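(* Let $(M,\mathsf{g})$ be a Riemannian manifold, let $\tilde X,\sigma_1,\ldots,\sigma_m\in\mathfrak{X}(M)$ be smooth vector fields, and let $W_1,\ldots,W_m$ be independent real-valued Wiener processes. Consider the stochastic differential equation on $M$, in the Itô sense, $$dx=\tilde X(x)\,dt+\sum_{i=1}^m\sigma_i(x)\,dW_i ,$$ and let $D=\sum_{i=1}^m\sigma_i\otimes\sigma_i$ be its diffusion tensor field, of type $(2,0)$. Then the Fokker--Planck equation $\frac{\partial p_t}{\partial t}=\mathcal{A}^*p_t$ corresponding to this equation, where $\mathcal{A}^*$ is the $L^2$-adjoint of the infinitesimal generator $\mathcal{A}$ of the process, is $$\frac{\partial p_t}{\partial t}=-\mathrm{div}_\mu(p_t\tilde X)+\frac12\,\mathrm{div}_\mu\big(\mathrm{div}_\mu(p_tD)\big),$$ where the inner divergence in the last term is the tensor divergence acting on the $(2,0)$ tensor field $p_tD$, and the outer divergence is the divergence of the resulting vector field (a $(1,0)$ tensor field).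
   Context: $(M,\mathsf{g})$ is an $n$-dimensional smooth Riemannian manifold with Riemannian volume form $\mu$ and Levi-Civita connection $\nabla$; $\mathfrak{X}(M)$ is the set of smooth vector fields, $\Omega^1(M)$ the set of smooth one-forms, $C_c^\infty(M)$ the set of smooth compactly supported real functions. For $f\in C^\infty(M)$ and $X\in\mathfrak{X}(M)$, $X[f]=df(X)$. A tensor field of type $(r,s)$ is a $C^\infty(M)$-multilinear map taking $r$ one-forms and $s$ vector fields to $C^\infty(M)$. For vector fields $X,Y$, $(X\otimes Y)(\alpha,\beta)=\alpha(X)\beta(Y)$. The connection is extended to tensor fields in the usual way (Leibniz rule). Divergence: for a vector field, $\mathrm{div}_\mu X=\mathrm{tr}(Y\mapsto\nabla_YX)$. For a tensor field $T$ of type $(r,s)$ with $r\ge1$, $\mathrm{div}_\mu T$ is the $(r-1,s)$ tensor field obtained by contracting the last contravariant slot with the derivative slot: $$(\mathrm{div}_\mu T)(\alpha^1,\ldots,\alpha^{r-1},v_1,\ldots,v_s)=\sum_{i=1}^n(\nabla_{E_i}T)(\alpha^1,\ldots,\alpha^{r-1},E^i,v_1,\ldots,v_s),$$ where $\{E_i\}$ is a local orthonormal frame and $\{E^i\}$ its dual coframe. The infinitesimal generator of a continuous stochastic process $x(t)$ on $M$ is the differential operator $\mathcal{A}:C^\infty(M)\to C^\infty(M)$, $$(\mathcal{A}f)(x_0)=\lim_{t\to0^+}\frac{\mathbb{E}[f(x(t))\mid x(0)=x_0]-f(x_0)}{t}.$$ Convention on Itô equations: the Itô equation $dx=\tilde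 X\,dt+\sum_i\sigma_i\,dW_i$ on $M$ is equivalent to the Stratonovich equation $dx=X\,dt+\sum_i\sigma_i\circ dW_i$ with drift $X$ determined by $\tilde X=X+\tfrac12\sum_{i=1}^m\nabla_{\sigma_i}\sigma_i$. The generator of the Stratonovich equation is the standard (recalled) one: $\mathcal{A}f=X[f]+\tfrac12\sum_{i=1}^m\sigma_i[\sigma_i[f]]$. The $L^2$-inner product of $p,q\in C_c^\infty(M)$ is $\langle p,q\rangle=\int_Mp\,q\,d\mu$. The adjoint $\mathcal{A}^*:C_c^\infty(M)\to C_c^\infty(M)$ is the unique operator with $\langle p,\mathcal{A}q\rangle=\langle\mathcal{A}^*p,q\rangle$ for all $p,q\in C_c^\infty(M)$. The Fokker--Planck equation of the process, for the density $p_t(x)=p(t,x)$ with respect to $\mu$, is by definition $\frac{\partial p_t}{\partial t}=\mathcal{A}^*p_t$. Thus to assert that the Fokker--Planck equation is $\frac{\partial p_t}{\partial t}=F(p_t)$ for a differential operator $F$ means that $\mathcal{A}^*p=F(p)$ for all $p\in C_c^\infty(M)$. *)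

theory Defs
  imports "HOL-Analysis.Analysis"
begin

section \<open>Smooth functions on open subsets of Euclidean space\<close>

text \<open>\<open>C\<^sup>k\<close>, and hence \<open>C\<^sup>\<infinity>\<close>, on an open set, by existence and continuity of iterated partial
  derivatives. The definitions are only meant for open \<open>U\<close>.\<close>

fun Ck_on :: "nat \<Rightarrow> 'e::euclidean_space set \<Rightarrow> ('e \<Rightarrow> 'b::real_normed_vector) \<Rightarrow> bool" where
  "Ck_on 0 U f \<longleftrightarrow> continuous_on U f"
| "Ck_on (Suc k) U f \<longleftrightarrow>
     f differentiable_on U \<and> (\<forall>b\<in>Basis. Ck_on k U (\<lambda>x. frechet_derivative f (at x) b))"

definition smooth_on :: "'e::euclidean_space set \<Rightarrow> ('e \<Rightarrow> 'b::real_normed_vector) \<Rightarrow> bool" where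
  "smooth_on U f \<longleftrightarrow> (\<forall>k. Ck_on k U f)"


section \<open>Smooth manifolds\<close>

text \<open>The points of the manifold are all elements of a Hausdorff second countable type \<open>'a\<close>; the
  dimension is \<open>n = CARD('n)\<close>. A chart is a pair of its domain and its coordinate map. The atlas
  need not be maximal.\<close>

type_synonym ('a, 'n) chart = "'a set \<times> ('a \<Rightarrow> real ^ 'n)"

definition smooth_atlas ::
    "('a::{t2_space, second_countable_topology}, 'n::finite) chart set \<Rightarrow> bool" where
  "smooth_atlas \<A> \<longleftrightarrow>
     (\<forall>(U, \<phi>)\<in>\<A>. open U \<and> open (\<phi> ` U) \<and> homeomorphism U (\<phi> ` U) \<phi> (inv_into U \<phi>)) \<and>
     (\<Union>(U, \<phi>)\<in>\<A>. U) = UNIV \<and>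
     (\<forall>(U, \<phi>)\<in>\<A>. \<forall>(V, \<psi>)\<in>\<A>. smooth_on (\<phi> ` (U \<inter> V)) (\<psi> \<circ> inv_into U \<phi>))"

definition Cinf :: "('a, 'n::finite) chart set \<Rightarrow> ('a \<Rightarrow> real) set" where
  "Cinf \<A> = {f. \<forall>(U, \<phi>)\<in>\<A>. smooth_on (\<phi> ` U) (f \<circ> inv_into U \<phi>)}"

definition Cinf_c :: "('a::topological_space, 'n::finite) chart set \<Rightarrow> ('a \<Rightarrow> real) set" where
  "Cinf_c \<A> = {f \<in> Cinf \<A>. compact (closure {x. f x \<noteq> 0})}"


section \<open>Vector fields and one-forms\<close>

text \<open>A tangent vector at \<open>x\<close> is a derivation at \<open>x\<close> of the algebra of smooth functions. It is
  set to \<open>0\<close> on non-smooth functions, so that tangent vectors are determined by their values on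
  smooth functions. Thus \<open>X[f]\<close> is \<open>\<lambda>x. X x f\<close>.\<close>

type_synonym 'a tangent = "('a \<Rightarrow> real) \<Rightarrow> real"
type_synonym 'a vfield = "'a \<Rightarrow> 'a tangent"

definition tangent_space :: "('a, 'n::finite) chart set \<Rightarrow> 'a \<Rightarrow> 'a tangent set" where
  "tangent_space \<A> x = {v.
     (\<forall>f\<in>Cinf \<A>. \<forall>h\<in>Cinf \<A>. v (\<lambda>y. f y + h y) = v f + v h) \<and>
     (\<forall>c. \<forall>f\<in>Cinf \<A>. v (\<lambda>y. c * f y) = c * v f) \<and>
     (\<forall>f\<in>Cinf \<A>. \<forall>h\<in>Cinf \<A>. v (\<lambda>y. f y * h y) = f x * v h + h x * v f) \<and>
     (\<forall>f. f \<notin> Cinf \<A> \<longrightarrow> v f = 0)}"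

definition vector_fields :: "('a, 'n::finite) chart set \<Rightarrow> 'a vfield set" where
  "vector_fields \<A> =
     {X. (\<forall>x. X x \<in> tangent_space \<A> x) \<and> (\<forall>f\<in>Cinf \<A>. (\<lambda>x. X x f) \<in> Cinf \<A>)}"

definition vf_add :: "'a vfield \<Rightarrow> 'a vfield \<Rightarrow> 'a vfield" where
  "vf_add X Y = (\<lambda>x f. X x f + Y x f)"

definition vf_scale :: "('a \<Rightarrow> real) \<Rightarrow> 'a vfield \<Rightarrow> 'a vfield" where
  "vf_scale h X = (\<lambda>x f. h x * X x f)"

text \<open>The coordinate vector \<open>\<partial>\<^sub>i\<close> at \<open>x\<close> of a chart around \<open>x\<close>.\<close>

definition coord_vector ::
    "('a, 'n::finite) chart set \<Rightarrow> ('a, 'n) chart \<Rightarrow> 'n \<Rightarrow> 'a \<Rightarrow> 'a tangent" where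
  "coord_vector \<A> c i x = (\<lambda>f. if f \<in> Cinf \<A>
     then frechet_derivative (f \<circ> inv_into (fst c) (snd c)) (at (snd c x)) (axis i 1) else 0)"

text \<open>One-forms are \<open>C\<^sup>\<infinity>(M)\<close>-linear maps from vector fields to smooth functions; they are set
  to \<open>0\<close> outside the vector fields.\<close>

type_synonym 'a oneform = "'a vfield \<Rightarrow> 'a \<Rightarrow> real"

definition one_forms :: "('a, 'n::finite) chart set \<Rightarrow> 'a oneform set" where
  "one_forms \<A> = {\<alpha>.
     (\<forall>X\<in>vector_fields \<A>. \<alpha> X \<in> Cinf \<A>) \<and>
     (\<forall>X\<in>vector_fields \<A>. \<forall>Y\<in>vector_fields \<A>. \<alpha> (vf_add X Y) = (\<lambda>x. \<alpha> X x + \<alpha> Y x)) \<and>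
     (\<forall>h\<in>Cinf \<A>. \<forall>X\<in>vector_fields \<A>. \<alpha> (vf_scale h X) = (\<lambda>x. h x * \<alpha> X x)) \<and>
     (\<forall>X. X \<notin> vector_fields \<A> \<longrightarrow> \<alpha> X = (\<lambda>x. 0))}"


section \<open>Riemannian metrics, Levi-Civita connection, Riemannian volume\<close>

type_synonym 'a metric = "'a \<Rightarrow> 'a tangent \<Rightarrow> 'a tangent \<Rightarrow> real"

definition riemannian_metric :: "('a, 'n::finite) chart set \<Rightarrow> 'a metric \<Rightarrow> bool" where
  "riemannian_metric \<A> g \<longleftrightarrow>
     (\<forall>x. \<forall>u\<in>tangent_space \<A> x. \<forall>v\<in>tangent_space \<A> x. \<forall>w\<in>tangent_space \<A> x. \<forall>c.
        g x (\<lambda>f. u f + c * v f) w = g x u w + c * g x v w) \<and>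
     (\<forall>x. \<forall>v\<in>tangent_space \<A> x. \<forall>w\<in>tangent_space \<A> x. g x v w = g x w v) \<and>
     (\<forall>x. \<forall>v\<in>tangent_space \<A> x. v \<noteq> (\<lambda>f. 0) \<longrightarrow> g x v v > 0) \<and>
     (\<forall>X\<in>vector_fields \<A>. \<forall>Y\<in>vector_fields \<A>. (\<lambda>x. g x (X x) (Y x)) \<in> Cinf \<A>)"

definition riemannian_manifold ::
    "('a::{t2_space, second_countable_topology}, 'n::finite) chart set \<Rightarrow> 'a metric \<Rightarrow> bool" where
  "riemannian_manifold \<A> g \<longleftrightarrow> smooth_atlas \<A> \<and> riemannian_metric \<A> g"

type_synonym 'a connection = "'a vfield \<Rightarrow> 'a vfield \<Rightarrow> 'a vfield"

text \<open>\<open>nabla X Y\<close> is \<open>\<nabla>\<^sub>X Y\<close>.\<close>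

definition affine_connection :: "('a, 'n::finite) chart set \<Rightarrow> 'a connection \<Rightarrow> bool" where
  "affine_connection \<A> nabla \<longleftrightarrow>
     (\<forall>X\<in>vector_fields \<A>. \<forall>Y\<in>vector_fields \<A>. nabla X Y \<in> vector_fields \<A>) \<and>
     (\<forall>X\<in>vector_fields \<A>. \<forall>Y\<in>vector_fields \<A>. \<forall>Z\<in>vector_fields \<A>.
        nabla (vf_add X Y) Z = vf_add (nabla X Z) (nabla Y Z) \<and>
        nabla X (vf_add Y Z) = vf_add (nabla X Y) (nabla X Z)) \<and>
     (\<forall>h\<in>Cinf \<A>. \<forall>X\<in>vector_fields \<A>. \<forall>Y\<in>vector_fields \<A>.
        nabla (vf_scale h X) Y = vf_scale h (nabla X Y) \<and>
        nabla X (vf_scale h Y) = vf_add (vf_scale (\<lambda>x. X x h) Y) (vf_scale h (nabla X Y)))"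

definition levi_civita ::
    "('a, 'n::finite) chart set \<Rightarrow> 'a metric \<Rightarrow> 'a connection \<Rightarrow> bool" where
  "levi_civita \<A> g nabla \<longleftrightarrow>
     affine_connection \<A> nabla \<and>
     (\<forall>X\<in>vector_fields \<A>. \<forall>Y\<in>vector_fields \<A>. \<forall>f\<in>Cinf \<A>. \<forall>x.
        nabla X Y x f - nabla Y X x f = X x (\<lambda>y. Y y f) - Y x (\<lambda>y. X y f)) \<and>
     (\<forall>X\<in>vector_fields \<A>. \<forall>Y\<in>vector_fields \<A>. \<forall>Z\<in>vector_fields \<A>. \<forall>x.
        X x (\<lambda>y. g y (Y y) (Z y)) = g x (nabla X Y x) (Z x) + g x (Y x) (nabla X Z x))"

definition gram_matrix ::
    "('a, 'n::finite) chart set \<Rightarrow> 'a metric \<Rightarrow> ('a, 'n) chart \<Rightarrow> 'a \<Rightarrow> real ^ 'n ^ 'n" where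
  "gram_matrix \<A> g c x = (\<chi> i j. g x (coord_vector \<A> c i x) (coord_vector \<A> c j x))"

text \<open>The Riemannian measure: density \<open>sqrt (det (g\<^sub>i\<^sub>j))\<close> with respect to Lebesgue measure in every
  chart. On an oriented manifold, integration against it is integration of functions against the
  Riemannian volume form.\<close>

definition riemannian_volume ::
    "('a::topological_space, 'n::finite) chart set \<Rightarrow> 'a metric \<Rightarrow> 'a measure \<Rightarrow> bool" where
  "riemannian_volume \<A> g \<mu> \<longleftrightarrow>
     sets \<mu> = sets borel \<and>
     (\<forall>(U, \<phi>)\<in>\<A>. \<forall>B\<in>sets borel. B \<subseteq> U \<longrightarrow>
        emeasure \<mu> B =
          (\<integral>\<^sup>+ y. ennreal (sqrt (det (gram_matrix \<A> g (U, \<phi>) (inv_into U \<phi> y)))) *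
                 indicator (\<phi> ` B) y \<partial>lborel))"


section \<open>Tensor fields and divergence\<close>

text \<open>A tensor field of type \<open>(r, s)\<close> takes a list of \<open>r\<close> one-forms and a list of \<open>s\<close> vector
  fields.\<close>

type_synonym 'a tensor = "'a oneform list \<Rightarrow> 'a vfield list \<Rightarrow> 'a \<Rightarrow> real"

definition vf_tensor :: "'a vfield \<Rightarrow> 'a vfield \<Rightarrow> 'a tensor" where
  "vf_tensor X Y = (\<lambda>\<alpha>s vs x. (\<alpha>s ! 0) X x * (\<alpha>s ! 1) Y x)"

definition tensor_scale :: "('a \<Rightarrow> real) \<Rightarrow> 'a tensor \<Rightarrow> 'a tensor" where
  "tensor_scale h T = (\<lambda>\<alpha>s vs x. h x * T \<alpha>s vs x)"

definition cov_oneform ::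
    "('a, 'n::finite) chart set \<Rightarrow> 'a connection \<Rightarrow> 'a vfield \<Rightarrow> 'a oneform \<Rightarrow> 'a oneform" where
  "cov_oneform \<A> nabla Y \<alpha> = (\<lambda>X x. if X \<in> vector_fields \<A>
     then Y x (\<alpha> X) - \<alpha> (nabla Y X) x else 0)"

definition cov_tensor ::
    "('a, 'n::finite) chart set \<Rightarrow> 'a connection \<Rightarrow> 'a vfield \<Rightarrow> 'a tensor \<Rightarrow> 'a tensor" where
  "cov_tensor \<A> nabla Y T = (\<lambda>\<alpha>s vs x.
     Y x (T \<alpha>s vs)
     - (\<Sum>k<length \<alpha>s. T (\<alpha>s[k := cov_oneform \<A> nabla Y (\<alpha>s ! k)]) vs x)
     - (\<Sum>k<length vs. T \<alpha>s (vs[k := nabla Y (vs ! k)]) x))"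

text \<open>A local orthonormal frame around \<open>x\<close> and its dual coframe are represented by globally defined
  vector fields and one-forms that satisfy the frame relations on a neighbourhood of \<open>x\<close>. Every
  local orthonormal frame has this form after shrinking its domain (multiply by a cutoff function).
  The contractions below do not depend on the frame.\<close>

definition orthonormal_frame_at ::
    "('a::topological_space, 'n::finite) chart set \<Rightarrow> 'a metric \<Rightarrow> 'a \<Rightarrow>
     ('n \<Rightarrow> 'a vfield) \<times> ('n \<Rightarrow> 'a oneform) \<Rightarrow> bool" where
  "orthonormal_frame_at \<A> g x = (\<lambda>(E, \<epsilon>).
     (\<forall>i. E i \<in> vector_fields \<A> \<and> \<epsilon> i \<in> one_forms \<A>) \<and>
     (\<exists>U. open U \<and> x \<in> U \<and> (\<forall>y\<in>U. \<forall>i j.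
        g y (E i y) (E j y) = (if i = j then 1 else 0) \<and>
        \<epsilon> i (E j) y = (if i = j then 1 else 0))))"

definition orthonormal_frame ::
    "('a::topological_space, 'n::finite) chart set \<Rightarrow> 'a metric \<Rightarrow> 'a \<Rightarrow>
     ('n \<Rightarrow> 'a vfield) \<times> ('n \<Rightarrow> 'a oneform)" where
  "orthonormal_frame \<A> g x = (SOME F. orthonormal_frame_at \<A> g x F)"

definition trace_at ::
    "('a::topological_space, 'n::finite) chart set \<Rightarrow> 'a metric \<Rightarrow> 'a \<Rightarrow>
     ('a vfield \<Rightarrow> 'a vfield) \<Rightarrow> real" where
  "trace_at \<A> g x \<Phi> = (let (E, \<epsilon>) = orthonormal_frame \<A> g x in \<Sum>i\<in>UNIV. \<epsilon> i (\<Phi> (E i)) x)"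

definition vf_div ::
    "('a::topological_space, 'n::finite) chart set \<Rightarrow> 'a metric \<Rightarrow> 'a connection \<Rightarrow>
     'a vfield \<Rightarrow> 'a \<Rightarrow> real" where
  "vf_div \<A> g nabla X = (\<lambda>x. trace_at \<A> g x (\<lambda>Y. nabla Y X))"

definition tensor_div ::
    "('a::topological_space, 'n::finite) chart set \<Rightarrow> 'a metric \<Rightarrow> 'a connection \<Rightarrow>
     'a tensor \<Rightarrow> 'a tensor" where
  "tensor_div \<A> g nabla T = (\<lambda>\<alpha>s vs x.
     let (E, \<epsilon>) = orthonormal_frame \<A> g x
     in \<Sum>i\<in>UNIV. cov_tensor \<A> nabla (E i) T (\<alpha>s @ [\<epsilon> i]) vs x)"


section \<open>Generators of stochastic differential equations and the Fokker--Planck operator\<close>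

text \<open>Noise vector fields \<open>\<sigma>\<^sub>1, \<dots>, \<sigma>\<^sub>m\<close> are given by \<open>\<sigma> :: nat \<Rightarrow> 'a vfield\<close> on indices
  \<open>1, \<dots>, m\<close>.\<close>

definition stratonovich_generator ::
    "nat \<Rightarrow> 'a vfield \<Rightarrow> (nat \<Rightarrow> 'a vfield) \<Rightarrow> ('a \<Rightarrow> real) \<Rightarrow> 'a \<Rightarrow> real" where
  "stratonovich_generator m X \<sigma> f =
     (\<lambda>x. X x f + 1/2 * (\<Sum>i=1..m. \<sigma> i x (\<lambda>y. \<sigma> i y f)))"

text \<open>The drift of the Stratonovich equation that is equivalent to the Ito equation with drift
  \<open>Xt\<close>.\<close>

definition stratonovich_drift ::
    "'a connection \<Rightarrow> nat \<Rightarrow> 'a vfield \<Rightarrow> (nat \<Rightarrow> 'a vfield) \<Rightarrow> 'a vfield" where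
  "stratonovich_drift nabla m Xt \<sigma> =
     (\<lambda>x f. Xt x f - 1/2 * (\<Sum>i=1..m. nabla (\<sigma> i) (\<sigma> i) x f))"

definition ito_generator ::
    "'a connection \<Rightarrow> nat \<Rightarrow> 'a vfield \<Rightarrow> (nat \<Rightarrow> 'a vfield) \<Rightarrow> ('a \<Rightarrow> real) \<Rightarrow> 'a \<Rightarrow> real" where
  "ito_generator nabla m Xt \<sigma> = stratonovich_generator m (stratonovich_drift nabla m Xt \<sigma>) \<sigma>"

definition diffusion_tensor :: "nat \<Rightarrow> (nat \<Rightarrow> 'a vfield) \<Rightarrow> 'a tensor" where
  "diffusion_tensor m \<sigma> = (\<lambda>\<alpha>s vs x. \<Sum>i=1..m. vf_tensor (\<sigma> i) (\<sigma> i) \<alpha>s vs x)"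

definition L2_inner :: "'a measure \<Rightarrow> ('a \<Rightarrow> real) \<Rightarrow> ('a \<Rightarrow> real) \<Rightarrow> real" where
  "L2_inner \<mu> p q = (\<integral>x. p x * q x \<partial>\<mu>)"

definition is_L2_adjoint_at ::
    "('a::topological_space, 'n::finite) chart set \<Rightarrow> 'a measure \<Rightarrow>
     (('a \<Rightarrow> real) \<Rightarrow> 'a \<Rightarrow> real) \<Rightarrow> ('a \<Rightarrow> real) \<Rightarrow> ('a \<Rightarrow> real) \<Rightarrow> bool" where
  "is_L2_adjoint_at \<A> \<mu> L p r \<longleftrightarrow>
     r \<in> Cinf_c \<A> \<and> (\<forall>q\<in>Cinf_c \<A>. L2_inner \<mu> p (L q) = L2_inner \<mu> r q)"

definition L2_adjoint ::
    "('a::topological_space, 'n::finite) chart set \<Rightarrow> 'a measure \<Rightarrow>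
     (('a \<Rightarrow> real) \<Rightarrow> 'a \<Rightarrow> real) \<Rightarrow> ('a \<Rightarrow> real) \<Rightarrow> 'a \<Rightarrow> real" where
  "L2_adjoint \<A> \<mu> L p = (THE r. is_L2_adjoint_at \<A> \<mu> L p r)"

end

theory Submission
  imports Defs
begin

text \<open>Up to exact divergences, the Fokker--Planck operator is what integration by parts makes of the
generator. For a noise field \<open>\<sigma>\<close> and smooth \<open>p\<close>, \<open>q\<close>, two applications of the product rule
\<open>div (f X) = f div X + X[f]\<close> give
\<open>p \<sigma>[\<sigma>[q]] - p (\<nabla>\<^sub>\<sigma> \<sigma>)[q] = q div (div (p \<sigma>) \<sigma> + p \<nabla>\<^sub>\<sigma> \<sigma>) + (divergences)\<close>,
where each remaining divergence is that of a vector field multiplied by a compactly supported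
function; likewise \<open>p X[q] = - q div (p X) + div (p q X)\<close>. Hence the theorem is the conjunction of
two facts.

The algebraic fact is that \<open>div (p \<sigma> \<otimes> \<sigma>)\<close> is the vector field \<open>div (p \<sigma>) \<sigma> + p \<nabla>\<^sub>\<sigma> \<sigma>\<close>, in the sense
that it sends a one-form to its value on this field (\<open>tensor_div_diffusion\<close>). This is the
Leibniz rule followed by a contraction, and it explains the \<open>\<nabla>\<^sub>\<sigma> \<sigma>\<close> in the conversion from Ito to
Stratonovich drift: that term is exactly the one that completes \<open>div (p \<sigma>) \<sigma>\<close> to a tensor
divergence. The contraction needs an orthonormal frame with global vector fields and its dual
coframe (\<open>gram_schmidt\<close>), and the fact that one-forms and connections act pointwise in the arguments
in which they are linear over smooth functions (\<open>tensorial_sum\<close>).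

The analytic fact is the divergence theorem \<open>\<integral> div (f X) d\<mu> = 0\<close> for compactly supported \<open>f\<close>
(\<open>divergence_theorem\<close>). In coordinates with Gram matrix \<open>G\<close>, the Levi-Civita conditions and Jacobi's
formula for the derivative of a determinant give \<open>\<partial>\<^sub>j det G = 2 (div \<partial>\<^sub>j) det G\<close>
(\<open>gram_det_deriv\<close>). So \<open>sqrt (det G) div (f X)\<close> is a sum of partial derivatives of compactly supported
functions, and these have integral zero by translation invariance of Lebesgue measure
(\<open>integral_derivative_eq_0\<close>). Cutoff functions reduce the general case to functions supported in one
coordinate neighbourhood.

Uniqueness of the adjoint holds because the difference \<open>d\<close> of two candidates is itself a test
function, so \<open>\<integral> d\<^sup>2 d\<mu> = 0\<close>, and \<open>\<mu>\<close> charges every nonempty open set.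

Tangent vectors are derivations of the algebra of global smooth functions. The two bridges between
such derivations and coordinates are smooth cutoff functions (\<open>manifold_bump\<close>), which make derivations
local, and Hadamard's lemma, which makes the coordinate vectors span the tangent space
(\<open>tangent_expand\<close>).\<close>

section \<open>Calculus of smooth functions\<close>

text \<open>Premise \<open>cong\<close> says that \<open>Ck_on k U\<close> only depends on the values in \<open>U\<close>. It is a premise because
that is proved from this rule by induction on \<open>k\<close>; afterwards \<open>Ck_on_deriv\<close> replaces the rule.\<close>

lemma Ck_on_SucI:
  assumes "\<And>x. x \<in> U \<Longrightarrow> (f has_derivative f' x) (at x)"
    and "\<And>b. b \<in> Basis \<Longrightarrow> Ck_on k U (\<lambda>x. f' x b)"
    and cong: "\<And>(g::'e::euclidean_space \<Rightarrow> 'b::real_normed_vector) h. (\<And>x. x \<in> U \<Longrightarrow> g x = h x) \<Longrightarrow> Ck_on k U g \<Longrightarrow> Ck_on k U h"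
  shows "Ck_on (Suc k) U (f :: 'e \<Rightarrow> 'b)"
proof -
  have fd: "frechet_derivative f (at x) = f' x" if "x \<in> U" for x
    using assms(1)[OF that] by (metis frechet_derivative_at)
  have "f differentiable_on U"
    unfolding differentiable_on_def
    using assms(1) by (meson differentiableI differentiable_at_withinI)
  moreover have "Ck_on k U (\<lambda>x. frechet_derivative f (at x) b)" if "b \<in> Basis" for b
    by (rule cong[OF _ assms(2)[OF that]]) (simp add: fd)
  ultimately show ?thesis by simp
qed

lemma Ck_on_cong_imp:
  fixes f h :: "'e::euclidean_space \<Rightarrow> 'b::real_normed_vector"
  assumes "open U"
  shows "(\<And>x. x \<in> U \<Longrightarrow> f x = h x) \<Longrightarrow> Ck_on k U f \<Longrightarrow> Ck_on k U h"
proof (induction k arbitrary: f h)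
  case 0
  then show ?case using continuous_on_cong by (metis Ck_on.simps(1))
next
  case (Suc k)
  have d: "(h has_derivative frechet_derivative f (at x)) (at x)" if "x \<in> U" for x
  proof -
    have "f differentiable (at x)"
      using Suc.prems(2) that assms by (simp add: differentiable_on_eq_differentiable_at)
    then have "(f has_derivative frechet_derivative f (at x)) (at x)"
      using frechet_derivative_works by blast
    then show ?thesis
      using has_derivative_transform_within_open[OF _ assms that] Suc.prems(1) by blast
  qed
  show ?case
    by (rule Ck_on_SucI[of U h "\<lambda>x. frechet_derivative f (at x)"])
      (use d Suc in \<open>auto intro: Suc.IH\<close>)
qed

lemma Ck_on_cong:
  assumes "open U" "\<And>x. x \<in> U \<Longrightarrow> f x = h x"
  shows "Ck_on k U f \<longleftrightarrow> Ck_on k U h"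
  using Ck_on_cong_imp[OF assms(1)] assms(2) by metis

lemma smooth_on_cong:
  assumes "open U" "\<And>x. x \<in> U \<Longrightarrow> f x = h x"
  shows "smooth_on U f \<longleftrightarrow> smooth_on U h"
  using Ck_on_cong[OF assms] by (simp add: smooth_on_def)

lemma Ck_on_deriv:
  assumes "open U" "\<And>x. x \<in> U \<Longrightarrow> (f has_derivative f' x) (at x)"
    and "\<And>b. b \<in> Basis \<Longrightarrow> Ck_on k U (\<lambda>x. f' x b)"
  shows "Ck_on (Suc k) U f"
  by (rule Ck_on_SucI[OF assms(2,3)]) (use Ck_on_cong_imp[OF assms(1)] in \<open>auto\<close>)

lemma Ck_on_has_derivative:
  assumes "open U" "Ck_on (Suc k) U f" "x \<in> U"
  shows "(f has_derivative frechet_derivative f (at x)) (at x)"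
  using assms by (simp add: differentiable_on_eq_differentiable_at frechet_derivative_works)

lemma Ck_on_continuous: "open U \<Longrightarrow> Ck_on k U f \<Longrightarrow> continuous_on U f"
  by (cases k) (auto intro: differentiable_imp_continuous_on)

lemma Ck_on_Suc_imp: "open U \<Longrightarrow> Ck_on (Suc k) U f \<Longrightarrow> Ck_on k U f"
proof (induction k arbitrary: f)
  case 0
  then show ?case by (simp add: differentiable_imp_continuous_on)
next
  case (Suc k)
  then show ?case by (metis Ck_on.simps(2))
qed

lemma Ck_on_local:
  assumes "\<And>x. x \<in> U \<Longrightarrow> \<exists>V. open V \<and> x \<in> V \<and> Ck_on k V f" "open U"
  shows "Ck_on k U f"
  using assms(1)
proof (induction k arbitrary: f)
  case 0
  have "continuous (at x) f" if x: "x \<in> U" for x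
    using 0[OF x] by (metis Ck_on.simps(1) continuous_on_eq_continuous_at)
  then show ?case using continuous_at_imp_continuous_on by auto
next
  case (Suc k)
  have "f differentiable (at x)" if x: "x \<in> U" for x
    using Suc.prems[OF x] by (metis Ck_on.simps(2) differentiable_on_eq_differentiable_at)
  then have "f differentiable_on U"
    by (simp add: assms(2) differentiable_on_eq_differentiable_at)
  moreover have "Ck_on k U (\<lambda>x. frechet_derivative f (at x) b)" if b: "b \<in> Basis" for b
    by (rule Suc.IH) (metis Suc.prems Ck_on.simps(2) b)
  ultimately show ?case by simp
qed

lemma smooth_on_local:
  assumes "\<And>x. x \<in> U \<Longrightarrow> \<exists>V. open V \<and> x \<in> V \<and> smooth_on V f" "open U"
  shows "smooth_on U f"
  unfolding smooth_on_def
  using assms Ck_on_local[of U _ f] by (metis smooth_on_def)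

lemma Ck_on_subset: "Ck_on k U f \<Longrightarrow> V \<subseteq> U \<Longrightarrow> Ck_on k V f"
  by (induction k arbitrary: f) (auto intro: continuous_on_subset differentiable_on_subset)

lemma smooth_on_subset: "smooth_on U f \<Longrightarrow> V \<subseteq> U \<Longrightarrow> smooth_on V f"
  by (auto simp: smooth_on_def intro: Ck_on_subset)

lemma Ck_on_const [simp]: "Ck_on k U (\<lambda>x. c)"
proof (induction k arbitrary: c)
  case (Suc k)
  then show ?case by (auto simp: frechet_derivative_const)
qed auto

lemma smooth_on_const [simp]: "smooth_on U (\<lambda>x. c)"
  by (simp add: smooth_on_def)

lemma Ck_on_bounded_linear:
  assumes "open U" "bounded_linear L" shows "Ck_on k U L"
proof (cases k)
  case 0
  then show ?thesis using assms linear_continuous_on by auto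
next
  case (Suc j)
  show ?thesis unfolding Suc
    by (rule Ck_on_deriv[OF assms(1) bounded_linear_imp_has_derivative[OF assms(2)]]) simp
qed

lemma smooth_on_bounded_linear:
  assumes "open U" "bounded_linear L" shows "smooth_on U L"
  using Ck_on_bounded_linear[OF assms] by (simp add: smooth_on_def)

lemma Ck_on_add:
  assumes "open U"
  shows "Ck_on k U f \<Longrightarrow> Ck_on k U h \<Longrightarrow> Ck_on k U (\<lambda>x. f x + h x)"
proof (induction k arbitrary: f h)
  case 0
  then show ?case by (auto intro: continuous_intros)
next
  case (Suc k)
  show ?case
    by (rule Ck_on_deriv[OF assms has_derivative_add[OF Ck_on_has_derivative[OF assms Suc.prems(1)]
            Ck_on_has_derivative[OF assms Suc.prems(2)]]])
      (use Suc in auto)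
qed

lemma smooth_on_add:
  "open U \<Longrightarrow> smooth_on U f \<Longrightarrow> smooth_on U h \<Longrightarrow> smooth_on U (\<lambda>x. f x + h x)"
  by (simp add: smooth_on_def Ck_on_add)

lemma Ck_on_sum:
  assumes "open U" "\<And>i. i \<in> I \<Longrightarrow> Ck_on k U (f i)"
  shows "Ck_on k U (\<lambda>x. \<Sum>i\<in>I. f i x)"
  using assms(2) by (induction I rule: infinite_finite_induct) (auto intro: Ck_on_add[OF assms(1)])

lemma smooth_on_sum:
  assumes "open U" "\<And>i. i \<in> I \<Longrightarrow> smooth_on U (f i)"
  shows "smooth_on U (\<lambda>x. \<Sum>i\<in>I. f i x)"
  using assms by (simp add: smooth_on_def Ck_on_sum)

lemma Ck_on_scaleR:
  fixes f :: "'e::euclidean_space \<Rightarrow> real" and h :: "'e \<Rightarrow> 'b::real_normed_vector"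
  assumes "open U"
  shows "Ck_on k U f \<Longrightarrow> Ck_on k U h \<Longrightarrow> Ck_on k U (\<lambda>x. f x *\<^sub>R h x)"
proof (induction k arbitrary: f h)
  case 0
  then show ?case by (auto intro: continuous_intros)
next
  case (Suc k)
  show ?case
    by (rule Ck_on_deriv[OF assms has_derivative_scaleR[OF Ck_on_has_derivative[OF assms Suc.prems(1)]
            Ck_on_has_derivative[OF assms Suc.prems(2)]]])
      (use Suc Ck_on_Suc_imp[OF assms Suc.prems(1)] Ck_on_Suc_imp[OF assms Suc.prems(2)]
        in \<open>auto intro!: Ck_on_add[OF assms] Suc.IH\<close>)
qed

lemma smooth_on_mult:
  fixes f h :: "'e::euclidean_space \<Rightarrow> real"
  shows "open U \<Longrightarrow> smooth_on U f \<Longrightarrow> smooth_on U h \<Longrightarrow> smooth_on U (\<lambda>x. f x * h x)"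
  using Ck_on_scaleR[of U _ f h] by (simp add: smooth_on_def)

lemma Ck_on_linear_comp:
  assumes "open U" "bounded_linear L"
  shows "Ck_on k U f \<Longrightarrow> Ck_on k U (\<lambda>x. L (f x))"
proof (induction k arbitrary: f)
  case 0
  then show ?case
    using bounded_linear.continuous_on[OF assms(2)] by auto
next
  case (Suc k)
  show ?case
    by (rule Ck_on_deriv[OF assms(1) bounded_linear.has_derivative[OF assms(2)
            Ck_on_has_derivative[OF assms(1) Suc.prems]]])
      (use Suc in auto)
qed

text \<open>By the chain rule, each partial derivative of \<open>h \<circ> f\<close> is a sum of products of a partial derivative of
a component of \<open>f\<close> with a partial derivative of \<open>h\<close> composed with \<open>f\<close>; the second factors are covered by
the induction hypothesis because \<open>h\<close> is arbitrary in it.\<close>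

lemma Ck_on_compose:
  fixes f :: "'e::euclidean_space \<Rightarrow> 'f::euclidean_space" and h :: "'f \<Rightarrow> 'b::real_normed_vector"
  assumes U: "open U" and V: "open V" and sub: "f ` U \<subseteq> V"
  shows "Ck_on k U f \<Longrightarrow> Ck_on k V h \<Longrightarrow> Ck_on k U (\<lambda>x. h (f x))"
proof (induction k arbitrary: h)
  case 0
  then show ?case using sub by (auto intro: continuous_on_compose2)
next
  case (Suc k)
  let ?f' = "\<lambda>x. frechet_derivative f (at x)" and ?h' = "\<lambda>y. frechet_derivative h (at y)"
  have d: "((\<lambda>x. h (f x)) has_derivative (\<lambda>b. \<Sum>c\<in>Basis. (?f' x b \<bullet> c) *\<^sub>R ?h' (f x) c)) (at x)"
    if x: "x \<in> U" for x
  proof -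
    have fx: "f x \<in> V" using x sub by auto
    have hd: "(h has_derivative ?h' (f x)) (at (f x))"
      by (rule Ck_on_has_derivative[OF V Suc.prems(2) fx])
    have "((\<lambda>x. h (f x)) has_derivative (\<lambda>b. ?h' (f x) (?f' x b))) (at x)"
      using has_derivative_compose[OF Ck_on_has_derivative[OF U Suc.prems(1) x] hd] .
    moreover have "?h' (f x) (?f' x b) = (\<Sum>c\<in>Basis. (?f' x b \<bullet> c) *\<^sub>R ?h' (f x) c)" for b
    proof -
      have lin: "linear (?h' (f x))" using hd has_derivative_linear by blast
      have "?h' (f x) (?f' x b) = ?h' (f x) (\<Sum>c\<in>Basis. (?f' x b \<bullet> c) *\<^sub>R c)"
        by (simp add: euclidean_representation)
      also have "\<dots> = (\<Sum>c\<in>Basis. (?f' x b \<bullet> c) *\<^sub>R ?h' (f x) c)"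
        by (simp add: linear_sum[OF lin] linear_cmul[OF lin])
      finally show ?thesis .
    qed
    ultimately show ?thesis by simp
  qed
  have fk: "Ck_on k U f" using Ck_on_Suc_imp[OF U Suc.prems(1)] .
  show ?case
  proof (rule Ck_on_deriv[OF U d], assumption, rule Ck_on_sum[OF U], rule Ck_on_scaleR[OF U])
    fix b c :: "'f" and b' :: 'e assume "b' \<in> Basis" "c \<in> Basis"
    then show "Ck_on k U (\<lambda>x. ?f' x b' \<bullet> c)"
      using Ck_on_linear_comp[OF U bounded_linear_inner_left[of c]] Suc.prems(1) by auto
    show "Ck_on k U (\<lambda>x. ?h' (f x) c)"
      using Suc.IH[OF fk, of "\<lambda>y. ?h' y c"] Suc.prems(2) \<open>c \<in> Basis\<close> by auto
  qed
qed

lemma smooth_on_compose: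
  fixes f :: "'e::euclidean_space \<Rightarrow> 'f::euclidean_space"
  assumes "open U" "open V" "f ` U \<subseteq> V" "smooth_on U f" "smooth_on V h"
  shows "smooth_on U (\<lambda>x. h (f x))"
  using assms(4,5) Ck_on_compose[OF assms(1-3)] unfolding smooth_on_def by blast

lemma smooth_on_partial:
  "smooth_on U f \<Longrightarrow> b \<in> Basis \<Longrightarrow> smooth_on U (\<lambda>x. frechet_derivative f (at x) b)"
  unfolding smooth_on_def by (metis Ck_on.simps(2))

lemma smooth_on_has_derivative:
  "open U \<Longrightarrow> smooth_on U f \<Longrightarrow> x \<in> U \<Longrightarrow> (f has_derivative frechet_derivative f (at x)) (at x)"
  using Ck_on_has_derivative[of U 0 f x] unfolding smooth_on_def by blast

lemma smooth_on_continuous: "open U \<Longrightarrow> smooth_on U f \<Longrightarrow> continuous_on U f"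
  unfolding smooth_on_def using Ck_on_continuous by blast

text \<open>The derivative is a multiple of \<open>t powr (a - 1)\<close>, so the induction runs over all exponents at once.\<close>

lemma smooth_on_powr: "smooth_on {0<..} (\<lambda>t::real. t powr a)"
proof -
  have "Ck_on k {0<..} (\<lambda>t::real. t powr a)" for k
  proof (induction k arbitrary: a)
    case 0
    show ?case by (auto intro!: continuous_intros)
  next
    case (Suc k)
    have "((\<lambda>t. t powr a) has_derivative (\<lambda>h. (a * x powr (a - 1)) * h)) (at x)"
      if "x \<in> {0<..}" for x::real
      using has_real_derivative_powr[of x a] that by (simp add: has_field_derivative_def)
    then show ?case
      by (rule Ck_on_deriv[rotated])
        (use Ck_on_scaleR[of "{0<..}" k "\<lambda>_. a", OF _ _ Suc[of "a-1"]] in auto)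
  qed
  then show ?thesis by (simp add: smooth_on_def)
qed

subsection \<open>Bump functions\<close>

lemma flat_limit: "((\<lambda>t::real. exp (- inverse t) * inverse t ^ k) \<longlongrightarrow> 0) (at_right 0)"
proof -
  have "((\<lambda>t::real. (inverse t) ^ k / exp (inverse t)) \<longlongrightarrow> 0) (at_right 0)"
    using filterlim_compose[OF tendsto_power_div_exp_0 filterlim_inverse_at_top_right] .
  then show ?thesis
    by (simp add: exp_minus divide_inverse mult.commute)
qed

text \<open>The classical flat function \<open>exp (- 1 / t)\<close> is the case \<open>k = 0\<close>. The other members make the family
closed, up to linear combinations, under differentiation.\<close>

definition flat :: "nat \<Rightarrow> real \<Rightarrow> real" where
  "flat k t = (if t > 0 then exp (- inverse t) * inverse t ^ k else 0)"

lemma flat_deriv: "(flat k has_field_derivative flat (k+2) x - real k * flat (k+1) x) (at x)"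
proof -
  consider "x > 0" | "x < 0" | "x = 0" by linarith
  then show ?thesis
  proof cases
    case 1
    have "((\<lambda>t. exp (- inverse t) * inverse t ^ k) has_field_derivative flat (k+2) x - real k * flat (k+1) x) (at x)"
    proof -
      have e: "((\<lambda>t. exp (- inverse t)) has_field_derivative exp (- inverse x) * inverse x ^ 2) (at x)"
        using 1 by (auto intro!: derivative_eq_intros simp: power2_eq_square)
      have p: "((\<lambda>t. inverse t ^ k) has_field_derivative - real k * inverse x ^ (k + 1)) (at x)"
        using DERIV_power[OF DERIV_inverse[of x UNIV], of k] 1
        by (cases k) (auto simp: algebra_simps)
      show ?thesis
        using DERIV_mult[OF e p] 1 by (simp add: flat_def power_add power2_eq_square algebra_simps)
    qed
    moreover have "\<forall>\<^sub>F t in nhds x. exp (- inverse t) * inverse t ^ k = flat k t"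
      using eventually_nhds_in_open[of "{0<..}" x] 1
      by (auto elim!: eventually_mono simp: flat_def)
    ultimately show ?thesis by (subst (asm) DERIV_cong_ev[OF refl _ refl]) auto
  next
    case 2
    have "((\<lambda>t. 0) has_field_derivative flat (k+2) x - real k * flat (k+1) x) (at x)"
      using 2 by (auto simp: flat_def)
    moreover have "\<forall>\<^sub>F t in nhds x. 0 = flat k t"
      using eventually_nhds_in_open[of "{..<0}" x] 2
      by (auto elim!: eventually_mono simp: flat_def)
    ultimately show ?thesis by (subst (asm) DERIV_cong_ev[OF refl _ refl]) auto
  next
    case 3
    have "((\<lambda>h. flat k h / h) \<longlongrightarrow> 0) (at 0)"
    proof (subst filterlim_at_split, intro conjI)
      show "((\<lambda>h. flat k h / h) \<longlongrightarrow> 0) (at_left 0)"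
        by (rule tendsto_eventually) (auto simp: flat_def eventually_at_filter)
      have "\<forall>\<^sub>F t in at_right 0. exp (- inverse t) * inverse t ^ (Suc k) = flat k t / t"
        by (auto simp: flat_def eventually_at_filter divide_inverse mult_ac)
      then show "((\<lambda>h. flat k h / h) \<longlongrightarrow> 0) (at_right 0)"
        using flat_limit[of "Suc k"] by (metis (mono_tags) tendsto_cong)
    qed
    then show ?thesis using 3 by (simp add: DERIV_def flat_def)
  qed
qed

lemma smooth_on_flat: "smooth_on UNIV (flat 0)"
proof -
  have "Ck_on j UNIV (flat k)" for j k
  proof (induction j arbitrary: k)
    case 0
    show ?case using DERIV_isCont[OF flat_deriv[of k]]
      by (auto intro!: continuous_at_imp_continuous_on)
  next
    case (Suc j)
    have "Ck_on j UNIV (\<lambda>x. flat (k+2) x + (- real k) *\<^sub>R flat (k+1) x)"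
      by (intro Ck_on_add Ck_on_scaleR Suc) auto
    then show ?case
      using flat_deriv[of k] by (intro Ck_on_deriv[where f' = "\<lambda>x h. (flat (k+2) x - real k * flat (k+1) x) * h"])
        (auto simp: has_field_derivative_def)
  qed
  then show ?thesis by (simp add: smooth_on_def)
qed

text \<open>With \<open>e t = exp (- 1 / t)\<close> for \<open>t > 0\<close> and \<open>e t = 0\<close> otherwise, \<open>H t = e (2 - t) / (e (t - 1) + e (2 - t))\<close>
descends smoothly from \<open>1\<close> on \<open>t \<le> 1\<close> to \<open>0\<close> on \<open>t \<ge> 2\<close>. It is applied to the squared scaled distance,
which is a polynomial and hence smooth at the centre too.\<close>

lemma smooth_bump:
  fixes x0 :: "'e::euclidean_space"
  assumes "r > 0"
  obtains b :: "'e \<Rightarrow> real" where "smooth_on UNIV b" "\<And>y. dist y x0 < r \<Longrightarrow> b y = 1"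
    "\<And>y. dist y x0 \<ge> 2 * r \<Longrightarrow> b y = 0"
proof -
  define s where "s t = flat 0 (t - 1) + flat 0 (2 - t)" for t
  have spos: "s t > 0" for t
    by (cases "t > 1") (auto simp: s_def flat_def intro: add_pos_nonneg add_nonneg_pos)
  define H where "H t = flat 0 (2 - t) * s t powr (-1)" for t
  have aff: "smooth_on UNIV (\<lambda>t. flat 0 (a + c * t))" for a c :: real
    by (rule smooth_on_compose[OF _ _ _ _ smooth_on_flat])
      (auto intro!: smooth_on_add smooth_on_bounded_linear[OF _ bounded_linear_mult_right])
  have ss: "smooth_on UNIV s"
    unfolding s_def using smooth_on_add[OF _ aff[of "-1" 1] aff[of 2 "-1"]] by (simp add: algebra_simps)
  have sH: "smooth_on UNIV H"
    unfolding H_def using aff[of 2 "-1"]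
      smooth_on_compose[OF open_UNIV open_greaterThan _ ss smooth_on_powr[of "-1"]] spos
    by (intro smooth_on_mult) auto
  have H1: "H t = 1" if "t < 1" for t
    using that spos[of t] by (auto simp: H_def s_def flat_def powr_minus)
  have H0: "H t = 0" if "t \<ge> 2" for t
    using that by (auto simp: H_def flat_def)
  define q where "q y = (\<Sum>c\<in>Basis. ((y - x0) \<bullet> c) * ((y - x0) \<bullet> c)) * inverse (r^2)" for y :: 'e
  have q: "q y = (dist y x0 / r)^2" for y
  proof -
    have "(\<Sum>c\<in>Basis. ((y - x0) \<bullet> c) * ((y - x0) \<bullet> c)) = (dist y x0)^2"
      by (metis dist_norm power2_norm_eq_inner euclidean_inner)
    then show ?thesis by (simp add: q_def power_divide divide_inverse power_inverse power_mult_distrib)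
  qed
  have co: "smooth_on UNIV (\<lambda>y. (y - x0) \<bullet> c)" for c :: 'e
    using smooth_on_add[OF open_UNIV smooth_on_bounded_linear[OF open_UNIV bounded_linear_inner_left[of c]]
        smooth_on_const[of _ "-(x0 \<bullet> c)"]] by (simp add: inner_diff_left)
  have sq: "smooth_on UNIV q"
    unfolding q_def by (intro smooth_on_mult smooth_on_sum co) auto
  show thesis
  proof
    show "smooth_on UNIV (\<lambda>y. H (q y))"
      by (rule smooth_on_compose[OF _ _ _ sq sH]) auto
    show "H (q y) = 1" if "dist y x0 < r" for y
      using that assms by (intro H1) (simp add: q abs_square_less_1)
    show "H (q y) = 0" if "dist y x0 \<ge> 2 * r" for y
    proof (rule H0)
      have "2 \<le> dist y x0 / r" using that assms by (simp add: field_simps)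
      then have "2^2 \<le> (dist y x0 / r)^2" by (rule power_mono) simp
      then show "2 \<le> q y" by (simp add: q)
    qed
  qed
qed

subsection \<open>Hadamard's lemma\<close>

text \<open>Differentiation under the integral sign. Each differentiation produces a factor \<open>t\<close> from the inner
affine map; the weight \<open>t ^ j\<close> absorbs it, so that the induction hypothesis applies to the partial
derivatives of \<open>F\<close>.\<close>

lemma Ck_on_segment_integral:
  fixes x0 :: "'e::euclidean_space"
  assumes U: "open U" "convex U" "x0 \<in> U"
  shows "Ck_on k U F \<Longrightarrow> Ck_on k U (\<lambda>y. integral {0..1} (\<lambda>t. t ^ j * F (x0 + t *\<^sub>R (y - x0)) :: real))"
proof (induction k arbitrary: F j)
  have seg: "x0 + t *\<^sub>R (y - x0) \<in> U" if "y \<in> U" "t \<in> {0..1}" for t y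
  proof -
    have "(1 - t) *\<^sub>R x0 + t *\<^sub>R y \<in> U"
      using that U by (intro convexD_alt) auto
    then show ?thesis by (simp add: algebra_simps)
  qed
  have cont: "continuous_on (U \<times> {0..1}) (\<lambda>(y, t). t ^ j * F (x0 + t *\<^sub>R (y - x0)))"
    if F: "continuous_on U F" for F :: "'e \<Rightarrow> real" and j
    unfolding split_beta
    by (intro continuous_intros continuous_on_compose2[OF F]) (auto intro: seg)
  {
    case 0
    then show ?case
      using integral_continuous_on_param[of U 0 1 "\<lambda>y t. t ^ j * F (x0 + t *\<^sub>R (y - x0))"] cont[of F j]
      by simp
  next
    case (Suc k)
    let ?F' = "\<lambda>x. frechet_derivative F (at x)"
    let ?G = "\<lambda>y t. \<Sum>b\<in>Basis. (t ^ Suc j * ?F' (x0 + t *\<^sub>R (y - x0)) b) *\<^sub>R blinfun_inner_left b"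
    have contb: "continuous_on (U \<times> {0..1}) (\<lambda>(y, t). t ^ i * ?F' (x0 + t *\<^sub>R (y - x0)) b)"
      if "b \<in> Basis" for b i
      using cont[of "\<lambda>x. ?F' x b"] Suc.prems that Ck_on_continuous[OF U(1)] by auto
    have d: "((\<lambda>y. t ^ j * F (x0 + t *\<^sub>R (y - x0))) has_derivative blinfun_apply (?G y t)) (at y within U)"
      if y: "y \<in> U" and t: "t \<in> cbox 0 1" for y t
    proof -
      let ?z = "x0 + t *\<^sub>R (y - x0)"
      have z: "?z \<in> U" using seg y t by simp
      have Fd: "(F has_derivative ?F' ?z) (at ?z)"
        by (rule Ck_on_has_derivative[OF U(1) Suc.prems z])
      have lin: "linear (?F' ?z)" using Fd has_derivative_linear by blast
      have "((\<lambda>y. x0 + t *\<^sub>R (y - x0)) has_derivative (\<lambda>h. t *\<^sub>R h)) (at y within U)"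
        by (auto intro!: derivative_eq_intros)
      from has_derivative_compose[OF this Fd]
      have "((\<lambda>y. F (x0 + t *\<^sub>R (y - x0))) has_derivative (\<lambda>h. ?F' ?z (t *\<^sub>R h))) (at y within U)" .
      from has_derivative_mult_right[OF this, of "t ^ j"]
      have 1: "((\<lambda>y. t ^ j * F (x0 + t *\<^sub>R (y - x0))) has_derivative (\<lambda>h. t ^ j * ?F' ?z (t *\<^sub>R h))) (at y within U)" .
      have "t ^ j * ?F' ?z (t *\<^sub>R h) = blinfun_apply (?G y t) h" for h
      proof -
        have "?F' ?z h = ?F' ?z (\<Sum>b\<in>Basis. (h \<bullet> b) *\<^sub>R b)" by (simp add: euclidean_representation)
        also have "\<dots> = (\<Sum>b\<in>Basis. (h \<bullet> b) * ?F' ?z b)"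
          by (simp add: linear_sum[OF lin] linear_cmul[OF lin])
        finally have "?F' ?z (t *\<^sub>R h) = t * (\<Sum>b\<in>Basis. (h \<bullet> b) * ?F' ?z b)"
          using linear_cmul[OF lin, of t h] by simp
        then show ?thesis
          by (simp only:) (simp add: blinfun.sum_left blinfun.scaleR_left sum_distrib_left
              mult_ac)
      qed
      then have "blinfun_apply (?G y t) = (\<lambda>h. t ^ j * ?F' ?z (t *\<^sub>R h))" by auto
      then show ?thesis using 1 by simp
    qed
    have contG: "continuous_on (U \<times> cbox 0 1) (\<lambda>(y, t). ?G y t)"
      using contb[of _ "Suc j"] unfolding split_beta cbox_interval
      by (intro continuous_on_sum continuous_on_scaleR continuous_on_const) auto
    have int: "(\<lambda>t. t ^ j * F (x0 + t *\<^sub>R (y - x0))) integrable_on cbox 0 1" if "y \<in> U" for y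
    proof (rule integrable_continuous)
      have F: "continuous_on U F" using Ck_on_continuous[OF U(1) Suc.prems] .
      show "continuous_on (cbox 0 1) (\<lambda>t. t ^ j * F (x0 + t *\<^sub>R (y - x0)))"
        by (intro continuous_intros continuous_on_compose2[OF F]) (use that seg in auto)
    qed
    have D: "((\<lambda>y. integral {0..1} (\<lambda>t. t ^ j * F (x0 + t *\<^sub>R (y - x0)))) has_derivative
        blinfun_apply (integral {0..1} (?G y))) (at y)" if y: "y \<in> U" for y
      using leibniz_rule[OF d int contG y U(2)] at_within_open[OF y U(1)] by (simp add: cbox_interval)
    show ?case
    proof (rule Ck_on_deriv[OF U(1) D], assumption)
      fix b :: 'e assume b: "b \<in> Basis"
      have "blinfun_apply (integral {0..1} (?G y)) b
          = integral {0..1} (\<lambda>t. t ^ Suc j * ?F' (x0 + t *\<^sub>R (y - x0)) b)" if y: "y \<in> U" for y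
      proof -
        have "continuous_on {0..1} (\<lambda>t. (y, t))" by (intro continuous_intros)
        then have "continuous_on {0..1} (?G y)"
          using continuous_on_compose2[OF contG, of "{0..1}" "\<lambda>t. (y, t)"] y
          by (simp add: cbox_interval image_subset_iff)
        then have "?G y integrable_on {0..1}"
          by (rule integrable_continuous_interval)
        then have "blinfun_apply (integral {0..1} (?G y)) b = integral {0..1} (\<lambda>t. blinfun_apply (?G y t) b)"
          by (rule blinfun_apply_integral)
        also have "(\<lambda>t. blinfun_apply (?G y t) b) = (\<lambda>t. t ^ Suc j * ?F' (x0 + t *\<^sub>R (y - x0)) b)"
          using b by (auto simp: blinfun.sum_left blinfun.scaleR_left inner_Basis if_distrib
              cong: if_cong)
        finally show ?thesis .
      qed
      moreover have "Ck_on k U (\<lambda>y. integral {0..1} (\<lambda>t. t ^ Suc j * ?F' (x0 + t *\<^sub>R (y - x0)) b))"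
        using Suc.IH[of "\<lambda>x. ?F' x b" "Suc j"] Suc.prems b by simp
      ultimately show "Ck_on k U (\<lambda>y. blinfun_apply (integral {0..1} (?G y)) b)"
        by (subst Ck_on_cong[OF U(1)]) auto
    qed
  }
qed

text \<open>The function \<open>H b\<close> is the mean of the partial derivative of \<open>F\<close> in direction \<open>b\<close> over the segment from
\<open>x0\<close> to the argument; the expansion is the fundamental theorem of calculus along that segment.\<close>

lemma hadamard:
  fixes x0 :: "'e::euclidean_space" and F :: "'e \<Rightarrow> real"
  assumes U: "open U" "convex U" "x0 \<in> U" and F: "smooth_on U F"
  obtains H where "\<And>b. b \<in> Basis \<Longrightarrow> smooth_on U (H b)"
    "\<And>b. b \<in> Basis \<Longrightarrow> H b x0 = frechet_derivative F (at x0) b"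
    "\<And>y. y \<in> U \<Longrightarrow> F y = F x0 + (\<Sum>b\<in>Basis. ((y - x0) \<bullet> b) * H b y)"
proof
  let ?F' = "\<lambda>x. frechet_derivative F (at x)"
  define H where "H b y = integral {0..1} (\<lambda>t. t ^ 0 * ?F' (x0 + t *\<^sub>R (y - x0)) b)" for b y
  show "smooth_on U (H b)" if "b \<in> Basis" for b
    using Ck_on_segment_integral[OF U] smooth_on_partial[OF F that]
    unfolding H_def smooth_on_def by blast
  show "H b x0 = ?F' x0 b" if "b \<in> Basis" for b
    by (simp add: H_def)
  show "F y = F x0 + (\<Sum>b\<in>Basis. ((y - x0) \<bullet> b) * H b y)" if y: "y \<in> U" for y
  proof -
    have seg: "x0 + t *\<^sub>R (y - x0) \<in> U" if "t \<in> {0..1}" for t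
    proof -
      have "(1 - t) *\<^sub>R x0 + t *\<^sub>R y \<in> U"
        using that U y by (intro convexD_alt) auto
      then show ?thesis by (simp add: algebra_simps)
    qed
    have d: "((\<lambda>t. F (x0 + t *\<^sub>R (y - x0))) has_vector_derivative
        (\<Sum>b\<in>Basis. ((y - x0) \<bullet> b) * ?F' (x0 + t *\<^sub>R (y - x0)) b)) (at t within {0..1})"
      if t: "t \<in> {0..1}" for t
    proof -
      let ?z = "x0 + t *\<^sub>R (y - x0)"
      have Fd: "(F has_derivative ?F' ?z) (at ?z)"
        by (rule smooth_on_has_derivative[OF U(1) F seg[OF t]])
      have lin: "linear (?F' ?z)" using Fd has_derivative_linear by blast
      have "((\<lambda>t. x0 + t *\<^sub>R (y - x0)) has_derivative (\<lambda>h. h *\<^sub>R (y - x0))) (at t within {0..1})"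
        by (auto intro!: derivative_eq_intros)
      from has_derivative_compose[OF this Fd]
      have "((\<lambda>t. F (x0 + t *\<^sub>R (y - x0))) has_vector_derivative ?F' ?z (y - x0)) (at t within {0..1})"
        by (simp add: has_vector_derivative_def linear_cmul[OF lin])
      moreover have "?F' ?z (y - x0) = ?F' ?z (\<Sum>b\<in>Basis. ((y - x0) \<bullet> b) *\<^sub>R b)"
        by (simp add: euclidean_representation)
      moreover have "\<dots> = (\<Sum>b\<in>Basis. ((y - x0) \<bullet> b) * ?F' ?z b)"
        by (simp add: linear_sum[OF lin] linear_cmul[OF lin])
      ultimately show ?thesis by simp
    qed
    have "((\<lambda>t. \<Sum>b\<in>Basis. ((y - x0) \<bullet> b) * ?F' (x0 + t *\<^sub>R (y - x0)) b) has_integral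
        F (x0 + 1 *\<^sub>R (y - x0)) - F (x0 + 0 *\<^sub>R (y - x0))) {0..1}"
      by (rule fundamental_theorem_of_calculus[OF _ d]) auto
    then have "F y - F x0 = integral {0..1} (\<lambda>t. \<Sum>b\<in>Basis. ((y - x0) \<bullet> b) * ?F' (x0 + t *\<^sub>R (y - x0)) b)"
      by (simp add: integral_unique)
    also have "\<dots> = (\<Sum>b\<in>Basis. integral {0..1} (\<lambda>t. ((y - x0) \<bullet> b) * ?F' (x0 + t *\<^sub>R (y - x0)) b))"
    proof (rule integral_sum, simp)
      fix b :: 'e assume b: "b \<in> Basis"
      have c: "continuous_on U (\<lambda>x. ?F' x b)"
        by (rule smooth_on_continuous[OF U(1) smooth_on_partial[OF F b]])
      show "(\<lambda>t. ((y - x0) \<bullet> b) * ?F' (x0 + t *\<^sub>R (y - x0)) b) integrable_on {0..1}"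
        by (intro integrable_continuous_interval continuous_intros continuous_on_compose2[OF c])
          (use seg in auto)
    qed
    also have "\<dots> = (\<Sum>b\<in>Basis. ((y - x0) \<bullet> b) * H b y)"
      by (simp add: H_def)
    finally show ?thesis by simp
  qed
qed

section \<open>Smooth functions on a manifold\<close>

text \<open>Smoothness on an open set \<open>Q\<close>, for functions whose values outside \<open>Q\<close> are arbitrary. Global smooth
functions are glued from such pieces.\<close>

definition Cinf_on :: "('a::topological_space, 'n::finite) chart set \<Rightarrow> 'a set \<Rightarrow> ('a \<Rightarrow> real) set" where
  "Cinf_on \<A> Q = {f. \<forall>(U, \<phi>)\<in>\<A>. smooth_on (\<phi> ` (U \<inter> Q)) (f \<circ> inv_into U \<phi>)}"

lemma Cinf_on_UNIV: "Cinf_on \<A> UNIV = Cinf \<A>"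
  by (simp add: Cinf_on_def Cinf_def)

lemma sum_Basis_vec: "(\<Sum>b\<in>(Basis::(real^'n) set). F b) = (\<Sum>i\<in>UNIV. F (axis i (1::real)))"
proof -
  have B: "(Basis::(real^'n) set) = range (\<lambda>i. axis i 1)" by (auto simp: Basis_vec_def)
  have inj: "inj (\<lambda>i::'n. axis i (1::real))" by (auto simp: inj_def axis_eq_axis)
  show ?thesis unfolding B sum.reindex[OF inj] by simp
qed

lemma Cinf_onD:
  "f \<in> Cinf_on \<A> Q \<Longrightarrow> (U, \<phi>) \<in> \<A> \<Longrightarrow> smooth_on (\<phi> ` (U \<inter> Q)) (\<lambda>z. f (inv_into U \<phi> z))"
  unfolding Cinf_on_def o_def by auto

lemma Cinf_onI:
  "(\<And>U \<phi>. (U, \<phi>) \<in> \<A> \<Longrightarrow> smooth_on (\<phi> ` (U \<inter> Q)) (\<lambda>z. f (inv_into U \<phi> z))) \<Longrightarrow> f \<in> Cinf_on \<A> Q"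
  unfolding Cinf_on_def o_def by auto

lemma CinfD:
  "f \<in> Cinf \<A> \<Longrightarrow> (U, \<phi>) \<in> \<A> \<Longrightarrow> smooth_on (\<phi> ` U) (f \<circ> inv_into U \<phi>)"
  unfolding Cinf_def by auto

locale smooth_manifold =
  fixes \<A> :: "('a::{t2_space, second_countable_topology}, 'n::finite) chart set"
  assumes atlas: "smooth_atlas \<A>"
begin

lemma chart_open: "(U, \<phi>) \<in> \<A> \<Longrightarrow> open U"
  and chart_homeo: "(U, \<phi>) \<in> \<A> \<Longrightarrow> homeomorphism U (\<phi> ` U) \<phi> (inv_into U \<phi>)"
  and chart_open_image: "(U, \<phi>) \<in> \<A> \<Longrightarrow> open (\<phi> ` U)"
  and chart_transition: "(U, \<phi>) \<in> \<A> \<Longrightarrow> (V, \<psi>) \<in> \<A> \<Longrightarrow>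
     smooth_on (\<phi> ` (U \<inter> V)) (\<psi> \<circ> inv_into U \<phi>)"
  using atlas unfolding smooth_atlas_def by blast+

lemma chart_at: obtains U \<phi> where "(U, \<phi>) \<in> \<A>" "x \<in> U"
  using atlas unfolding smooth_atlas_def by blast

lemma chart_inv [simp]: "(U, \<phi>) \<in> \<A> \<Longrightarrow> y \<in> U \<Longrightarrow> inv_into U \<phi> (\<phi> y) = y"
  by (rule homeomorphism_apply1[OF chart_homeo])

lemma chart_open_image': "(U, \<phi>) \<in> \<A> \<Longrightarrow> open Q \<Longrightarrow> open (\<phi> ` (U \<inter> Q))"
proof -
  assume c: "(U, \<phi>) \<in> \<A>" "open Q"
  have "openin (top_of_set U) (U \<inter> Q)" using c by (simp add: openin_open_Int)
  then have "openin (top_of_set (\<phi> ` U)) (\<phi> ` (U \<inter> Q))"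
    by (rule homeomorphism_imp_open_map[OF chart_homeo[OF c(1)]])
  then show ?thesis by (rule openin_open_trans[OF _ chart_open_image[OF c(1)]])
qed

lemma chart_cont: "(U, \<phi>) \<in> \<A> \<Longrightarrow> continuous_on U \<phi>"
  by (rule homeomorphism_cont1[OF chart_homeo])

lemma chart_inv_cont: "(U, \<phi>) \<in> \<A> \<Longrightarrow> continuous_on (\<phi> ` U) (inv_into U \<phi>)"
  by (rule homeomorphism_cont2[OF chart_homeo])

lemma Cinf_on_local:
  assumes "\<And>x. x \<in> Q \<Longrightarrow> \<exists>N h. open N \<and> x \<in> N \<and> h \<in> Cinf_on \<A> N \<and> (\<forall>y\<in>N. f y = h y)"
    and Q: "open Q"
  shows "f \<in> Cinf_on \<A> Q"
proof -
  have "smooth_on (\<phi> ` (U \<inter> Q)) (\<lambda>z. f (inv_into U \<phi> z))" if c: "(U, \<phi>) \<in> \<A>" for U \<phi>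
  proof (rule smooth_on_local[OF _ chart_open_image'[OF c Q]])
    fix z assume "z \<in> \<phi> ` (U \<inter> Q)"
    then obtain x where x: "x \<in> U" "x \<in> Q" "z = \<phi> x" by auto
    then obtain N h where N: "open N" "x \<in> N" "h \<in> Cinf_on \<A> N" "\<forall>y\<in>N. f y = h y"
      using assms(1) by blast
    have "smooth_on (\<phi> ` (U \<inter> N)) (\<lambda>z. h (inv_into U \<phi> z))"
      by (rule Cinf_onD[OF N(3) c])
    then have "smooth_on (\<phi> ` (U \<inter> N)) (\<lambda>z. f (inv_into U \<phi> z))"
      by (subst smooth_on_cong[OF chart_open_image'[OF c N(1)]]) (use c N(4) in auto)
    then show "\<exists>V. open V \<and> z \<in> V \<and> smooth_on V (\<lambda>z. f (inv_into U \<phi> z))"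
      using chart_open_image'[OF c N(1)] x N(2) by blast
  qed
  then show ?thesis by (rule Cinf_onI)
qed

lemma Cinf_local:
  assumes "\<And>x. \<exists>N h. open N \<and> x \<in> N \<and> h \<in> Cinf_on \<A> N \<and> (\<forall>y\<in>N. f y = h y)"
  shows "f \<in> Cinf \<A>"
  using Cinf_on_local[of UNIV f] assms by (simp add: Cinf_on_UNIV)

lemma Cinf_on_subset: "f \<in> Cinf_on \<A> Q \<Longrightarrow> R \<subseteq> Q \<Longrightarrow> f \<in> Cinf_on \<A> R"
  by (rule Cinf_onI, rule smooth_on_subset[OF Cinf_onD[of f]]) auto

lemma Cinf_imp_on: "f \<in> Cinf \<A> \<Longrightarrow> f \<in> Cinf_on \<A> Q"
  using Cinf_on_subset[of f UNIV Q] by (simp add: Cinf_on_UNIV)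

lemma Cinf_on_const [simp]: "(\<lambda>x. c) \<in> Cinf_on \<A> Q"
  by (auto simp: Cinf_on_def o_def)

lemma Cinf_on_add: "open Q \<Longrightarrow> f \<in> Cinf_on \<A> Q \<Longrightarrow> h \<in> Cinf_on \<A> Q \<Longrightarrow> (\<lambda>x. f x + h x) \<in> Cinf_on \<A> Q"
  by (rule Cinf_onI, rule smooth_on_add[OF chart_open_image']) (auto intro: Cinf_onD)

lemma Cinf_on_mult: "open Q \<Longrightarrow> f \<in> Cinf_on \<A> Q \<Longrightarrow> h \<in> Cinf_on \<A> Q \<Longrightarrow> (\<lambda>x. f x * h x) \<in> Cinf_on \<A> Q"
  by (rule Cinf_onI, rule smooth_on_mult[OF chart_open_image']) (auto intro: Cinf_onD)

lemma Cinf_on_compose: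
  assumes Q: "open Q" and f: "f \<in> Cinf_on \<A> Q" and F: "open T" "smooth_on T F" "f ` Q \<subseteq> T"
  shows "(\<lambda>x. F (f x)) \<in> Cinf_on \<A> Q"
proof -
  have "smooth_on (\<phi> ` (U \<inter> Q)) (\<lambda>z. F (f (inv_into U \<phi> z)))" if c: "(U, \<phi>) \<in> \<A>" for U \<phi>
  proof (rule smooth_on_compose[OF chart_open_image'[OF c Q] F(1) _ _ F(2)])
    show "smooth_on (\<phi> ` (U \<inter> Q)) (\<lambda>z. f (inv_into U \<phi> z))"
      by (rule Cinf_onD[OF f c])
    show "(\<lambda>z. f (inv_into U \<phi> z)) ` \<phi> ` (U \<inter> Q) \<subseteq> T"
      using F(3) c by auto
  qed
  then show ?thesis by (rule Cinf_onI)
qed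

lemma Cinf_const [simp]: "(\<lambda>x. c) \<in> Cinf \<A>"
  using Cinf_on_const[of c UNIV] by (simp only: Cinf_on_UNIV)

lemma Cinf_add: "f \<in> Cinf \<A> \<Longrightarrow> h \<in> Cinf \<A> \<Longrightarrow> (\<lambda>x. f x + h x) \<in> Cinf \<A>"
  and Cinf_mult: "f \<in> Cinf \<A> \<Longrightarrow> h \<in> Cinf \<A> \<Longrightarrow> (\<lambda>x. f x * h x) \<in> Cinf \<A>"
  using Cinf_on_add[of UNIV f h] Cinf_on_mult[of UNIV f h] by (simp_all add: Cinf_on_UNIV)

lemma Cinf_diff: "f \<in> Cinf \<A> \<Longrightarrow> h \<in> Cinf \<A> \<Longrightarrow> (\<lambda>x. f x - h x) \<in> Cinf \<A>"
  using Cinf_add[of f "\<lambda>x. (-1) * h x"] Cinf_mult[of "\<lambda>_. -1" h] by simp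

lemma Cinf_minus: "f \<in> Cinf \<A> \<Longrightarrow> (\<lambda>x. - f x) \<in> Cinf \<A>"
  using Cinf_mult[of "\<lambda>_. -1" f] by simp

lemma Cinf_sum: "(\<And>i. i \<in> I \<Longrightarrow> f i \<in> Cinf \<A>) \<Longrightarrow> (\<lambda>x. \<Sum>i\<in>I. f i x) \<in> Cinf \<A>"
  by (induction I rule: infinite_finite_induct) (auto intro: Cinf_add)

lemma Cinf_prod: "(\<And>i. i \<in> I \<Longrightarrow> f i \<in> Cinf \<A>) \<Longrightarrow> (\<lambda>x. \<Prod>i\<in>I. f i x) \<in> Cinf \<A>"
  by (induction I rule: infinite_finite_induct) (auto intro: Cinf_mult)

lemma Cinf_on_chart:
  assumes c: "(U, \<phi>) \<in> \<A>" and W: "open W" "W \<subseteq> \<phi> ` U" and u: "smooth_on W u"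
  shows "open {x\<in>U. \<phi> x \<in> W}" "(\<lambda>x. u (\<phi> x)) \<in> Cinf_on \<A> {x\<in>U. \<phi> x \<in> W}"
proof -
  let ?Q = "{x\<in>U. \<phi> x \<in> W}"
  show Q: "open ?Q"
    using continuous_open_preimage[OF chart_cont[OF c] chart_open[OF c] W(1)]
    by (simp add: vimage_def Int_def)
  have "smooth_on (\<psi> ` (V \<inter> ?Q)) (\<lambda>z. u ((\<phi> \<circ> inv_into V \<psi>) z))" if d: "(V, \<psi>) \<in> \<A>" for V \<psi>
  proof (rule smooth_on_compose[OF chart_open_image'[OF d Q] W(1) _ _ u])
    show "smooth_on (\<psi> ` (V \<inter> ?Q)) (\<phi> \<circ> inv_into V \<psi>)"
      using chart_transition[OF d c] by (rule smooth_on_subset) auto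
    show "(\<phi> \<circ> inv_into V \<psi>) ` \<psi> ` (V \<inter> ?Q) \<subseteq> W"
      using d by auto
  qed
  then have "smooth_on (\<psi> ` (V \<inter> ?Q)) (\<lambda>z. u (\<phi> (inv_into V \<psi> z)))" if "(V, \<psi>) \<in> \<A>" for V \<psi>
    using that by (simp add: o_def)
  then show "(\<lambda>x. u (\<phi> x)) \<in> Cinf_on \<A> ?Q" by (rule Cinf_onI)
qed

lemma Cinf_continuous: "f \<in> Cinf \<A> \<Longrightarrow> continuous_on UNIV f"
proof -
  assume f: "f \<in> Cinf \<A>"
  have "isCont f x" for x
  proof -
    obtain U \<phi> where c: "(U, \<phi>) \<in> \<A>" "x \<in> U" by (rule chart_at)
    have "continuous_on (\<phi> ` U) (f \<circ> inv_into U \<phi>)"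
      by (rule smooth_on_continuous[OF chart_open_image[OF c(1)] CinfD[OF f c(1)]])
    then have "continuous_on U (\<lambda>y. (f \<circ> inv_into U \<phi>) (\<phi> y))"
      by (rule continuous_on_compose2[OF _ chart_cont[OF c(1)]]) auto
    then have "continuous_on U f"
      by (rule continuous_on_eq) (use c in auto)
    then show ?thesis using chart_open c continuous_on_eq_continuous_at by blast
  qed
  then show ?thesis by (simp add: continuous_at_imp_continuous_on)
qed

text \<open>Points outside \<open>Q\<close> have a neighbourhood that misses the closed set \<open>K\<close>, and the function vanishes there.\<close>

lemma Cinf_cut:
  assumes u: "u \<in> Cinf_on \<A> Q" and Q: "open Q" and K: "closed K" "K \<subseteq> Q"
    and \<eta>: "\<eta> \<in> Cinf \<A>" "\<And>y. y \<notin> K \<Longrightarrow> \<eta> y = 0"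
  shows "(\<lambda>x. if x \<in> Q then \<eta> x * u x else 0) \<in> Cinf \<A>"
proof (rule Cinf_local)
  fix x
  show "\<exists>N h. open N \<and> x \<in> N \<and> h \<in> Cinf_on \<A> N \<and> (\<forall>y\<in>N. (if y \<in> Q then \<eta> y * u y else 0) = h y)"
  proof (cases "x \<in> Q")
    case True
    then show ?thesis
      using Q Cinf_on_mult[OF Q Cinf_imp_on[OF \<eta>(1)] u]
      by (intro exI[of _ Q] exI[of _ "\<lambda>x. \<eta> x * u x"]) auto
  next
    case False
    then show ?thesis using K \<eta>(2)
      by (intro exI[of _ "- K"] exI[of _ "\<lambda>x. 0"]) auto
  qed
qed

text \<open>A bump function of Euclidean space is transported through a chart and extended by zero. The
extension is smooth because its support is compact, hence closed in the Hausdorff space.\<close>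

lemma manifold_bump:
  assumes Q: "open Q" "x \<in> Q"
  obtains \<eta> N K where "\<eta> \<in> Cinf \<A>" "open N" "x \<in> N" "N \<subseteq> K" "compact K" "K \<subseteq> Q"
    "\<And>y. y \<in> N \<Longrightarrow> \<eta> y = 1" "\<And>y. y \<notin> K \<Longrightarrow> \<eta> y = 0"
proof -
  obtain U \<phi> where c: "(U, \<phi>) \<in> \<A>" "x \<in> U" by (rule chart_at)
  have o: "open (\<phi> ` (U \<inter> Q))" by (rule chart_open_image'[OF c(1) Q(1)])
  obtain r where r: "r > 0" "cball (\<phi> x) r \<subseteq> \<phi> ` (U \<inter> Q)"
    using o c Q open_contains_cball by blast
  obtain b :: "real^'n \<Rightarrow> real" where b: "smooth_on UNIV b" "\<And>y. dist y (\<phi> x) < r/2 \<Longrightarrow> b y = 1"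
    "\<And>y. dist y (\<phi> x) \<ge> 2 * (r/2) \<Longrightarrow> b y = 0"
    using smooth_bump[of "r/2" "\<phi> x"] r(1) by auto
  define K where "K = inv_into U \<phi> ` cball (\<phi> x) r"
  have KU: "K \<subseteq> U \<inter> Q" using r(2) c by (auto simp: K_def)
  have K: "compact K"
    unfolding K_def using r(2)
    by (intro compact_continuous_image continuous_on_subset[OF chart_inv_cont[OF c(1)]]) auto
  have inK: "y \<in> K" if "y \<in> U" "dist (\<phi> y) (\<phi> x) \<le> r" for y
    unfolding K_def using that c by (intro image_eqI[of _ _ "\<phi> y"]) (auto simp: dist_commute)
  define \<eta> where "\<eta> y = (if y \<in> U then b (\<phi> y) else 0)" for y
  define N where "N = {y\<in>U. \<phi> y \<in> ball (\<phi> x) (r/2)}"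
  have bK: "\<eta> y = 0" if "y \<notin> K" for y
    using inK[of y] that b(3)[of "\<phi> y"] by (cases "dist (\<phi> y) (\<phi> x) \<le> r") (auto simp: \<eta>_def)
  have ball: "ball (\<phi> x) (r/2) \<subseteq> \<phi> ` U"
  proof -
    have "ball (\<phi> x) (r/2) \<subseteq> cball (\<phi> x) r" using r(1) by auto
    then show ?thesis using r(2) by blast
  qed
  show thesis
  proof
    show "\<eta> \<in> Cinf \<A>"
    proof (rule Cinf_local)
      fix y
      show "\<exists>N h. open N \<and> y \<in> N \<and> h \<in> Cinf_on \<A> N \<and> (\<forall>z\<in>N. \<eta> z = h z)"
      proof (cases "y \<in> U")
        case True
        have "{x\<in>U. \<phi> x \<in> \<phi> ` U} = U" by auto
        then have "(\<lambda>x. b (\<phi> x)) \<in> Cinf_on \<A> U"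
          using Cinf_on_chart(2)[OF c(1) chart_open_image[OF c(1)] subset_refl, of b]
            smooth_on_subset[OF b(1)] by simp
        then show ?thesis using True chart_open[OF c(1)]
          by (intro exI[of _ U] exI[of _ "\<lambda>x. b (\<phi> x)"]) (auto simp: \<eta>_def)
      next
        case False
        then show ?thesis using bK KU compact_imp_closed[OF K]
          by (intro exI[of _ "-K"] exI[of _ "\<lambda>x. 0"]) auto
      qed
    qed
    show "open N" unfolding N_def
      using Cinf_on_chart(1)[OF c(1) open_ball ball, of "\<lambda>_. 0"] by simp
    show "x \<in> N" using c r by (simp add: N_def)
    show "N \<subseteq> K" using inK r by (fastforce simp: N_def dist_commute)
    show "\<eta> y = 1" if "y \<in> N" for y using that b(2) by (auto simp: N_def \<eta>_def dist_commute)
  qed (use K KU bK in auto)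
qed

lemma Cinf_local_extension:
  assumes u: "u \<in> Cinf_on \<A> Q" and Q: "open Q" "x \<in> Q"
  obtains h N where "h \<in> Cinf \<A>" "open N" "x \<in> N" "N \<subseteq> Q" "\<And>y. y \<in> N \<Longrightarrow> h y = u y"
proof -
  obtain \<eta> N K where \<eta>: "\<eta> \<in> Cinf \<A>" "open N" "x \<in> N" "N \<subseteq> K" "compact K" "K \<subseteq> Q"
    "\<And>y. y \<in> N \<Longrightarrow> \<eta> y = 1" "\<And>y. y \<notin> K \<Longrightarrow> \<eta> y = 0"
    by (rule manifold_bump[OF Q]) (rule that; assumption)
  show thesis
  proof (rule that[OF Cinf_cut[OF u Q(1) compact_imp_closed[OF \<eta>(5)] \<eta>(6) \<eta>(1) \<eta>(8)] \<eta>(2,3)])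
    show "N \<subseteq> Q" using \<eta>(4,6) by blast
    then show "(if y \<in> Q then \<eta> y * u y else 0) = u y" if "y \<in> N" for y
      using \<eta>(7)[OF that] that by auto
  qed
qed

section \<open>Tangent vectors\<close>

lemma tan_add: "v \<in> tangent_space \<A> x \<Longrightarrow> f \<in> Cinf \<A> \<Longrightarrow> h \<in> Cinf \<A> \<Longrightarrow> v (\<lambda>y. f y + h y) = v f + v h"
  and tan_cmult: "v \<in> tangent_space \<A> x \<Longrightarrow> f \<in> Cinf \<A> \<Longrightarrow> v (\<lambda>y. c * f y) = c * v f"
  and tan_mult: "v \<in> tangent_space \<A> x \<Longrightarrow> f \<in> Cinf \<A> \<Longrightarrow> h \<in> Cinf \<A> \<Longrightarrow>
    v (\<lambda>y. f y * h y) = f x * v h + h x * v f"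
  and tan_notin: "v \<in> tangent_space \<A> x \<Longrightarrow> f \<notin> Cinf \<A> \<Longrightarrow> v f = 0"
  unfolding tangent_space_def by blast+

lemma tan_const: "v \<in> tangent_space \<A> x \<Longrightarrow> v (\<lambda>y. c) = 0"
proof -
  assume v: "v \<in> tangent_space \<A> x"
  have "v (\<lambda>y. 1 * 1) = 1 * v (\<lambda>y. 1) + 1 * v (\<lambda>y. 1)"
    by (rule tan_mult[OF v]) auto
  then have "v (\<lambda>y. 1) = 0" by simp
  then show ?thesis using tan_cmult[OF v, of "\<lambda>y. 1" c] by simp
qed

lemma tan_diff: "v \<in> tangent_space \<A> x \<Longrightarrow> f \<in> Cinf \<A> \<Longrightarrow> h \<in> Cinf \<A> \<Longrightarrow> v (\<lambda>y. f y - h y) = v f - v h"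
  using tan_add[of v x f "\<lambda>y. (-1) * h y"] tan_cmult[of v x h "-1"] Cinf_minus[of h] by simp

lemma tan_sum:
  assumes v: "v \<in> tangent_space \<A> x"
  shows "(\<And>i. i \<in> I \<Longrightarrow> f i \<in> Cinf \<A>) \<Longrightarrow> v (\<lambda>y. \<Sum>i\<in>I. f i y) = (\<Sum>i\<in>I. v (f i))"
proof (induction I rule: infinite_finite_induct)
  case (insert i I)
  have "v (\<lambda>y. f i y + (\<Sum>i\<in>I. f i y)) = v (f i) + v (\<lambda>y. \<Sum>i\<in>I. f i y)"
    using insert by (intro tan_add[OF v] Cinf_sum) auto
  then show ?case using insert by simp
qed (auto simp: tan_const[OF v])

text \<open>If \<open>f\<close> and \<open>h\<close> agree near \<open>x\<close>, then \<open>f - h = (f - h) (1 - \<eta>)\<close> for a cutoff \<open>\<eta>\<close> with \<open>\<eta> x = 1\<close>, and the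
derivation property evaluates the product to zero.\<close>

lemma tan_local:
  assumes v: "v \<in> tangent_space \<A> x" and f: "f \<in> Cinf \<A>" "h \<in> Cinf \<A>"
    and N: "open N" "x \<in> N" "\<And>y. y \<in> N \<Longrightarrow> f y = h y"
  shows "v f = v h"
proof -
  obtain \<eta> N' K where \<eta>: "\<eta> \<in> Cinf \<A>" "open N'" "x \<in> N'" "N' \<subseteq> K" "compact K" "K \<subseteq> N"
    "\<And>y. y \<in> N' \<Longrightarrow> \<eta> y = 1" "\<And>y. y \<notin> K \<Longrightarrow> \<eta> y = 0"
    by (rule manifold_bump[OF N(1,2)]) (rule that; assumption)
  have "(\<lambda>y. (f y - h y) * (1 - \<eta> y)) = (\<lambda>y. f y - h y)"
  proof
    fix y show "(f y - h y) * (1 - \<eta> y) = f y - h y"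
      using \<eta>(6,8) N(3) by (cases "y \<in> K") auto
  qed
  moreover have "v (\<lambda>y. (f y - h y) * (1 - \<eta> y)) = (f x - h x) * v (\<lambda>y. 1 - \<eta> y) + (1 - \<eta> x) * v (\<lambda>y. f y - h y)"
    using f \<eta>(1) by (intro tan_mult[OF v] Cinf_diff) auto
  ultimately have "v (\<lambda>y. f y - h y) = 0" using N(2,3) \<eta>(3,7) by simp
  then show ?thesis using tan_diff[OF v f] by simp
qed

lemma tan_lincomb:
  "u \<in> tangent_space \<A> x \<Longrightarrow> v \<in> tangent_space \<A> x \<Longrightarrow> (\<lambda>f. u f + c * v f) \<in> tangent_space \<A> x"
  unfolding tangent_space_def by (auto simp: algebra_simps)

lemma tan_zero: "(\<lambda>f. 0) \<in> tangent_space \<A> x"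
  unfolding tangent_space_def by auto

lemma tan_scale: "v \<in> tangent_space \<A> x \<Longrightarrow> (\<lambda>f. c * v f) \<in> tangent_space \<A> x"
  using tan_lincomb[OF tan_zero, of v x c] by simp

lemma tan_plus: "u \<in> tangent_space \<A> x \<Longrightarrow> v \<in> tangent_space \<A> x \<Longrightarrow> (\<lambda>f. u f + v f) \<in> tangent_space \<A> x"
  using tan_lincomb[of u x v 1] by simp

lemma tan_Sum: "(\<And>i. i \<in> I \<Longrightarrow> v i \<in> tangent_space \<A> x) \<Longrightarrow> (\<lambda>f. \<Sum>i\<in>I. v i f) \<in> tangent_space \<A> x"
  by (induction I rule: infinite_finite_induct) (auto simp: tan_zero tan_plus)

lemma Cinf_chart_has_derivative:
  assumes c: "(U, \<phi>) \<in> \<A>" and x: "x \<in> U" and f: "f \<in> Cinf \<A>"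
  shows "((f \<circ> inv_into U \<phi>) has_derivative frechet_derivative (f \<circ> inv_into U \<phi>) (at (\<phi> x))) (at (\<phi> x))"
  by (rule smooth_on_has_derivative[OF chart_open_image[OF c] CinfD[OF f c]]) (use x in simp)

lemma coord_vector_tangent:
  assumes c: "(U, \<phi>) \<in> \<A>" and x: "x \<in> U"
  shows "coord_vector \<A> (U, \<phi>) i x \<in> tangent_space \<A> x"
proof -
  let ?I = "inv_into U \<phi>" and ?z = "\<phi> x"
  note d = Cinf_chart_has_derivative[OF c x]
  let ?d = "\<lambda>f. frechet_derivative (f \<circ> ?I) (at ?z)"
  have add: "?d (\<lambda>y. f y + h y) = (\<lambda>b. ?d f b + ?d h b)" if "f \<in> Cinf \<A>" "h \<in> Cinf \<A>" for f h
    using frechet_derivative_at[OF has_derivative_add[OF d[OF that(1)] d[OF that(2)]]]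
    by (simp add: o_def)
  have cm: "?d (\<lambda>y. e * f y) = (\<lambda>b. e * ?d f b)" if "f \<in> Cinf \<A>" for f e
    using frechet_derivative_at[OF has_derivative_mult_right[OF d[OF that], of e]]
    by (simp add: o_def)
  have mu: "?d (\<lambda>y. f y * h y) = (\<lambda>b. f x * ?d h b + ?d f b * h x)" if "f \<in> Cinf \<A>" "h \<in> Cinf \<A>" for f h
  proof -
    have "((\<lambda>z. (f \<circ> ?I) z * (h \<circ> ?I) z) has_derivative (\<lambda>b. f x * ?d h b + ?d f b * h x)) (at ?z)"
      using has_derivative_mult[OF d[OF that(1)] d[OF that(2)]] c x by simp
    from frechet_derivative_at[OF this] show ?thesis
      by (simp add: o_def)
  qed
  show ?thesis
    unfolding tangent_space_def coord_vector_def
    by (auto simp: add cm mu Cinf_add Cinf_mult)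
qed

lemma coord_vector_cong:
  "f \<in> Cinf \<A> \<Longrightarrow> coord_vector \<A> (U, \<phi>) i x f = frechet_derivative (f \<circ> inv_into U \<phi>) (at (\<phi> x)) (axis i 1)"
  by (simp add: coord_vector_def)

text \<open>Near \<open>x\<close>, Hadamard's lemma writes \<open>f\<close> as \<open>f x + \<Sum>\<^sub>i (\<xi>\<^sub>i - \<xi>\<^sub>i x) h\<^sub>i\<close>, where \<open>h\<^sub>i\<close> takes the value
\<open>\<partial>\<^sub>i f\<close> at \<open>x\<close>. The functions \<open>\<xi>\<^sub>i\<close> and \<open>h\<^sub>i\<close> have to be global for a derivation to act on them, which
is what local extension provides.\<close>

lemma tangent_expand:
  assumes c: "(U, \<phi>) \<in> \<A>" and x: "x \<in> U" and v: "v \<in> tangent_space \<A> x"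
    and \<xi>: "\<And>i. \<xi> i \<in> Cinf \<A>" and N: "open N" "x \<in> N" "\<And>i y. y \<in> N \<Longrightarrow> \<xi> i y = \<phi> y $ i"
  shows "v f = (\<Sum>i\<in>UNIV. v (\<xi> i) * coord_vector \<A> (U, \<phi>) i x f)"
proof (cases "f \<in> Cinf \<A>")
  case False
  then show ?thesis using tan_notin[OF v] by (simp add: coord_vector_def)
next
  case f: True
  let ?F = "f \<circ> inv_into U \<phi>" and ?z = "\<phi> x"
  have o: "open (\<phi> ` (U \<inter> N))" by (rule chart_open_image'[OF c N(1)])
  obtain r where r: "r > 0" "ball ?z r \<subseteq> \<phi> ` (U \<inter> N)"
    using o x N(2) open_contains_ball by blast
  have F: "smooth_on (ball ?z r) ?F"
    by (rule smooth_on_subset[OF CinfD[OF f c]]) (use r(2) in blast)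
  have axisB: "axis i 1 \<in> (Basis :: (real^'n) set)" for i by (auto simp: Basis_vec_def)
  have zb: "?z \<in> ball ?z r" using r(1) by simp
  obtain H where H: "\<And>b. b \<in> Basis \<Longrightarrow> smooth_on (ball ?z r) (H b)"
    "\<And>b. b \<in> Basis \<Longrightarrow> H b ?z = frechet_derivative ?F (at ?z) b"
    "\<And>y. y \<in> ball ?z r \<Longrightarrow> ?F y = ?F ?z + (\<Sum>b\<in>Basis. ((y - ?z) \<bullet> b) * H b y)"
    by (rule hadamard[OF open_ball convex_ball zb F]) (rule that; assumption)
  have ballU: "ball ?z r \<subseteq> \<phi> ` U" using r(2) by blast
  define Q where "Q = {y\<in>U. \<phi> y \<in> ball ?z r}"
  have Q: "open Q" "x \<in> Q"
    using Cinf_on_chart(1)[OF c open_ball ballU smooth_on_const[of _ 0]] x r(1) by (auto simp: Q_def)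
  have QN: "Q \<subseteq> N"
  proof
    fix y assume y: "y \<in> Q"
    then obtain w where "w \<in> U" "w \<in> N" "\<phi> y = \<phi> w" using r(2) unfolding Q_def by blast
    moreover have "y \<in> U" using y by (simp add: Q_def)
    ultimately have "y = w" using chart_inv[OF c] by metis
    then show "y \<in> N" using \<open>w \<in> N\<close> by simp
  qed
  have "\<exists>h M. h \<in> Cinf \<A> \<and> open M \<and> x \<in> M \<and> M \<subseteq> Q \<and> (\<forall>y\<in>M. h y = H (axis i 1) (\<phi> y))" for i
  proof -
    obtain h M where "h \<in> Cinf \<A>" "open M" "x \<in> M" "M \<subseteq> Q" "\<And>y. y \<in> M \<Longrightarrow> h y = H (axis i 1) (\<phi> y)"
      by (rule Cinf_local_extension[OF Cinf_on_chart(2)[OF c open_ball ballU H(1)[OF axisB]], of x])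
        (use Q in \<open>auto simp: Q_def\<close>)
    then show ?thesis by blast
  qed
  then obtain h M where h: "\<And>i. h i \<in> Cinf \<A>" "\<And>i. open (M i)" "\<And>i. x \<in> M i" "\<And>i. M i \<subseteq> Q"
    "\<And>i y. y \<in> M i \<Longrightarrow> h i y = H (axis i 1) (\<phi> y)"
    by metis
  define R where "R = (\<Inter>i. M i)"
  have R: "open R" "x \<in> R" using h by (auto simp: R_def)
  let ?e = "\<lambda>y. f x + (\<Sum>i\<in>UNIV. (\<xi> i y - \<xi> i x) * h i y)"
  have e: "f y = ?e y" if y: "y \<in> R" for y
  proof -
    have yQ: "y \<in> Q" using y h(4) by (auto simp: R_def)
    then have "?F (\<phi> y) = ?F ?z + (\<Sum>b\<in>Basis. ((\<phi> y - ?z) \<bullet> b) * H b (\<phi> y))"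
      by (intro H(3)) (simp add: Q_def)
    also have "?F (\<phi> y) = f y" using yQ c by (simp add: Q_def)
    also have "?F ?z = f x" using x c by simp
    also have "(\<Sum>b\<in>Basis. ((\<phi> y - ?z) \<bullet> b) * H b (\<phi> y)) = (\<Sum>i\<in>UNIV. (\<xi> i y - \<xi> i x) * h i y)"
      unfolding sum_Basis_vec using y yQ QN N h(5)
      by (intro sum.cong) (auto simp: inner_axis R_def)
    finally show ?thesis .
  qed
  have "v f = v ?e"
    by (rule tan_local[OF v f _ R e]) (auto intro!: Cinf_add Cinf_sum Cinf_mult Cinf_diff \<xi> h)
  also have "\<dots> = v (\<lambda>y. f x) + v (\<lambda>y. \<Sum>i\<in>UNIV. (\<xi> i y - \<xi> i x) * h i y)"
    by (rule tan_add[OF v]) (auto intro!: Cinf_add Cinf_sum Cinf_mult Cinf_diff \<xi> h)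
  also have "\<dots> = (\<Sum>i\<in>UNIV. v (\<lambda>y. (\<xi> i y - \<xi> i x) * h i y))"
    by (subst tan_sum[OF v]) (auto intro!: Cinf_mult Cinf_diff \<xi> h simp: tan_const[OF v])
  also have "\<dots> = (\<Sum>i\<in>UNIV. v (\<xi> i) * h i x)"
  proof (rule sum.cong[OF refl])
    fix i
    have "v (\<lambda>y. (\<xi> i y - \<xi> i x) * h i y) = (\<xi> i x - \<xi> i x) * v (h i) + h i x * v (\<lambda>y. \<xi> i y - \<xi> i x)"
      by (rule tan_mult[OF v]) (auto intro!: Cinf_diff \<xi> h)
    also have "v (\<lambda>y. \<xi> i y - \<xi> i x) = v (\<xi> i)"
      using tan_diff[OF v \<xi> Cinf_const, of i "\<xi> i x"] by (simp add: tan_const[OF v])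
    finally show "v (\<lambda>y. (\<xi> i y - \<xi> i x) * h i y) = v (\<xi> i) * h i x" by simp
  qed
  also have "\<dots> = (\<Sum>i\<in>UNIV. v (\<xi> i) * coord_vector \<A> (U, \<phi>) i x f)"
    using h(3,5) H(2)[OF axisB] by (simp add: coord_vector_cong[OF f])
  finally show ?thesis .
qed

section \<open>Vector fields\<close>

lemma vf_tan: "X \<in> vector_fields \<A> \<Longrightarrow> X x \<in> tangent_space \<A> x"
  and vf_Cinf: "X \<in> vector_fields \<A> \<Longrightarrow> f \<in> Cinf \<A> \<Longrightarrow> (\<lambda>x. X x f) \<in> Cinf \<A>"
  unfolding vector_fields_def by blast+

lemma vfI: "(\<And>x. X x \<in> tangent_space \<A> x) \<Longrightarrow> (\<And>f. f \<in> Cinf \<A> \<Longrightarrow> (\<lambda>x. X x f) \<in> Cinf \<A>) \<Longrightarrow> X \<in> vector_fields \<A>"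
  unfolding vector_fields_def by blast

lemma vf_add_in: "X \<in> vector_fields \<A> \<Longrightarrow> Y \<in> vector_fields \<A> \<Longrightarrow> vf_add X Y \<in> vector_fields \<A>"
  by (rule vfI) (auto simp: vf_add_def intro: tan_plus vf_tan Cinf_add vf_Cinf)

lemma vf_scale_in: "h \<in> Cinf \<A> \<Longrightarrow> X \<in> vector_fields \<A> \<Longrightarrow> vf_scale h X \<in> vector_fields \<A>"
  by (rule vfI) (auto simp: vf_scale_def intro: tan_scale vf_tan Cinf_mult vf_Cinf)

definition vf_sum :: "'i set \<Rightarrow> ('i \<Rightarrow> 'a vfield) \<Rightarrow> 'a vfield" where
  "vf_sum I X = (\<lambda>x f. \<Sum>i\<in>I. X i x f)"

lemma vf_sum_in: "(\<And>i. i \<in> I \<Longrightarrow> X i \<in> vector_fields \<A>) \<Longrightarrow> vf_sum I X \<in> vector_fields \<A>"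
  by (rule vfI) (simp_all add: vf_sum_def tan_Sum vf_tan Cinf_sum vf_Cinf)

lemma vf_zero_in: "(\<lambda>x f. 0) \<in> vector_fields \<A>"
  by (rule vfI) (auto simp: tan_zero)

text \<open>Coordinate functions and coordinate vector fields of a chart on a smaller open set \<open>N\<close>, represented
by global smooth functions and global vector fields. They have to be global because derivations and
the connection only act on global objects.\<close>

definition coordinates_on where
  "coordinates_on U \<phi> N \<xi> D \<longleftrightarrow> open N \<and> N \<subseteq> U \<and>
     (\<forall>i. \<xi> i \<in> Cinf \<A> \<and> D i \<in> vector_fields \<A>) \<and>
     (\<forall>y\<in>N. \<forall>i. \<xi> i y = \<phi> y $ i \<and> D i y = coord_vector \<A> (U, \<phi>) i y)"

lemma coordinates_exist:
  assumes c: "(U, \<phi>) \<in> \<A>" and x: "x \<in> U"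
  obtains N \<xi> D where "x \<in> N" "coordinates_on U \<phi> N \<xi> D"
proof -
  obtain \<eta> N K where \<eta>: "\<eta> \<in> Cinf \<A>" "open N" "x \<in> N" "N \<subseteq> K" "compact K" "K \<subseteq> U"
    "\<And>y. y \<in> N \<Longrightarrow> \<eta> y = 1" "\<And>y. y \<notin> K \<Longrightarrow> \<eta> y = 0"
    by (rule manifold_bump[OF chart_open[OF c] x]) (rule that; assumption)
  note cut = Cinf_cut[OF _ chart_open[OF c] compact_imp_closed[OF \<eta>(5)] \<eta>(6) \<eta>(1) \<eta>(8)]
  have ch: "(\<lambda>x. u (\<phi> x)) \<in> Cinf_on \<A> U" if u: "smooth_on (\<phi> ` U) u" for u :: "real^'n \<Rightarrow> real"
  proof -
    have "{x\<in>U. \<phi> x \<in> \<phi> ` U} = U" by auto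
    then show ?thesis using Cinf_on_chart(2)[OF c chart_open_image[OF c] subset_refl u] by simp
  qed
  define \<xi> where "\<xi> i y = (if y \<in> U then \<eta> y * (\<phi> y $ i) else 0)" for i y
  define D where "D i y = (\<lambda>f. if y \<in> U then \<eta> y * coord_vector \<A> (U, \<phi>) i y f else 0)" for i y
  have \<xi>: "\<xi> i \<in> Cinf \<A>" for i
    unfolding \<xi>_def
    by (rule cut, rule ch) (auto intro: smooth_on_bounded_linear chart_open_image[OF c] bounded_linear_vec_nth)
  have D: "D i \<in> vector_fields \<A>" for i
  proof (rule vfI)
    show "D i y \<in> tangent_space \<A> y" for y
      unfolding D_def using coord_vector_tangent[OF c] by (cases "y \<in> U") (auto simp: tan_scale tan_zero)
    fix f assume f: "f \<in> Cinf \<A>"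
    have "smooth_on (\<phi> ` U) (\<lambda>z. frechet_derivative (f \<circ> inv_into U \<phi>) (at z) (axis i 1))"
      using f c by (intro smooth_on_partial) (auto simp: Cinf_def Basis_vec_def)
    from cut[OF ch[OF this]]
    show "(\<lambda>y. D i y f) \<in> Cinf \<A>"
      by (simp add: D_def coord_vector_cong[OF f] if_distrib cong: if_cong)
  qed
  show thesis
  proof (rule that[OF \<eta>(3)])
    have NU: "N \<subseteq> U" using \<eta>(4,6) by blast
    then have "\<xi> i y = \<phi> y $ i \<and> D i y = coord_vector \<A> (U, \<phi>) i y" if "y \<in> N" for y i
      using \<eta>(7)[OF that] that by (auto simp: \<xi>_def D_def)
    then show "coordinates_on U \<phi> N \<xi> D"
      unfolding coordinates_on_def using NU \<eta>(2) \<xi> D by blast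
  qed
qed

lemma coordinates_onD:
  assumes "coordinates_on U \<phi> N \<xi> D"
  shows "open N" "N \<subseteq> U" "\<xi> i \<in> Cinf \<A>" "D i \<in> vector_fields \<A>"
    "y \<in> N \<Longrightarrow> \<xi> i y = \<phi> y $ i" "y \<in> N \<Longrightarrow> D i y = coord_vector \<A> (U, \<phi>) i y"
  using assms unfolding coordinates_on_def by auto

lemma coordinates_expand:
  assumes "(U, \<phi>) \<in> \<A>" "coordinates_on U \<phi> N \<xi> D" "y \<in> N" "v \<in> tangent_space \<A> y"
  shows "v f = (\<Sum>i\<in>UNIV. v (\<xi> i) * D i y f)"
  using tangent_expand[OF assms(1) _ assms(4), of \<xi> N f] coordinates_onD[OF assms(2)] assms(3)
  by (auto simp: subset_iff)

lemma coordinates_dual: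
  assumes c: "(U, \<phi>) \<in> \<A>" and co: "coordinates_on U \<phi> N \<xi> D" and y: "y \<in> N"
  shows "D i y (\<xi> j) = (if i = j then 1 else 0)"
proof -
  note co = coordinates_onD[OF co]
  have o: "open (\<phi> ` (U \<inter> N))" by (rule chart_open_image'[OF c co(1)])
  have yU: "y \<in> U" using y co(2) by auto
  have "((\<lambda>z. z $ j) has_derivative (\<lambda>b. b $ j)) (at (\<phi> y))"
    by (intro bounded_linear_imp_has_derivative bounded_linear_vec_nth)
  then have "((\<xi> j \<circ> inv_into U \<phi>) has_derivative (\<lambda>b. b $ j)) (at (\<phi> y))"
    by (rule has_derivative_transform_within_open[OF _ o]) (use y yU co(5) c in auto)
  then have "frechet_derivative (\<xi> j \<circ> inv_into U \<phi>) (at (\<phi> y)) = (\<lambda>b. b $ j)"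
    by (metis frechet_derivative_at)
  then show ?thesis
    using co(6)[OF y] coord_vector_cong[OF co(3)] by (simp add: axis_def)
qed

text \<open>With a cutoff \<open>\<eta>\<close> supported in a coordinate neighbourhood of \<open>x\<close>, \<open>\<eta> X = \<Sum>\<^sub>i (\<eta> X[\<xi>\<^sub>i]) D\<^sub>i\<close> holds
globally, and all coefficients vanish at \<open>x\<close>.\<close>

lemma tensorial_zero:
  fixes \<Phi> :: "'a vfield \<Rightarrow> real"
  assumes add: "\<And>X Y. X \<in> vector_fields \<A> \<Longrightarrow> Y \<in> vector_fields \<A> \<Longrightarrow> \<Phi> (vf_add X Y) = \<Phi> X + \<Phi> Y"
    and scale: "\<And>h X. h \<in> Cinf \<A> \<Longrightarrow> X \<in> vector_fields \<A> \<Longrightarrow> \<Phi> (vf_scale h X) = h x * \<Phi> X"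
    and X: "X \<in> vector_fields \<A>" and X0: "X x = (\<lambda>f. 0)"
  shows "\<Phi> X = 0"
proof -
  obtain U \<phi> where c: "(U, \<phi>) \<in> \<A>" "x \<in> U" by (rule chart_at)
  obtain N \<xi> D where N: "x \<in> N" and co: "coordinates_on U \<phi> N \<xi> D"
    by (rule coordinates_exist[OF c])
  note co' = coordinates_onD[OF co]
  obtain \<eta> N' K where \<eta>: "\<eta> \<in> Cinf \<A>" "open N'" "x \<in> N'" "N' \<subseteq> K" "compact K" "K \<subseteq> N"
    "\<And>y. y \<in> N' \<Longrightarrow> \<eta> y = 1" "\<And>y. y \<notin> K \<Longrightarrow> \<eta> y = 0"
    by (rule manifold_bump[OF co'(1) N]) (rule that; assumption)
  let ?a = "\<lambda>i y. \<eta> y * X y (\<xi> i)"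
  have a: "?a i \<in> Cinf \<A>" for i by (rule Cinf_mult[OF \<eta>(1) vf_Cinf[OF X co'(3)]])
  have in1: "vf_scale (?a i) (D i) \<in> vector_fields \<A>" for i by (rule vf_scale_in[OF a co'(4)])
  have zero: "\<Phi> (\<lambda>x f. 0) = 0"
    using add[OF vf_zero_in vf_zero_in] by (simp add: vf_add_def)
  have \<Phi>sum: "\<Phi> (vf_sum I (\<lambda>i. vf_scale (?a i) (D i))) = (\<Sum>i\<in>I. \<Phi> (vf_scale (?a i) (D i)))"
    if "finite I" for I
    using that
  proof (induction I)
    case empty
    then show ?case by (simp add: vf_sum_def zero)
  next
    case (insert i I)
    have "vf_sum (insert i I) (\<lambda>i. vf_scale (?a i) (D i))
        = vf_add (vf_scale (?a i) (D i)) (vf_sum I (\<lambda>i. vf_scale (?a i) (D i)))"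
      using insert by (simp add: vf_sum_def vf_add_def)
    then show ?case using add[OF in1 vf_sum_in[OF in1], of i I] insert by simp
  qed
  have "vf_scale \<eta> X = vf_sum UNIV (\<lambda>i. vf_scale (?a i) (D i))"
  proof (intro ext)
    fix y f
    show "vf_scale \<eta> X y f = vf_sum UNIV (\<lambda>i. vf_scale (?a i) (D i)) y f"
    proof (cases "y \<in> K")
      case True
      then have "X y f = (\<Sum>i\<in>UNIV. X y (\<xi> i) * D i y f)"
        using coordinates_expand[OF c(1) co _ vf_tan[OF X]] \<eta>(6) by blast
      then show ?thesis by (simp add: vf_scale_def vf_sum_def sum_distrib_left mult_ac)
    qed (simp add: \<eta>(8) vf_scale_def vf_sum_def)
  qed
  then have "\<Phi> (vf_scale \<eta> X) = 0"
    using \<Phi>sum[of UNIV] scale[OF a co'(4)] X0 by simp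
  then show ?thesis using scale[OF \<eta>(1) X] \<eta>(3,7) by simp
qed

text \<open>A functional that is linear over smooth functions depends only on the value of the field at \<open>x\<close>, so
it respects linear relations that hold at that single point.\<close>

lemma tensorial_sum:
  fixes \<Phi> :: "'a vfield \<Rightarrow> real"
  assumes add: "\<And>X Y. X \<in> vector_fields \<A> \<Longrightarrow> Y \<in> vector_fields \<A> \<Longrightarrow> \<Phi> (vf_add X Y) = \<Phi> X + \<Phi> Y"
    and scale: "\<And>h X. h \<in> Cinf \<A> \<Longrightarrow> X \<in> vector_fields \<A> \<Longrightarrow> \<Phi> (vf_scale h X) = h x * \<Phi> X"
    and X: "X \<in> vector_fields \<A>" and I: "finite I" "\<And>i. i \<in> I \<Longrightarrow> Y i \<in> vector_fields \<A>"
    and eq: "\<And>f. X x f = (\<Sum>i\<in>I. c i * Y i x f)"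
  shows "\<Phi> X = (\<Sum>i\<in>I. c i * \<Phi> (Y i))"
proof -
  define S where "S J = vf_sum J (\<lambda>i. vf_scale (\<lambda>_. c i) (Y i))" for J
  have zero: "\<Phi> (\<lambda>x f. 0) = 0"
    using add[OF vf_zero_in vf_zero_in] by (simp add: vf_add_def)
  have Sin: "S J \<in> vector_fields \<A>" if "J \<subseteq> I" for J
    unfolding S_def using that I(2) by (intro vf_sum_in vf_scale_in) auto
  have S: "\<Phi> (S J) = (\<Sum>i\<in>J. c i * \<Phi> (Y i))" if "finite J" "J \<subseteq> I" for J
    using that
  proof (induction J)
    case empty
    then show ?case by (simp add: S_def vf_sum_def zero)
  next
    case (insert i J)
    have "S (insert i J) = vf_add (vf_scale (\<lambda>_. c i) (Y i)) (S J)"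
      using insert by (simp add: S_def vf_sum_def vf_add_def)
    then show ?case using add[OF vf_scale_in Sin, of "\<lambda>_. c i" "Y i" J] insert I(2) scale[OF Cinf_const, of "Y i" "c i"] by simp
  qed
  let ?Z = "vf_add X (vf_scale (\<lambda>_. -1) (S I))"
  have "\<Phi> ?Z = 0"
  proof (rule tensorial_zero[of \<Phi> x, OF add scale])
    show "?Z \<in> vector_fields \<A>" by (intro vf_add_in vf_scale_in X Sin) auto
    show "?Z x = (\<lambda>f. 0)" by (simp add: eq vf_add_def vf_scale_def S_def vf_sum_def)
  qed
  moreover have "\<Phi> ?Z = \<Phi> X - \<Phi> (S I)"
    using add[OF X vf_scale_in[OF Cinf_const Sin], of I "-1"] scale[OF Cinf_const Sin, of I "-1"] by simp
  ultimately show ?thesis using S[OF I(1)] by simp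
qed

end

section \<open>Metric and Levi-Civita connection\<close>

lemma vf_add_app: "vf_add X Y x f = X x f + Y x f"
  and vf_scale_app: "vf_scale h X x f = h x * X x f"
  by (simp_all add: vf_add_def vf_scale_def)

lemma matrix_ker_surj:
  fixes M :: "real^'n^'n"
  assumes "\<And>c. M *v c = 0 \<Longrightarrow> c = 0"
  obtains c where "M *v c = z"
proof -
  obtain B where "B ** M = mat 1" using assms matrix_left_invertible_ker[of M] by blast
  then have "M ** B = mat 1" by (simp add: matrix_left_right_inverse)
  then have "M *v (B *v z) = z" by (simp add: matrix_vector_mul_assoc)
  then show thesis by (rule that)
qed

locale riemannian = smooth_manifold \<A>
  for \<A> :: "('a::{t2_space, second_countable_topology}, 'n::finite) chart set" +
  fixes g :: "'a metric" and nabla :: "'a connection"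
  assumes metric: "riemannian_metric \<A> g" and lc: "levi_civita \<A> g nabla"
begin

lemma g_lin: "u \<in> tangent_space \<A> x \<Longrightarrow> v \<in> tangent_space \<A> x \<Longrightarrow> w \<in> tangent_space \<A> x \<Longrightarrow>
    g x (\<lambda>f. u f + c * v f) w = g x u w + c * g x v w"
  and g_sym: "v \<in> tangent_space \<A> x \<Longrightarrow> w \<in> tangent_space \<A> x \<Longrightarrow> g x v w = g x w v"
  and g_pos: "v \<in> tangent_space \<A> x \<Longrightarrow> v \<noteq> (\<lambda>f. 0) \<Longrightarrow> g x v v > 0"
  and g_Cinf: "X \<in> vector_fields \<A> \<Longrightarrow> Y \<in> vector_fields \<A> \<Longrightarrow> (\<lambda>x. g x (X x) (Y x)) \<in> Cinf \<A>"
  using metric unfolding riemannian_metric_def by blast+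

lemma g_zero: "w \<in> tangent_space \<A> x \<Longrightarrow> g x (\<lambda>f. 0) w = 0"
  using g_lin[OF tan_zero tan_zero, of w x 1] by simp

lemma g_sum:
  assumes w: "w \<in> tangent_space \<A> x" and v: "\<And>i. v i \<in> tangent_space \<A> x"
  shows "g x (\<lambda>f. \<Sum>i\<in>I. c i * v i f) w = (\<Sum>i\<in>I. c i * g x (v i) w)"
proof (induction I rule: infinite_finite_induct)
  case (insert i I)
  have t: "(\<lambda>f. \<Sum>i\<in>I. c i * v i f) \<in> tangent_space \<A> x" by (intro tan_Sum tan_scale v)
  have "(\<lambda>f. \<Sum>i\<in>insert i I. c i * v i f) = (\<lambda>f. (\<Sum>i\<in>I. c i * v i f) + c i * v i f)"
    using insert by (simp add: add.commute)
  then show ?case using g_lin[OF t v w, of "c i" i] insert by simp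
qed (auto simp: g_zero[OF w])

lemma g_sum_right:
  assumes w: "w \<in> tangent_space \<A> x" and v: "\<And>i. v i \<in> tangent_space \<A> x"
  shows "g x w (\<lambda>f. \<Sum>i\<in>I. c i * v i f) = (\<Sum>i\<in>I. c i * g x w (v i))"
proof -
  have t: "(\<lambda>f. \<Sum>i\<in>I. c i * v i f) \<in> tangent_space \<A> x" by (intro tan_Sum tan_scale v)
  show ?thesis using g_sum[OF w v] by (simp add: g_sym[OF w t] g_sym[OF w v])
qed

lemma g_scale: "v \<in> tangent_space \<A> x \<Longrightarrow> w \<in> tangent_space \<A> x \<Longrightarrow> g x (\<lambda>f. c * v f) w = c * g x v w"
  using g_lin[OF tan_zero, of v x w c] by (simp add: g_zero)

lemma g_add: "u \<in> tangent_space \<A> x \<Longrightarrow> v \<in> tangent_space \<A> x \<Longrightarrow> w \<in> tangent_space \<A> x \<Longrightarrow>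
    g x (\<lambda>f. u f + v f) w = g x u w + g x v w"
  using g_lin[of u x v w 1] by simp

lemma nabla_in: "X \<in> vector_fields \<A> \<Longrightarrow> Y \<in> vector_fields \<A> \<Longrightarrow> nabla X Y \<in> vector_fields \<A>"
  and nabla_add1: "X \<in> vector_fields \<A> \<Longrightarrow> Y \<in> vector_fields \<A> \<Longrightarrow> Z \<in> vector_fields \<A> \<Longrightarrow>
    nabla (vf_add X Y) Z = vf_add (nabla X Z) (nabla Y Z)"
  and nabla_add2: "X \<in> vector_fields \<A> \<Longrightarrow> Y \<in> vector_fields \<A> \<Longrightarrow> Z \<in> vector_fields \<A> \<Longrightarrow>
    nabla X (vf_add Y Z) = vf_add (nabla X Y) (nabla X Z)"
  and nabla_scale1: "h \<in> Cinf \<A> \<Longrightarrow> X \<in> vector_fields \<A> \<Longrightarrow> Y \<in> vector_fields \<A> \<Longrightarrow>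
    nabla (vf_scale h X) Y = vf_scale h (nabla X Y)"
  and nabla_scale2: "h \<in> Cinf \<A> \<Longrightarrow> X \<in> vector_fields \<A> \<Longrightarrow> Y \<in> vector_fields \<A> \<Longrightarrow>
    nabla X (vf_scale h Y) = vf_add (vf_scale (\<lambda>x. X x h) Y) (vf_scale h (nabla X Y))"
  using lc unfolding levi_civita_def affine_connection_def by blast+

lemma torsion_free: "X \<in> vector_fields \<A> \<Longrightarrow> Y \<in> vector_fields \<A> \<Longrightarrow> f \<in> Cinf \<A> \<Longrightarrow>
    nabla X Y x f - nabla Y X x f = X x (\<lambda>y. Y y f) - Y x (\<lambda>y. X y f)"
  and metric_compat: "X \<in> vector_fields \<A> \<Longrightarrow> Y \<in> vector_fields \<A> \<Longrightarrow> Z \<in> vector_fields \<A> \<Longrightarrow>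
    X x (\<lambda>y. g y (Y y) (Z y)) = g x (nabla X Y x) (Z x) + g x (Y x) (nabla X Z x)"
  using lc unfolding levi_civita_def by blast+

lemma nabla_tensorial:
  assumes X: "X \<in> vector_fields \<A>" and Z: "Z \<in> vector_fields \<A>"
    and I: "finite I" "\<And>i. i \<in> I \<Longrightarrow> Y i \<in> vector_fields \<A>"
    and eq: "\<And>f. X x f = (\<Sum>i\<in>I. c i * Y i x f)"
  shows "nabla X Z x f = (\<Sum>i\<in>I. c i * nabla (Y i) Z x f)"
  by (rule tensorial_sum[of "\<lambda>X. nabla X Z x f" x, OF _ _ X I eq])
    (simp_all add: nabla_add1 nabla_scale1 Z, simp_all add: vf_add_def vf_scale_def)

text \<open>As in \<open>tan_local\<close>: the difference of the two fields is unchanged by multiplication with \<open>1 - \<eta>\<close>, and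
the Leibniz rule is evaluated at \<open>x\<close>, where both \<open>1 - \<eta>\<close> and the difference vanish.\<close>

lemma nabla_local:
  assumes X: "X \<in> vector_fields \<A>" and Y: "Y \<in> vector_fields \<A>" and Z: "Z \<in> vector_fields \<A>"
    and N: "open N" "x \<in> N" "\<And>y. y \<in> N \<Longrightarrow> Y y = Z y"
  shows "nabla X Y x = nabla X Z x"
proof -
  obtain \<eta> N' K where \<eta>: "\<eta> \<in> Cinf \<A>" "open N'" "x \<in> N'" "N' \<subseteq> K" "compact K" "K \<subseteq> N"
    "\<And>y. y \<in> N' \<Longrightarrow> \<eta> y = 1" "\<And>y. y \<notin> K \<Longrightarrow> \<eta> y = 0"
    by (rule manifold_bump[OF N(1,2)]) (rule that; assumption)
  let ?m = "vf_scale (\<lambda>_. -1) Z" and ?h = "\<lambda>y. 1 - \<eta> y"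
  let ?W = "vf_add Y ?m"
  have m: "?m \<in> vector_fields \<A>" by (rule vf_scale_in[OF Cinf_const Z])
  have W: "?W \<in> vector_fields \<A>" by (rule vf_add_in[OF Y m])
  have h: "?h \<in> Cinf \<A>" by (rule Cinf_diff[OF Cinf_const \<eta>(1)])
  have "vf_scale ?h ?W = ?W"
  proof (intro ext)
    fix y f show "vf_scale ?h ?W y f = ?W y f"
      using N(3)[of y] \<eta>(6) \<eta>(8)[of y] by (cases "y \<in> K") (auto simp: vf_scale_def vf_add_def)
  qed
  then have "nabla X ?W = vf_add (vf_scale (\<lambda>x. X x ?h) ?W) (vf_scale ?h (nabla X ?W))"
    using nabla_scale2[OF h X W] by (simp only:)
  then have "nabla X ?W x f = vf_add (vf_scale (\<lambda>x. X x ?h) ?W) (vf_scale ?h (nabla X ?W)) x f" for f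
    by (rule fun_cong[OF fun_cong])
  then have "nabla X ?W x f = X x ?h * ?W x f + ?h x * nabla X ?W x f" for f
    unfolding vf_add_app vf_scale_app .
  then have "nabla X ?W x f = X x ?h * 0 + 0 * nabla X ?W x f" for f
    using N(2,3) \<eta>(3,7) by (simp add: vf_add_app vf_scale_app)
  then have "nabla X ?W x f = 0" for f by simp
  moreover have "nabla X ?W x f = nabla X Y x f - nabla X Z x f" for f
    using tan_const[OF vf_tan[OF X], of x]
    by (simp add: nabla_add2[OF X Y m] nabla_scale2[OF Cinf_const X Z, of "-1"] vf_add_app vf_scale_app)
  ultimately show ?thesis by (intro ext) simp
qed

section \<open>Orthonormal frames\<close>

text \<open>In the induction step some coordinate field \<open>D\<^sub>k\<close> is, at \<open>x\<close>, outside the span of the fields found so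
far, because these are fewer than the dimension. Its orthogonal component \<open>Z\<close> is nonzero at \<open>x\<close>. It is
normalised by a global smooth function that equals \<open>1 / sqrt (g Z Z)\<close> only near \<open>x\<close>.\<close>

lemma gram_schmidt:
  fixes x :: 'a and S :: "'n set"
  shows "\<exists>E N. open N \<and> x \<in> N \<and> (\<forall>i\<in>S. E i \<in> vector_fields \<A>) \<and>
     (\<forall>y\<in>N. \<forall>i\<in>S. \<forall>j\<in>S. g y (E i y) (E j y) = (if i = j then 1 else 0))"
  using finite[of S]
proof (induction S)
  case empty
  show ?case by (intro exI[of _ "\<lambda>_. undefined"] exI[of _ UNIV]) auto
next
  case (insert a S)
  from insert.IH obtain E N where E0: "open N \<and> x \<in> N \<and> (\<forall>i\<in>S. E i \<in> vector_fields \<A>) \<and>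
     (\<forall>y\<in>N. \<forall>i\<in>S. \<forall>j\<in>S. g y (E i y) (E j y) = (if i = j then 1 else 0))"
    by (elim exE) (rule that)
  then have E: "open N" "x \<in> N" "\<And>i. i \<in> S \<Longrightarrow> E i \<in> vector_fields \<A>"
    "\<And>y i j. y \<in> N \<Longrightarrow> i \<in> S \<Longrightarrow> j \<in> S \<Longrightarrow> g y (E i y) (E j y) = (if i = j then 1 else 0)"
    by auto
  obtain U \<phi> where c: "(U, \<phi>) \<in> \<A>" "x \<in> U" by (rule chart_at)
  obtain M \<xi> D where M: "x \<in> M" and co: "coordinates_on U \<phi> M \<xi> D"
    by (rule coordinates_exist[OF c])
  note co' = coordinates_onD[OF co]
  define w where "w i = (\<chi> j. E i x (\<xi> j))" for i
  \<comment> \<open>Fewer vectors than the dimension cannot span all coordinate directions.\<close>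
  have "\<exists>k. axis k 1 \<notin> span (w ` S)"
  proof (rule ccontr)
    assume "\<not> ?thesis"
    then have "(Basis :: (real^'n) set) \<subseteq> span (w ` S)" by (auto simp: Basis_vec_def)
    then have "span (w ` S) = UNIV" using span_mono[of Basis "span (w ` S)"] by (auto simp: span_span)
    then have "dim (w ` S) = CARD('n)" by (metis dim_span dim_UNIV DIM_cart DIM_real mult.right_neutral)
    moreover have "dim (w ` S) \<le> card (w ` S)" by (rule dim_le_card') simp
    moreover have "card (w ` S) \<le> card S" by (rule card_image_le) simp
    moreover have "card S < CARD('n)" using insert(2) by (intro psubset_card_mono) auto
    ultimately show False by linarith
  qed
  then obtain k where k: "axis k 1 \<notin> span (w ` S)" by blast
  let ?c = "\<lambda>i y. g y (D k y) (E i y)"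
  define Z where "Z = vf_add (D k) (vf_sum S (\<lambda>i. vf_scale (\<lambda>y. - ?c i y) (E i)))"
  have Z: "Z \<in> vector_fields \<A>"
    unfolding Z_def
    by (intro vf_add_in vf_sum_in vf_scale_in Cinf_minus g_Cinf co'(4) E(3))
  have Zeq: "Z y = (\<lambda>f. D k y f + (-1) * (\<Sum>i\<in>S. ?c i y * E i y f))" for y
    by (simp add: Z_def vf_add_def vf_sum_def vf_scale_def sum_negf)
  have tS: "(\<lambda>f. \<Sum>i\<in>S. ?c i y * E i y f) \<in> tangent_space \<A> y" for y
    by (intro tan_Sum tan_scale vf_tan E(3))
  have Zorth: "g y (Z y) (E j y) = 0" if y: "y \<in> N" and j: "j \<in> S" for y j
  proof -
    let ?F = "\<lambda>i. if i \<in> S then E i y else (\<lambda>f. 0)"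
    have F: "?F i \<in> tangent_space \<A> y" for i using vf_tan[OF E(3)] tan_zero by auto
    have "g y (\<lambda>f. \<Sum>i\<in>S. ?c i y * ?F i f) (E j y) = (\<Sum>i\<in>S. ?c i y * g y (?F i) (E j y))"
      by (rule g_sum[OF vf_tan[OF E(3)[OF j]] F])
    also have "\<dots> = (\<Sum>i\<in>S. if i = j then ?c i y else 0)"
      using E(4)[OF y _ j] by (intro sum.cong) auto
    also have "\<dots> = ?c j y" using j by simp
    finally have "g y (\<lambda>f. \<Sum>i\<in>S. ?c i y * ?F i f) (E j y) = ?c j y" .
    moreover have "(\<lambda>f. \<Sum>i\<in>S. ?c i y * ?F i f) = (\<lambda>f. \<Sum>i\<in>S. ?c i y * E i y f)"
      by (intro ext sum.cong) auto
    ultimately show ?thesis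
      using g_lin[OF vf_tan[OF co'(4)[of k]] tS vf_tan[OF E(3)[OF j]], where c="-1"] Zeq[of y] by simp
  qed
  have "Z x \<noteq> (\<lambda>f. 0)"
  proof
    assume z: "Z x = (\<lambda>f. 0)"
    have "axis k 1 = (\<Sum>i\<in>S. ?c i x *\<^sub>R w i)"
    proof (subst vec_eq_iff, rule allI)
      fix j
      have "Z x (\<xi> j) = 0" using z by simp
      then have "D k x (\<xi> j) = (\<Sum>i\<in>S. ?c i x * E i x (\<xi> j))" by (simp add: Zeq)
      then show "axis k 1 $ j = (\<Sum>i\<in>S. ?c i x *\<^sub>R w i) $ j"
        using coordinates_dual[OF c(1) co M, where i=k and j=j]
        by (cases "j = k") (simp_all add: w_def axis_def)
    qed
    also have "\<dots> \<in> span (w ` S)" by (intro span_sum span_scale span_base) auto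
    finally show False using k by simp
  qed
  then have pos: "g x (Z x) (Z x) > 0" by (rule g_pos[OF vf_tan[OF Z]])
  let ?q = "\<lambda>y. g y (Z y) (Z y)"
  have q: "?q \<in> Cinf \<A>" by (rule g_Cinf[OF Z Z])
  define Q where "Q = {y. ?q y \<in> {0<..}}"
  have Q: "open Q" "x \<in> Q"
    using open_Collect_less[OF continuous_on_const Cinf_continuous[OF q], of 0] pos
    by (simp_all add: Q_def)
  have qp: "(\<lambda>y. ?q y powr (-1/2)) \<in> Cinf_on \<A> Q"
    by (rule Cinf_on_compose[OF Q(1) Cinf_imp_on[OF q] open_greaterThan smooth_on_powr]) (auto simp: Q_def)
  obtain \<rho> P where \<rho>: "\<rho> \<in> Cinf \<A>" "open P" "x \<in> P" "P \<subseteq> Q" "\<And>y. y \<in> P \<Longrightarrow> \<rho> y = ?q y powr (-1/2)"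
    by (rule Cinf_local_extension[OF qp Q]) (rule that; assumption)
  define E' where "E' = E(a := vf_scale \<rho> Z)"
  have \<rho>q: "\<rho> y * (\<rho> y * ?q y) = 1" if y: "y \<in> P" for y
  proof -
    have "?q y > 0" using y \<rho>(4) by (auto simp: Q_def)
    then have "?q y powr (-1/2) * (?q y powr (-1/2) * ?q y powr 1) = 1"
      by (simp only: powr_add[symmetric]) simp
    then show ?thesis using \<rho>(5)[OF y] \<open>?q y > 0\<close> by simp
  qed
  note tZ = vf_tan[OF Z]
  have orth: "g y (E' i y) (E' j y) = (if i = j then 1 else 0)"
    if y: "y \<in> N \<inter> P" and i: "i \<in> insert a S" and j: "j \<in> insert a S" for y i j
  proof -
    have 1: "g y (vf_scale \<rho> Z y) v = \<rho> y * g y (Z y) v" if "v \<in> tangent_space \<A> y" for v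
      unfolding vf_scale_def by (rule g_scale[OF tZ that])
    have 2: "g y v (vf_scale \<rho> Z y) = \<rho> y * g y v (Z y)" if v: "v \<in> tangent_space \<A> y" for v
      using 1[OF v] g_sym[OF v tZ] g_sym[OF v, of "vf_scale \<rho> Z y"] tan_scale[OF tZ, of "\<rho> y" y]
      by (simp add: vf_scale_def)
    have 3: "g y (E l y) (Z y) = 0" if "l \<in> S" for l
      using Zorth[of y l] y that g_sym[OF vf_tan[OF E(3)[OF that]] tZ] by simp
    have tr: "vf_scale \<rho> Z y \<in> tangent_space \<A> y" unfolding vf_scale_def by (rule tan_scale[OF tZ])
    consider "i = a" "j = a" | "i = a" "j \<in> S" "j \<noteq> a" | "i \<in> S" "i \<noteq> a" "j = a" | "i \<in> S" "i \<noteq> a" "j \<in> S" "j \<noteq> a"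
      using i j insert(2) by auto
    then show ?thesis
    proof cases
      case 1
      then show ?thesis using y \<rho>q[of y] 2[OF tr] \<open>\<And>v. v \<in> tangent_space \<A> y \<Longrightarrow> g y (vf_scale \<rho> Z y) v = \<rho> y * g y (Z y) v\<close>[OF tZ]
        by (simp add: E'_def)
    next
      case 2
      then show ?thesis using 1[OF vf_tan[OF E(3)]] Zorth y by (simp add: E'_def)
    next
      case 3
      then show ?thesis using 2[OF vf_tan[OF E(3)]] \<open>\<And>l. l \<in> S \<Longrightarrow> g y (E l y) (Z y) = 0\<close> by (simp add: E'_def)
    next
      case 4
      then show ?thesis using E(4) y by (simp add: E'_def)
    qed
  qed
  have "E' i \<in> vector_fields \<A>" if "i \<in> insert a S" for i
    using that E(3) vf_scale_in[OF \<rho>(1) Z] by (auto simp: E'_def)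
  then show ?case using orth E(1,2) \<rho>(2,3)
    by (intro exI[of _ E'] exI[of _ "N \<inter> P"]) auto
qed

lemma orthonormal_frame_exists: "\<exists>F. orthonormal_frame_at \<A> g x F"
proof -
  from gram_schmidt[of x UNIV] obtain E N where "open N \<and> x \<in> N \<and> (\<forall>i\<in>UNIV. E i \<in> vector_fields \<A>) \<and>
     (\<forall>y\<in>N. \<forall>i\<in>UNIV. \<forall>j\<in>UNIV. g y (E i y) (E j y) = (if (i::'n) = j then 1 else 0))"
    by (elim exE) (rule that)
  then have E: "open N" "x \<in> N" "\<And>i. E i \<in> vector_fields \<A>"
    "\<And>y i j. y \<in> N \<Longrightarrow> g y (E i y) (E j y) = (if i = j then 1 else 0)"
    by auto
  define \<epsilon> where "\<epsilon> i X = (if X \<in> vector_fields \<A> then (\<lambda>y. g y (X y) (E i y)) else (\<lambda>y. 0))" for i X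
  have in1: "\<epsilon> i X = (\<lambda>y. g y (X y) (E i y))" if "X \<in> vector_fields \<A>" for i X
    using that by (simp add: \<epsilon>_def)
  have "\<epsilon> i \<in> one_forms \<A>" for i
    unfolding one_forms_def mem_Collect_eq
  proof (intro conjI ballI allI impI)
    fix X Y assume X: "X \<in> vector_fields \<A>"
    show "\<epsilon> i X \<in> Cinf \<A>" unfolding in1[OF X] by (rule g_Cinf[OF X E(3)])
    show "\<epsilon> i (vf_scale h X) = (\<lambda>x. h x * \<epsilon> i X x)" if h: "h \<in> Cinf \<A>" for h
      unfolding in1[OF X] in1[OF vf_scale_in[OF h X]]
      by (simp add: vf_scale_def g_scale[OF vf_tan[OF X] vf_tan[OF E(3)]])
    assume Y: "Y \<in> vector_fields \<A>"
    show "\<epsilon> i (vf_add X Y) = (\<lambda>x. \<epsilon> i X x + \<epsilon> i Y x)"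
      unfolding in1[OF X] in1[OF Y] in1[OF vf_add_in[OF X Y]]
      by (simp add: vf_add_def g_add[OF vf_tan[OF X] vf_tan[OF Y] vf_tan[OF E(3)]])
  next
    fix X assume "X \<notin> vector_fields \<A>"
    then show "\<epsilon> i X = (\<lambda>x. 0)" by (simp add: \<epsilon>_def)
  qed
  then have "orthonormal_frame_at \<A> g x (E, \<epsilon>)"
    unfolding orthonormal_frame_at_def using E
    by (auto simp: \<epsilon>_def intro!: exI[of _ N])
  then show ?thesis ..
qed

lemma orthonormal_frameD:
  assumes F: "orthonormal_frame \<A> g x = (E, \<epsilon>)"
  shows "E i \<in> vector_fields \<A>" "\<epsilon> i \<in> one_forms \<A>"
    "g x (E i x) (E j x) = (if i = j then 1 else 0)" "\<epsilon> i (E j) x = (if i = j then 1 else 0)"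
proof -
  have "orthonormal_frame_at \<A> g x (E, \<epsilon>)"
    unfolding F[symmetric] orthonormal_frame_def by (rule someI_ex[OF orthonormal_frame_exists])
  then show "E i \<in> vector_fields \<A>" "\<epsilon> i \<in> one_forms \<A>"
    "g x (E i x) (E j x) = (if i = j then 1 else 0)" "\<epsilon> i (E j) x = (if i = j then 1 else 0)"
    unfolding orthonormal_frame_at_def by auto
qed

text \<open>Orthonormal vectors are linearly independent, and in coordinates there are as many as the dimension.
So the matrix of their components is invertible, they span, and the coefficients are read off by
taking inner products.\<close>

lemma orthonormal_expand:
  assumes e: "\<And>i. e i \<in> tangent_space \<A> y"
    and on: "\<And>i j. g y (e i) (e j) = (if i = j then 1 else 0)"
    and v: "v \<in> tangent_space \<A> y"
  shows "v = (\<lambda>f. \<Sum>i\<in>UNIV. g y v (e i) * e (i::'n) f)"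
proof -
  obtain U \<phi> where c: "(U, \<phi>) \<in> \<A>" "y \<in> U" by (rule chart_at)
  obtain M \<xi> D where M: "y \<in> M" and co: "coordinates_on U \<phi> M \<xi> D"
    by (rule coordinates_exist[OF c])
  have coord: "u = (\<lambda>f. \<Sum>i\<in>UNIV. c $ i * e i f)"
    if u: "u \<in> tangent_space \<A> y" and eq: "\<And>j. u (\<xi> j) = (\<Sum>i\<in>UNIV. c $ i * e i (\<xi> j))" for u and c :: "real^'n"
  proof
    fix f
    have "u f = (\<Sum>j\<in>UNIV. u (\<xi> j) * D j y f)" by (rule coordinates_expand[OF c(1) co M u])
    also have "\<dots> = (\<Sum>i\<in>UNIV. c $ i * (\<Sum>j\<in>UNIV. e i (\<xi> j) * D j y f))"
      unfolding eq sum_distrib_right sum_distrib_left by (subst sum.swap) (simp add: mult_ac)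
    also have "\<dots> = (\<Sum>i\<in>UNIV. c $ i * e i f)"
      by (simp only: coordinates_expand[OF c(1) co M e, symmetric])
    finally show "u f = (\<Sum>i\<in>UNIV. c $ i * e i f)" .
  qed
  have coef: "g y (\<lambda>f. \<Sum>i\<in>UNIV. c $ i * e i f) (e j) = c $ j" for c :: "real^'n" and j
    by (subst g_sum[OF e e]) (simp add: on if_distrib cong: if_cong)
  let ?M = "(\<chi> j i. e i (\<xi> j)) :: real^'n^'n"
  have "c = 0" if "?M *v c = 0" for c
  proof -
    have "(\<lambda>f. 0) = (\<lambda>f. \<Sum>i\<in>UNIV. c $ i * e i f)"
      by (rule coord[OF tan_zero])
        (use that in \<open>simp add: matrix_vector_mult_def vec_eq_iff mult.commute\<close>)
    then have "c $ j = 0" for j using coef[of c j] g_zero[OF e, of j] by simp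
    then show ?thesis by (simp add: vec_eq_iff)
  qed
  then obtain c where cc: "?M *v c = (\<chi> j. v (\<xi> j))"
    using matrix_ker_surj[of ?M "\<chi> j. v (\<xi> j)"] by blast
  have ve: "v = (\<lambda>f. \<Sum>i\<in>UNIV. c $ i * e i f)"
    by (rule coord[OF v]) (use cc in \<open>simp add: matrix_vector_mult_def vec_eq_iff mult.commute\<close>)
  have "g y v (e j) = c $ j" for j unfolding ve by (rule coef)
  then show ?thesis by (simp only:) (rule ve)
qed

lemma one_form_add: "\<alpha> \<in> one_forms \<A> \<Longrightarrow> X \<in> vector_fields \<A> \<Longrightarrow> Y \<in> vector_fields \<A> \<Longrightarrow>
    \<alpha> (vf_add X Y) = (\<lambda>x. \<alpha> X x + \<alpha> Y x)"
  and one_form_scale: "\<alpha> \<in> one_forms \<A> \<Longrightarrow> h \<in> Cinf \<A> \<Longrightarrow> X \<in> vector_fields \<A> \<Longrightarrow>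
    \<alpha> (vf_scale h X) = (\<lambda>x. h x * \<alpha> X x)"
  and one_form_Cinf: "\<alpha> \<in> one_forms \<A> \<Longrightarrow> X \<in> vector_fields \<A> \<Longrightarrow> \<alpha> X \<in> Cinf \<A>"
  unfolding one_forms_def by blast+

lemma one_form_tensorial:
  assumes \<alpha>: "\<alpha> \<in> one_forms \<A>" and X: "X \<in> vector_fields \<A>"
    and I: "finite I" "\<And>i. i \<in> I \<Longrightarrow> Y i \<in> vector_fields \<A>"
    and eq: "\<And>f. X x f = (\<Sum>i\<in>I. c i * Y i x f)"
  shows "\<alpha> X x = (\<Sum>i\<in>I. c i * \<alpha> (Y i) x)"
  by (rule tensorial_sum[of "\<lambda>X. \<alpha> X x" x, OF _ _ X I eq])
    (simp_all add: one_form_add[OF \<alpha>] one_form_scale[OF \<alpha>])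

text \<open>The coframe of a frame is only postulated to be dual to it. Pointwise dependence of one-forms on
their argument forces it to be the metric dual.\<close>

lemma frame_expand:
  assumes F: "orthonormal_frame \<A> g x = (E, \<epsilon>)" and X: "X \<in> vector_fields \<A>"
  shows "X x f = (\<Sum>i\<in>UNIV. \<epsilon> i X x * E i x f)" "\<epsilon> i X x = g x (X x) (E i x)"
proof -
  note F' = orthonormal_frameD[OF F]
  have ex: "X x f = (\<Sum>i\<in>UNIV. g x (X x) (E i x) * E i x f)" for f
    by (rule fun_cong[OF orthonormal_expand[OF vf_tan[OF F'(1)] F'(3) vf_tan[OF X]]])
  have "\<epsilon> i X x = (\<Sum>j\<in>UNIV. g x (X x) (E j x) * \<epsilon> i (E j) x)" for i
    by (rule one_form_tensorial[OF F'(2) X finite F'(1) ex])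
  then have \<epsilon>: "\<epsilon> i X x = g x (X x) (E i x)" for i
    by (simp add: F'(4) if_distrib cong: if_cong)
  then show "\<epsilon> i X x = g x (X x) (E i x)" .
  show "X x f = (\<Sum>i\<in>UNIV. \<epsilon> i X x * E i x f)" using ex[of f] by (simp add: \<epsilon>)
qed

section \<open>Divergence of vector fields\<close>

text \<open>The trace does not depend on the basis: the frame is expanded in coordinate vectors in the derivative
slot, and the resulting vectors are expanded in the frame.\<close>

lemma vf_div_coordinates:
  assumes c: "(U, \<phi>) \<in> \<A>" and co: "coordinates_on U \<phi> N \<xi> D" and y: "y \<in> N"
    and X: "X \<in> vector_fields \<A>"
  shows "vf_div \<A> g nabla X y = (\<Sum>k\<in>UNIV. nabla (D k) X y (\<xi> k))"
proof -
  note co' = coordinates_onD[OF co]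
  obtain E \<epsilon> where F0: "orthonormal_frame \<A> g y = (E, \<epsilon>)" by fastforce
  note F = orthonormal_frameD[OF F0]
  note tD = vf_tan[OF nabla_in[OF co'(4) X]]
  have N: "nabla (E i) X y = (\<lambda>f. \<Sum>k\<in>UNIV. E i y (\<xi> k) * nabla (D k) X y f)" for i
    by (rule ext, rule nabla_tensorial[OF F(1) X finite co'(4) coordinates_expand[OF c co y vf_tan[OF F(1)]]])
  have "vf_div \<A> g nabla X y = (\<Sum>i\<in>UNIV. g y (nabla (E i) X y) (E i y))"
    using frame_expand(2)[OF F0 nabla_in[OF F(1) X]] by (simp add: vf_div_def trace_at_def F0)
  also have "\<dots> = (\<Sum>i\<in>UNIV. \<Sum>k\<in>UNIV. E i y (\<xi> k) * g y (nabla (D k) X y) (E i y))"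
    unfolding N by (intro sum.cong refl g_sum vf_tan[OF F(1)] tD)
  also have "\<dots> = (\<Sum>k\<in>UNIV. \<Sum>i\<in>UNIV. g y (nabla (D k) X y) (E i y) * E i y (\<xi> k))"
    by (subst sum.swap) (simp add: mult.commute)
  also have "\<dots> = (\<Sum>k\<in>UNIV. nabla (D k) X y (\<xi> k))"
  proof (rule sum.cong[OF refl])
    fix k
    show "(\<Sum>i\<in>UNIV. g y (nabla (D k) X y) (E i y) * E i y (\<xi> k)) = nabla (D k) X y (\<xi> k)"
      by (rule fun_cong[OF orthonormal_expand[OF vf_tan[OF F(1)] F(3) tD], symmetric])
  qed
  finally show ?thesis .
qed

lemma coordinates_at:
  obtains U \<phi> N \<xi> D where "(U, \<phi>) \<in> \<A>" "x \<in> N" "coordinates_on U \<phi> N \<xi> D"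
  by (meson chart_at coordinates_exist)

lemma vf_div_Cinf:
  assumes X: "X \<in> vector_fields \<A>" shows "vf_div \<A> g nabla X \<in> Cinf \<A>"
proof (rule Cinf_local)
  fix x
  obtain U \<phi> N \<xi> D where c: "(U, \<phi>) \<in> \<A>" "x \<in> N" "coordinates_on U \<phi> N \<xi> D" by (rule coordinates_at)
  note co' = coordinates_onD[OF c(3)]
  have "(\<lambda>y. \<Sum>k\<in>UNIV. nabla (D k) X y (\<xi> k)) \<in> Cinf \<A>"
    by (rule Cinf_sum, rule vf_Cinf[OF nabla_in[OF co'(4) X] co'(3)])
  then show "\<exists>M h. open M \<and> x \<in> M \<and> h \<in> Cinf_on \<A> M \<and> (\<forall>y\<in>M. vf_div \<A> g nabla X y = h y)"
    using vf_div_coordinates[OF c(1,3) _ X] co'(1) c(2) Cinf_imp_on by blast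
qed

lemma vf_div_add:
  assumes X: "X \<in> vector_fields \<A>" and Y: "Y \<in> vector_fields \<A>"
  shows "vf_div \<A> g nabla (vf_add X Y) x = vf_div \<A> g nabla X x + vf_div \<A> g nabla Y x"
proof -
  obtain U \<phi> N \<xi> D where c: "(U, \<phi>) \<in> \<A>" "x \<in> N" "coordinates_on U \<phi> N \<xi> D" by (rule coordinates_at)
  note co' = coordinates_onD[OF c(3)]
  show ?thesis
    by (simp add: vf_div_coordinates[OF c(1,3,2)] X Y vf_add_in nabla_add2 co'(4) sum.distrib)
      (simp add: vf_add_def sum.distrib)
qed

lemma vf_div_scale:
  assumes X: "X \<in> vector_fields \<A>" and h: "h \<in> Cinf \<A>"
  shows "vf_div \<A> g nabla (vf_scale h X) x = h x * vf_div \<A> g nabla X x + X x h"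
proof -
  obtain U \<phi> N \<xi> D where c: "(U, \<phi>) \<in> \<A>" "x \<in> N" "coordinates_on U \<phi> N \<xi> D" by (rule coordinates_at)
  note co' = coordinates_onD[OF c(3)]
  have "X x h = (\<Sum>k\<in>UNIV. X x (\<xi> k) * D k x h)" by (rule coordinates_expand[OF c(1,3,2) vf_tan[OF X]])
  then show ?thesis
    by (simp add: vf_div_coordinates[OF c(1,3,2)] X vf_scale_in nabla_scale2 h co'(4))
      (simp add: vf_add_def vf_scale_def sum.distrib sum_distrib_left mult.commute)
qed

lemma vf_div_local:
  assumes X: "X \<in> vector_fields \<A>" and Y: "Y \<in> vector_fields \<A>"
    and N: "open N" "x \<in> N" "\<And>y. y \<in> N \<Longrightarrow> X y = Y y"
  shows "vf_div \<A> g nabla X x = vf_div \<A> g nabla Y x"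
proof -
  obtain U \<phi> M \<xi> D where c: "(U, \<phi>) \<in> \<A>" "x \<in> M" "coordinates_on U \<phi> M \<xi> D" by (rule coordinates_at)
  note co' = coordinates_onD[OF c(3)]
  show ?thesis
    by (simp add: vf_div_coordinates[OF c(1,3,2)] X Y nabla_local[OF co'(4) X Y N])
qed

lemma vf_div_sum:
  assumes "finite I" "\<And>i. i \<in> I \<Longrightarrow> X i \<in> vector_fields \<A>"
  shows "vf_div \<A> g nabla (vf_sum I X) x = (\<Sum>i\<in>I. vf_div \<A> g nabla (X i) x)"
  using assms
proof (induction I)
  case empty
  have "vf_sum {} X = vf_scale (\<lambda>_. 0) (\<lambda>x f. 0)" by (simp add: vf_sum_def vf_scale_def)
  then show ?case using vf_div_scale[OF vf_zero_in Cinf_const, of 0 x] by simp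
next
  case (insert i I)
  have "vf_sum (insert i I) X = vf_add (X i) (vf_sum I X)"
    using insert by (simp add: vf_sum_def vf_add_def)
  then show ?case using vf_div_add[of "X i" "vf_sum I X" x] vf_sum_in[of I X] insert by simp
qed

section \<open>The volume density\<close>

lemma tan_prod:
  assumes v: "v \<in> tangent_space \<A> y" and f: "\<And>i. f i \<in> Cinf \<A>" and S: "finite S"
  shows "v (\<lambda>z. \<Prod>i\<in>S. f i z) = (\<Sum>i\<in>S. \<Prod>j\<in>S. if j = i then v (f i) else f j y)"
  using S
proof (induction S)
  case empty
  then show ?case by (simp add: tan_const[OF v])
next
  case (insert a S)
  have "v (\<lambda>z. f a z * (\<Prod>i\<in>S. f i z)) = f a y * v (\<lambda>z. \<Prod>i\<in>S. f i z) + (\<Prod>i\<in>S. f i y) * v (f a)"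
    by (rule tan_mult[OF v f Cinf_prod[OF f]])
  moreover have "(\<Prod>j\<in>S. if j = a then v (f a) else f j y) = (\<Prod>i\<in>S. f i y)"
    using insert by (intro prod.cong) auto
  moreover have "(\<Sum>i\<in>S. \<Prod>j\<in>insert a S. if j = i then v (f i) else f j y)
      = (\<Sum>i\<in>S. f a y * (\<Prod>j\<in>S. if j = i then v (f i) else f j y))"
    using insert by (intro sum.cong) auto
  ultimately show ?case using insert by (simp add: sum_distrib_left)
qed

text \<open>Jacobi's formula. The derivative of a determinant is the sum over rows of the determinant with that
row differentiated. By hypothesis the differentiated row \<open>i\<close> is the combination of the rows with
coefficients from row \<open>i\<close> of \<open>C\<close>, so by Cramer's lemma its determinant is \<open>C $ i $ i\<close> times the
original one.\<close>

lemma tan_det: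
  fixes G :: "'n \<Rightarrow> 'n \<Rightarrow> 'a \<Rightarrow> real" and C :: "real^'n^'n"
  assumes v: "v \<in> tangent_space \<A> y" and G: "\<And>i j. G i j \<in> Cinf \<A>"
    and M: "(\<chi> i j. v (G i j)) = C ** (\<chi> i j. G i j y)"
  shows "(\<lambda>z. det (\<chi> i j. G i j z)) \<in> Cinf \<A>"
    "v (\<lambda>z. det (\<chi> i j. G i j z)) = trace C * det (\<chi> i j. G i j y)"
proof -
  let ?A = "(\<chi> i j. G i j y) :: real^'n^'n"
  let ?P = "{p. p permutes (UNIV :: 'n set)}"
  show "(\<lambda>z. det (\<chi> i j. G i j z)) \<in> Cinf \<A>"
    unfolding det_def by (auto intro!: Cinf_sum Cinf_mult Cinf_prod G)
  have "v (\<lambda>z. det (\<chi> i j. G i j z)) = v (\<lambda>z. \<Sum>p\<in>?P. of_int (sign p) * (\<Prod>i\<in>UNIV. G i (p i) z))"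
    by (simp add: det_def)
  also have "\<dots> = (\<Sum>p\<in>?P. of_int (sign p) * (\<Sum>i\<in>UNIV. \<Prod>j\<in>UNIV. if j = i then v (G i (p i)) else G j (p j) y))"
    by (subst tan_sum[OF v]) (auto intro!: Cinf_sum Cinf_mult Cinf_prod G sum.cong
        simp: tan_cmult[OF v Cinf_prod[OF G]] tan_prod[OF v G])
  also have "\<dots> = (\<Sum>i\<in>UNIV. \<Sum>p\<in>?P. of_int (sign p) * (\<Prod>j\<in>UNIV. if j = i then v (G i (p i)) else G j (p j) y))"
    unfolding sum_distrib_left by (rule sum.swap)
  also have "\<dots> = (\<Sum>i\<in>UNIV. det ((\<chi> k. if k = i then sum (\<lambda>l. (C $ i) $ l *s row l ?A) UNIV else row k ?A) :: real^'n^'n))"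
  proof (intro sum.cong refl)
    fix i
    have "sum (\<lambda>l. (C $ i) $ l *s row l ?A) UNIV $ j = v (G i j)" for j
    proof -
      have "v (G i j) = ((\<chi> i j. v (G i j)) :: real^'n^'n) $ i $ j" by simp
      also have "\<dots> = (\<Sum>l\<in>UNIV. C $ i $ l * G l j y)" unfolding M by (simp add: matrix_matrix_mult_def)
      finally show ?thesis by (simp add: row_def)
    qed
    then show "(\<Sum>p\<in>?P. of_int (sign p) * (\<Prod>j\<in>UNIV. if j = i then v (G i (p i)) else G j (p j) y))
      = det ((\<chi> k. if k = i then sum (\<lambda>l. (C $ i) $ l *s row l ?A) UNIV else row k ?A) :: real^'n^'n)"
      unfolding det_def by (intro sum.cong refl arg_cong2[of _ _ _ _ "(*)"] prod.cong) (auto simp: row_def)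
  qed
  also have "\<dots> = trace C * det ?A"
    unfolding cramer_lemma_transpose by (simp add: trace_def sum_distrib_right)
  finally show "v (\<lambda>z. det (\<chi> i j. G i j z)) = trace C * det ?A" .
qed

definition gram :: "('n \<Rightarrow> 'a vfield) \<Rightarrow> 'a \<Rightarrow> real^'n^'n" where
  "gram D y = (\<chi> i j. g y (D i y) (D j y))"

text \<open>In an orthonormal frame \<open>G = A A\<^sup>T\<close>, so \<open>det G\<close> is a square; and a vector in the kernel of \<open>G\<close> gives a
combination of coordinate vectors of length zero.\<close>

lemma gram_det_pos:
  assumes c: "(U, \<phi>) \<in> \<A>" and co: "coordinates_on U \<phi> N \<xi> D" and y: "y \<in> N"
  shows "det (gram D y) > 0" "\<exists>B. gram D y ** B = mat 1"
proof -
  note co' = coordinates_onD[OF co]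
  note tD = vf_tan[OF co'(4)]
  obtain E \<epsilon> where F0: "orthonormal_frame \<A> g y = (E, \<epsilon>)" by fastforce
  note F = orthonormal_frameD[OF F0]
  let ?A = "(\<chi> i k. g y (D i y) (E k y)) :: real^'n^'n"
  have "gram D y = ?A ** transpose ?A"
  proof -
    have "g y (D i y) (D j y) = (\<Sum>k\<in>UNIV. g y (D i y) (E k y) * g y (D j y) (E k y))" for i j
    proof -
      have "D j y = (\<lambda>f. \<Sum>k\<in>UNIV. g y (D j y) (E k y) * E k y f)"
        by (rule orthonormal_expand[OF vf_tan[OF F(1)] F(3) tD])
      then have "g y (D i y) (D j y) = g y (D i y) (\<lambda>f. \<Sum>k\<in>UNIV. g y (D j y) (E k y) * E k y f)" by simp
      also have "\<dots> = (\<Sum>k\<in>UNIV. g y (D j y) (E k y) * g y (D i y) (E k y))"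
        by (rule g_sum_right[OF tD vf_tan[OF F(1)]])
      finally show ?thesis by (simp add: mult.commute)
    qed
    then show ?thesis by (simp add: gram_def matrix_matrix_mult_def transpose_def)
  qed
  then have d: "det (gram D y) = (det ?A)^2" by (simp add: det_mul det_transpose power2_eq_square)
  have ker: "w = 0" if w: "gram D y *v w = 0" for w
  proof -
    let ?v = "\<lambda>f. \<Sum>i\<in>UNIV. w $ i * D i y f"
    have v: "?v \<in> tangent_space \<A> y" by (intro tan_Sum tan_scale tD)
    have "g y (D i y) ?v = 0" for i
      using w
      by (simp add: gram_def matrix_vector_mult_def vec_eq_iff mult.commute g_sum_right[OF tD tD])
    then have "g y ?v ?v = 0" by (simp add: g_sum[OF v tD])
    then have "?v = (\<lambda>f. 0)" using g_pos[OF v] by fastforce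
    then have "(\<Sum>i\<in>UNIV. w $ i * D i y (\<xi> j)) = 0" for j by (rule fun_cong)
    then have "w $ j = 0" for j
      by (simp add: coordinates_dual[OF c co y] if_distrib cong: if_cong)
    then show ?thesis by (simp add: vec_eq_iff)
  qed
  then obtain B where "B ** gram D y = mat 1" using matrix_left_invertible_ker[of "gram D y"] by blast
  then show inv: "\<exists>B. gram D y ** B = mat 1" using matrix_left_right_inverse by blast
  then have "det (gram D y) \<noteq> 0"
    by (metis det_I det_mul mult_zero_left zero_neq_one)
  then show "det (gram D y) > 0" using d by simp
qed

text \<open>Let \<open>\<Gamma>\<close> be the matrix of \<open>D\<^sub>i \<mapsto> \<nabla>\<^bsub>D\<^sub>j\<^esub> D\<^sub>i\<close> in coordinates. Metric compatibility says that \<open>G\<close> has derivative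
\<open>\<Gamma> G + G \<Gamma>\<^sup>T = (\<Gamma> + G \<Gamma>\<^sup>T G\<^sup>-\<^sup>1) G\<close>, and the bracket has trace \<open>2 tr \<Gamma>\<close>. Coordinate fields commute, so
vanishing torsion identifies \<open>tr \<Gamma>\<close> with the divergence of \<open>D\<^sub>j\<close>.\<close>

lemma gram_det_deriv:
  assumes c: "(U, \<phi>) \<in> \<A>" and co: "coordinates_on U \<phi> N \<xi> D" and y: "y \<in> N"
  shows "(\<lambda>z. det (gram D z)) \<in> Cinf \<A>"
    "D j y (\<lambda>z. det (gram D z)) = 2 * vf_div \<A> g nabla (D j) y * det (gram D y)"
proof -
  note co' = coordinates_onD[OF co]
  note tD = vf_tan[OF co'(4)]
  let ?\<Gamma> = "(\<chi> i l. nabla (D j) (D i) y (\<xi> l)) :: real^'n^'n"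
  let ?G = "gram D y"
  obtain B where B: "?G ** B = mat 1" using gram_det_pos(2)[OF c co y] by blast
  then have B': "B ** ?G = mat 1" by (simp add: matrix_left_right_inverse)
  let ?C = "?\<Gamma> + (?G ** transpose ?\<Gamma>) ** B"
  have n: "nabla (D j) (D i) y = (\<lambda>f. \<Sum>l\<in>UNIV. nabla (D j) (D i) y (\<xi> l) * D l y f)" for i
    by (rule ext, rule coordinates_expand[OF c co y vf_tan[OF nabla_in[OF co'(4) co'(4)]]])
  have "(\<chi> i k. D j y (\<lambda>z. g z (D i z) (D k z))) = ?\<Gamma> ** ?G + ?G ** transpose ?\<Gamma>"
  proof (simp add: vec_eq_iff, intro allI)
    fix i k
    have "D j y (\<lambda>z. g z (D i z) (D k z)) = g y (nabla (D j) (D i) y) (D k y) + g y (D i y) (nabla (D j) (D k) y)"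
      by (rule metric_compat[OF co'(4) co'(4) co'(4)])
    also have "g y (nabla (D j) (D i) y) (D k y) = (?\<Gamma> ** ?G) $ i $ k"
      by (subst n) (simp add: g_sum[OF tD tD] gram_def matrix_matrix_mult_def)
    also have "g y (D i y) (nabla (D j) (D k) y) = (?G ** transpose ?\<Gamma>) $ i $ k"
      by (subst n, subst g_sum_right[OF tD tD]) (simp add: gram_def matrix_matrix_mult_def transpose_def mult.commute)
    finally show "D j y (\<lambda>z. g z (D i z) (D k z)) = (?\<Gamma> ** ?G) $ i $ k + (?G ** transpose ?\<Gamma>) $ i $ k" .
  qed
  also have "\<dots> = ?C ** ?G"
  proof -
    have "(P + Q) ** R = P ** R + Q ** R" for P Q R :: "real^'n^'n"
      by (simp add: vec_eq_iff matrix_matrix_mult_def distrib_right sum.distrib)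
    then show ?thesis by (simp add: matrix_mul_assoc[symmetric] B')
  qed
  finally have M: "(\<chi> i k. D j y (\<lambda>z. g z (D i z) (D k z))) = ?C ** (\<chi> i k. g y (D i y) (D k y))"
    by (simp add: gram_def)
  have tr: "trace ?C = 2 * trace ?\<Gamma>"
  proof -
    have "trace ((?G ** transpose ?\<Gamma>) ** B) = trace (B ** (?G ** transpose ?\<Gamma>))" by (rule trace_mul_sym)
    also have "\<dots> = trace ?\<Gamma>" by (simp add: matrix_mul_assoc B' trace_def transpose_def)
    finally show ?thesis by (simp add: trace_add)
  qed
  have div: "trace ?\<Gamma> = vf_div \<A> g nabla (D j) y"
  proof -
    have "nabla (D j) (D k) y (\<xi> k) = nabla (D k) (D j) y (\<xi> k)" for k
    proof -
      \<comment> \<open>Coordinate fields commute: \<open>D\<^sub>b[\<xi>\<^sub>k]\<close> is constant on \<open>N\<close>.\<close>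
      have const: "D a y (\<lambda>z. D b z (\<xi> k)) = 0" for a b
      proof -
        have "D a y (\<lambda>z. D b z (\<xi> k)) = D a y (\<lambda>z. if b = k then 1 else 0)"
          by (rule tan_local[OF tD vf_Cinf[OF co'(4) co'(3)] _ co'(1) y])
            (auto simp: coordinates_dual[OF c co])
        then show ?thesis by (simp add: tan_const[OF tD])
      qed
      show ?thesis using torsion_free[OF co'(4)[of j] co'(4)[of k] co'(3)[of k], of y] const by simp
    qed
    then show ?thesis by (simp add: trace_def vf_div_coordinates[OF c co y co'(4)])
  qed
  show "(\<lambda>z. det (gram D z)) \<in> Cinf \<A>"
    using tan_det(1)[OF tD g_Cinf[OF co'(4) co'(4)] M] by (simp add: gram_def)
  show "D j y (\<lambda>z. det (gram D z)) = 2 * vf_div \<A> g nabla (D j) y * det (gram D y)"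
    using tan_det(2)[OF tD g_Cinf[OF co'(4) co'(4)] M] tr div by (simp add: gram_def)
qed

end

section \<open>Integrals of directional derivatives\<close>

text \<open>The difference quotients of \<open>F\<close> in direction \<open>e\<close> have integral zero by translation invariance. They
converge to \<open>F'\<close> and, by the mean value theorem, are dominated by a constant on the compact set swept
out by \<open>K\<close>.\<close>

lemma integral_derivative_eq_0:
  fixes F F' :: "'e::euclidean_space \<Rightarrow> real" and e :: 'e
  assumes d: "\<And>z. ((\<lambda>t. F (z + t *\<^sub>R e)) has_real_derivative F' z) (at 0)"
    and c: "continuous_on UNIV F" "continuous_on UNIV F'"
    and K: "compact K" "\<And>z. z \<notin> K \<Longrightarrow> F z = 0" "\<And>z. z \<notin> K \<Longrightarrow> F' z = 0"
  shows "integrable lborel F'" "(\<integral>z. F' z \<partial>lborel) = 0"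
proof -
  have int: "integrable lborel f" if f: "continuous_on UNIV f" "\<And>z. z \<notin> K \<Longrightarrow> f z = 0" for f :: "'e \<Rightarrow> real"
  proof -
    obtain B where B: "\<And>z. z \<in> K \<Longrightarrow> norm (f z) \<le> B"
      using compact_imp_bounded[OF compact_continuous_image[OF continuous_on_subset[OF f(1)] K(1)]]
      by (auto simp: bounded_iff)
    show ?thesis
    proof (rule integrableI_bounded_set[of K])
      show "K \<in> sets lborel" using compact_imp_closed[OF K(1)] by simp
      show "f \<in> borel_measurable lborel" using borel_measurable_continuous_onI[OF f(1)] by simp
      show "emeasure lborel K < \<infinity>" by (rule emeasure_compact_finite[OF K(1)])
    qed (use B f(2) in auto)
  qed
  show "integrable lborel F'" by (rule int[OF c(2) K(3)])
  have intF: "integrable lborel F" by (rule int[OF c(1) K(2)])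
  obtain C0 where C0: "\<And>z. z \<in> K \<Longrightarrow> norm (F' z) \<le> C0"
    using compact_imp_bounded[OF compact_continuous_image[OF continuous_on_subset[OF c(2)] K(1)]]
    by (auto simp: bounded_iff)
  define C where "C = max C0 0"
  have C: "\<bar>F' z\<bar> \<le> C" for z
    using C0[of z] K(3)[of z] by (cases "z \<in> K") (auto simp: C_def)
  define K' where "K' = (\<lambda>(t, z). z - t *\<^sub>R e) ` ({0..1} \<times> K)"
  have K': "compact K'" unfolding K'_def
    by (intro compact_continuous_image compact_Times K(1)) (auto simp: split_beta intro!: continuous_intros)
  let ?s = "\<lambda>n z. (F (z + inverse (real (Suc n)) *\<^sub>R e) - F z) * real (Suc n)"
  have dt: "((\<lambda>t. F (z + t *\<^sub>R e)) has_real_derivative F' (z + t *\<^sub>R e)) (at t)" for z t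
    using DERIV_shift[of "\<lambda>t. F (z + t *\<^sub>R e)" "F' (z + t *\<^sub>R e)" 0 t] d[of "z + t *\<^sub>R e"]
    by (simp add: scaleR_add_left add_ac)
  have s_lim: "(\<lambda>n. ?s n z) \<longlonglongrightarrow> F' z" for z
  proof -
    have "((\<lambda>h. (F (z + h *\<^sub>R e) - F z) / h) \<longlongrightarrow> F' z) (at 0)"
      using d[of z] by (simp add: DERIV_def)
    moreover have "filterlim (\<lambda>n. inverse (real (Suc n))) (at 0) sequentially"
      by (rule filterlim_atI[OF LIMSEQ_inverse_real_of_nat]) simp
    ultimately have "(\<lambda>n. (F (z + inverse (real (Suc n)) *\<^sub>R e) - F z) / inverse (real (Suc n))) \<longlonglongrightarrow> F' z"
      by (rule filterlim_compose)
    then show ?thesis by (simp add: divide_inverse)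
  qed
  \<comment> \<open>The intermediate point of the mean value theorem lies in \<open>K\<close> only if \<open>z\<close> lies in \<open>K'\<close>.\<close>
  have s_bound: "\<bar>?s n z\<bar> \<le> C * indicator K' z" for n z
  proof -
    let ?h = "inverse (real (Suc n))"
    have h: "0 < ?h" "?h \<le> 1" by (auto simp: field_simps)
    obtain t where t: "0 < t" "t < ?h" "F (z + ?h *\<^sub>R e) - F (z + 0 *\<^sub>R e) = (?h - 0) * F' (z + t *\<^sub>R e)"
      using MVT2[OF h(1), of "\<lambda>t. F (z + t *\<^sub>R e)" "\<lambda>t. F' (z + t *\<^sub>R e)"] dt by blast
    then have s: "?s n z = F' (z + t *\<^sub>R e)" by simp
    show ?thesis
    proof (cases "z + t *\<^sub>R e \<in> K")
      case True
      then have "z \<in> K'" unfolding K'_def using t h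
        by (intro image_eqI[of _ _ "(t, z + t *\<^sub>R e)"]) auto
      then show ?thesis unfolding s using C by simp
    next
      case False
      then show ?thesis unfolding s using K(3) by (simp add: C_def)
    qed
  qed
  have mF: "F \<in> borel_measurable borel" by (rule borel_measurable_continuous_onI[OF c(1)])
  have shift: "integrable lborel (\<lambda>z. F (z + a))" "(\<integral>z. F (z + a) \<partial>lborel) = (\<integral>z. F z \<partial>lborel)" for a
  proof -
    have D: "distr lborel borel ((+) a) = lborel" by (rule lborel_distr_plus)
    have "integrable (distr lborel borel ((+) a)) F" using intF by (simp add: D)
    then show "integrable lborel (\<lambda>z. F (z + a))"
      by (subst (asm) integrable_distr_eq) (use mF in \<open>simp_all add: add.commute\<close>)
    have "(\<integral>z. F z \<partial>distr lborel borel ((+) a)) = (\<integral>z. F (a + z) \<partial>lborel)"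
      by (rule integral_distr) (use mF in simp_all)
    then show "(\<integral>z. F (z + a) \<partial>lborel) = (\<integral>z. F z \<partial>lborel)" by (simp add: D add.commute)
  qed
  have s0: "(\<integral>z. ?s n z \<partial>lborel) = 0" for n
    using shift[of "inverse (real (Suc n)) *\<^sub>R e"] intF by simp
  have "(\<lambda>n. \<integral>z. ?s n z \<partial>lborel) \<longlonglongrightarrow> (\<integral>z. F' z \<partial>lborel)"
  proof (rule integral_dominated_convergence[where w="\<lambda>z. C * indicator K' z"])
    show "F' \<in> borel_measurable lborel" using borel_measurable_continuous_onI[OF c(2)] by simp
    have "(\<lambda>z. F (z + inverse (real (Suc n)) *\<^sub>R e)) \<in> borel_measurable borel" for n
      by (rule measurable_compose[OF _ mF]) simp
    then show "(\<lambda>z. ?s n z) \<in> borel_measurable lborel" for n using mF by simp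
    have "K' \<in> sets lborel" using compact_imp_closed[OF K'] by simp
    then show "integrable lborel (\<lambda>z. C * indicator K' z)"
      using emeasure_compact_finite[OF K'] by (intro integrable_mult_right integrable_real_indicator)
  qed (use s_lim s_bound in auto)
  then have "(\<lambda>n. 0) \<longlonglongrightarrow> (\<integral>z. F' z \<partial>lborel)" unfolding s0 .
  then show "(\<integral>z. F' z \<partial>lborel) = 0" by (simp add: LIMSEQ_const_iff)
qed

lemma (in smooth_manifold) Cinf_cI:
  assumes "f \<in> Cinf \<A>" "compact K" "\<And>y. y \<notin> K \<Longrightarrow> f y = 0"
  shows "f \<in> Cinf_c \<A>"
proof -
  have "closure {x. f x \<noteq> 0} \<subseteq> K"
    using assms(3) by (intro closure_minimal compact_imp_closed[OF assms(2)]) auto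
  then have "compact (K \<inter> closure {x. f x \<noteq> 0})" by (intro compact_Int_closed assms(2) closed_closure)
  then have "compact (closure {x. f x \<noteq> 0})" using \<open>closure {x. f x \<noteq> 0} \<subseteq> K\<close> by (simp add: Int_absorb1)
  then show ?thesis using assms(1) by (simp add: Cinf_c_def)
qed

lemma (in smooth_manifold) Cinf_cE:
  assumes "f \<in> Cinf_c \<A>"
  obtains K where "f \<in> Cinf \<A>" "compact K" "\<And>y. y \<notin> K \<Longrightarrow> f y = 0"
proof (rule that)
  show "f \<in> Cinf \<A>" "compact (closure {x. f x \<noteq> 0})" using assms by (simp_all add: Cinf_c_def)
  show "f y = 0" if "y \<notin> closure {x. f x \<noteq> 0}" for y
    using that closure_subset[of "{x. f x \<noteq> 0}"] by blast
qed

section \<open>The Riemannian measure and the divergence theorem\<close>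

locale riemannian_volume_space = riemannian \<A> g nabla
  for \<A> :: "('a::{t2_space, second_countable_topology}, 'n::finite) chart set" and g nabla +
  fixes \<mu> :: "'a measure"
  assumes vol: "riemannian_volume \<A> g \<mu>"
begin

lemma sets_mu [measurable_cong]: "sets \<mu> = sets borel"
  using vol unfolding riemannian_volume_def by blast

text \<open>The density of the Riemannian measure with respect to Lebesgue measure in coordinates, extended by
zero so that integrals over the whole Euclidean space can be used.\<close>

definition chart_density :: "'a set \<Rightarrow> ('a \<Rightarrow> real^'n) \<Rightarrow> 'a set \<Rightarrow> ('n \<Rightarrow> 'a vfield) \<Rightarrow> real^'n \<Rightarrow> real" where
  "chart_density U \<phi> N D z = (if z \<in> \<phi> ` N then sqrt (det (gram D (inv_into U \<phi> z))) else 0)"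

text \<open>The inverse of the chart as a Borel map on the whole Euclidean space; outside the image of \<open>N\<close>, where
the density vanishes, it takes a default value.\<close>

definition chart_inverse :: "'a set \<Rightarrow> ('a \<Rightarrow> real^'n) \<Rightarrow> 'a set \<Rightarrow> real^'n \<Rightarrow> 'a" where
  "chart_inverse U \<phi> N z = (if z \<in> \<phi> ` N then inv_into U \<phi> z else undefined)"

text \<open>Multiples of a vector field by a function supported in a compact set have their divergence
supported there too, since derivations are local.\<close>

lemma vf_div_scale_off:
  assumes X: "X \<in> vector_fields \<A>" and f: "f \<in> Cinf \<A>" and K: "compact K" "\<And>y. y \<notin> K \<Longrightarrow> f y = 0" and y: "y \<notin> K"
  shows "X y f = 0" "vf_div \<A> g nabla (vf_scale f X) y = 0"
proof -
  have "X y f = X y (\<lambda>_. 0)"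
    by (rule tan_local[OF vf_tan[OF X] f Cinf_const, of "- K"]) (use K y compact_imp_closed[OF K(1)] in auto)
  then show "X y f = 0" using tan_const[OF vf_tan[OF X], of y 0] by simp
  then show "vf_div \<A> g nabla (vf_scale f X) y = 0" using vf_div_scale[OF X f, of y] K(2)[OF y] by simp
qed

context
  fixes U :: "'a set" and \<phi> :: "'a \<Rightarrow> real^'n" and N \<xi> D
  assumes c: "(U, \<phi>) \<in> \<A>" and co: "coordinates_on U \<phi> N \<xi> D"
begin

lemma coordinates_subset: "N \<subseteq> U" and coordinates_open: "open N" and coordinates_open_image: "open (\<phi> ` N)"
  using coordinates_onD(1,2)[OF co] chart_open_image'[OF c, of N] by (auto simp: Int_absorb1)

lemma coordinates_inv: "y \<in> N \<Longrightarrow> inv_into U \<phi> (\<phi> y) = y"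
  using coordinates_subset c by auto

lemma coordinates_inv_cont: "continuous_on (\<phi> ` N) (inv_into U \<phi>)"
  by (rule continuous_on_subset[OF chart_inv_cont[OF c]]) (use coordinates_subset in auto)

lemma chart_density_measurable: "chart_density U \<phi> N D \<in> borel_measurable borel"
  unfolding chart_density_def[abs_def]
proof (rule borel_measurable_continuous_on_if)
  show "\<phi> ` N \<in> sets borel" using coordinates_open_image by simp
  show "continuous_on (\<phi> ` N) (\<lambda>z. sqrt (det (gram D (inv_into U \<phi> z))))"
  proof (cases "N = {}")
    case False
    then obtain y where "y \<in> N" by blast
    then have "continuous_on UNIV (\<lambda>z. det (gram D z))"
      by (intro Cinf_continuous gram_det_deriv(1)[OF c co])
    then show ?thesis
      by (intro continuous_intros continuous_on_compose2[OF _ coordinates_inv_cont]) auto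
  qed simp
qed simp

lemma chart_inverse_measurable: "chart_inverse U \<phi> N \<in> borel_measurable borel"
  unfolding chart_inverse_def[abs_def]
  by (rule borel_measurable_continuous_on_if[OF _ coordinates_inv_cont]) (use coordinates_open_image in auto)

lemma chart_density_nonneg: "chart_density U \<phi> N D z \<ge> 0"
  using gram_det_pos(1)[OF c co] coordinates_inv by (auto simp: chart_density_def intro!: less_imp_le)

lemma emeasure_chart:
  assumes B: "B \<in> sets borel" "B \<subseteq> N"
  shows "emeasure \<mu> B = (\<integral>\<^sup>+ z. ennreal (chart_density U \<phi> N D z) * indicator (\<phi> ` B) z \<partial>lborel)"
proof -
  have "emeasure \<mu> B = (\<integral>\<^sup>+ z. ennreal (sqrt (det (gram_matrix \<A> g (U, \<phi>) (inv_into U \<phi> z)))) *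
                 indicator (\<phi> ` B) z \<partial>lborel)"
    using vol c B coordinates_subset unfolding riemannian_volume_def by blast
  also have "\<dots> = (\<integral>\<^sup>+ z. ennreal (chart_density U \<phi> N D z) * indicator (\<phi> ` B) z \<partial>lborel)"
  proof (rule nn_integral_cong)
    fix z
    show "ennreal (sqrt (det (gram_matrix \<A> g (U, \<phi>) (inv_into U \<phi> z)))) * indicator (\<phi> ` B) z
        = ennreal (chart_density U \<phi> N D z) * indicator (\<phi> ` B) z"
    proof (cases "z \<in> \<phi> ` B")
      case True
      then obtain y where y: "y \<in> N" "z = \<phi> y" using B by blast
      then have "gram_matrix \<A> g (U, \<phi>) y = gram D y"
        using coordinates_onD(6)[OF co] by (simp add: gram_matrix_def gram_def)
      then show ?thesis using y coordinates_inv by (simp add: chart_density_def)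
    qed simp
  qed
  finally show ?thesis .
qed

text \<open>The restriction of \<open>\<mu>\<close> to \<open>N\<close> and the image under the inverse chart of the measure with density
\<open>chart_density\<close> agree on Borel sets, hence define the same integral.\<close>

lemma integral_chart:
  fixes F :: "'a \<Rightarrow> real"
  assumes F: "F \<in> borel_measurable borel" "\<And>y. y \<notin> N \<Longrightarrow> F y = 0"
  shows "(\<integral>y. F y \<partial>\<mu>) = (\<integral>z. chart_density U \<phi> N D z * F (chart_inverse U \<phi> N z) \<partial>lborel)"
proof -
  note [measurable] = chart_density_measurable chart_inverse_measurable F(1)
  have N [measurable]: "N \<in> sets borel" using coordinates_open by simp
  have eq: "density \<mu> (\<lambda>y. ennreal (indicator N y)) = distr (density lborel (\<lambda>z. ennreal (chart_density U \<phi> N D z))) borel (chart_inverse U \<phi> N)"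
    (is "?L = ?R")
  proof (rule measure_eqI)
    show "sets ?L = sets ?R" by (simp add: sets_mu)
    fix B assume "B \<in> sets ?L"
    then have B [measurable]: "B \<in> sets borel" by (simp add: sets_mu)
    have "emeasure ?L B = (\<integral>\<^sup>+ y. ennreal (indicator N y) * indicator B y \<partial>\<mu>)"
      by (rule emeasure_density) (auto simp: sets_mu)
    also have "\<dots> = (\<integral>\<^sup>+ y. indicator (N \<inter> B) y \<partial>\<mu>)"
      by (rule nn_integral_cong) (simp split: split_indicator)
    also have "\<dots> = emeasure \<mu> (N \<inter> B)" by (simp add: sets_mu)
    also have "\<dots> = (\<integral>\<^sup>+ z. ennreal (chart_density U \<phi> N D z) * indicator (\<phi> ` (N \<inter> B)) z \<partial>lborel)"
      by (rule emeasure_chart) auto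
    also have "\<dots> = (\<integral>\<^sup>+ z. ennreal (chart_density U \<phi> N D z) * indicator (chart_inverse U \<phi> N -` B) z \<partial>lborel)"
    proof (rule nn_integral_cong)
      fix z
      show "ennreal (chart_density U \<phi> N D z) * indicator (\<phi> ` (N \<inter> B)) z
        = ennreal (chart_density U \<phi> N D z) * indicator (chart_inverse U \<phi> N -` B) z"
      proof (cases "z \<in> \<phi> ` N")
        case True
        then obtain y where y: "y \<in> N" "z = \<phi> y" by blast
        have "\<phi> y \<in> \<phi> ` (N \<inter> B) \<longleftrightarrow> y \<in> B"
          using inj_on_image_mem_iff[OF inj_on_inverseI[of N "inv_into U \<phi>" \<phi>, OF coordinates_inv] y(1), of "N \<inter> B"] y(1)
          by auto
        then show ?thesis using y coordinates_inv[OF y(1)] by (simp add: chart_inverse_def indicator_def)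
      qed (simp add: chart_density_def)
    qed
    also have "\<dots> = emeasure ?R B"
    proof -
      have [measurable]: "chart_inverse U \<phi> N -` B \<in> sets borel"
        using measurable_sets[OF chart_inverse_measurable B] by simp
      show ?thesis by (subst emeasure_distr, simp, simp, subst emeasure_density) auto
    qed
    finally show "emeasure ?L B = emeasure ?R B" .
  qed
  have "(\<integral>y. F y \<partial>\<mu>) = (\<integral>y. indicator N y *\<^sub>R F y \<partial>\<mu>)"
    using F(2) by (intro Bochner_Integration.integral_cong) (auto split: split_indicator)
  also have "\<dots> = (\<integral>y. F y \<partial>?L)"
    by (rule integral_density[symmetric]) (auto simp: sets_mu)
  also have "\<dots> = (\<integral>z. F (chart_inverse U \<phi> N z) \<partial>density lborel (\<lambda>z. ennreal (chart_density U \<phi> N D z)))"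
    unfolding eq by (rule integral_distr) simp_all
  also have "\<dots> = (\<integral>z. chart_density U \<phi> N D z *\<^sub>R F (chart_inverse U \<phi> N z) \<partial>lborel)"
    by (rule integral_density) (auto simp: chart_density_nonneg)
  finally show ?thesis by simp
qed

lemma emeasure_chart_compact_finite:
  assumes K: "compact K" "K \<subseteq> N" shows "emeasure \<mu> K < \<infinity>"
proof -
  have "continuous_on N \<phi>" by (rule continuous_on_subset[OF chart_cont[OF c] coordinates_subset])
  then have cK: "compact (\<phi> ` K)" using K by (intro compact_continuous_image) (auto intro: continuous_on_subset)
  have "bounded ((\<lambda>y. det (gram D y)) ` K)"
  proof (cases "K = {}")
    case False
    then obtain y where "y \<in> N" using K by blast
    then have "continuous_on K (\<lambda>y. det (gram D y))"
      using Cinf_continuous[OF gram_det_deriv(1)[OF c co]] continuous_on_subset by blast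
    then show ?thesis using compact_continuous_image K(1) compact_imp_bounded by blast
  qed simp
  then obtain B where B: "\<And>y. y \<in> K \<Longrightarrow> norm (det (gram D y)) \<le> B" by (auto simp: bounded_iff)
  have "emeasure \<mu> K = (\<integral>\<^sup>+ z. ennreal (chart_density U \<phi> N D z) * indicator (\<phi> ` K) z \<partial>lborel)"
    using compact_imp_closed[OF K(1)] K(2) by (intro emeasure_chart) auto
  also have "\<dots> \<le> (\<integral>\<^sup>+ z. ennreal (sqrt B) * indicator (\<phi> ` K) z \<partial>lborel)"
  proof (rule nn_integral_mono)
    fix z
    show "ennreal (chart_density U \<phi> N D z) * indicator (\<phi> ` K) z \<le> ennreal (sqrt B) * indicator (\<phi> ` K) z"
    proof (cases "z \<in> \<phi> ` K")
      case True
      then obtain y where y: "y \<in> K" "z = \<phi> y" by blast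
      then have "y \<in> N" using K by blast
      then have "chart_density U \<phi> N D z = sqrt (det (gram D y))" using y coordinates_inv by (simp add: chart_density_def)
      moreover have "sqrt (det (gram D y)) \<le> sqrt B" using B[OF y(1)] by simp
      ultimately show ?thesis by (auto intro!: ennreal_leI mult_right_mono)
    qed simp
  qed
  also have "\<dots> = ennreal (sqrt B) * emeasure lborel (\<phi> ` K)"
    using compact_imp_closed[OF cK] by (intro nn_integral_cmult_indicator) auto
  also have "\<dots> < \<infinity>"
    using emeasure_compact_finite[OF cK] by (simp add: ennreal_mult_less_top)
  finally show ?thesis .
qed

text \<open>The density is positive, and a nonempty open set of Euclidean space is not a null set.\<close>

lemma emeasure_chart_open_pos:
  assumes Q: "open Q" "Q \<subseteq> N" "Q \<noteq> {}" shows "emeasure \<mu> Q \<noteq> 0"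
proof
  assume 0: "emeasure \<mu> Q = 0"
  have o: "open (\<phi> ` Q)" using chart_open_image'[OF c Q(1)] Q(2) coordinates_subset by (simp add: Int_absorb1)
  have "(\<integral>\<^sup>+ z. ennreal (chart_density U \<phi> N D z) * indicator (\<phi> ` Q) z \<partial>lborel) = 0"
    using emeasure_chart[of Q] Q 0 by simp
  moreover have "(\<lambda>z. ennreal (chart_density U \<phi> N D z) * indicator (\<phi> ` Q) z) \<in> borel_measurable lborel"
  proof -
    note [measurable] = chart_density_measurable
    have [measurable]: "\<phi> ` Q \<in> sets borel" using o by simp
    show ?thesis by measurable
  qed
  ultimately have ae: "AE z in lborel. ennreal (chart_density U \<phi> N D z) * indicator (\<phi> ` Q) z = 0"
    using nn_integral_0_iff_AE by blast
  have nz: "z \<notin> \<phi> ` Q" if "ennreal (chart_density U \<phi> N D z) * indicator (\<phi> ` Q) z = 0" for z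
  proof
    assume "z \<in> \<phi> ` Q"
    then obtain y where y: "y \<in> Q" "z = \<phi> y" by blast
    then have "y \<in> N" using Q by blast
    then have "chart_density U \<phi> N D z > 0" using y coordinates_inv gram_det_pos(1)[OF c co] by (simp add: chart_density_def)
    then show False using that \<open>z \<in> \<phi> ` Q\<close> by simp
  qed
  have "AE z in lborel. z \<notin> \<phi> ` Q" by (rule eventually_mono[OF ae nz])
  then have "\<phi> ` Q \<in> null_sets lborel" using o by (subst AE_iff_null_sets) auto
  then have "negligible (\<phi> ` Q)" unfolding negligible_iff_null_sets by (rule null_sets_completionI)
  then show False using open_not_negligible[OF o] Q(3) by simp
qed

text \<open>The image of \<open>N\<close> and the complement of the compact image of \<open>K\<close> are open and cover the space, and the
extension by zero is continuous on each of them.\<close>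

lemma chart_extension_continuous:
  assumes u: "continuous_on N u" and K: "compact K" "K \<subseteq> N" "\<And>y. y \<in> N \<Longrightarrow> y \<notin> K \<Longrightarrow> u y = (0::real)"
  shows "continuous_on UNIV (\<lambda>z. if z \<in> \<phi> ` N then u (inv_into U \<phi> z) else 0)" (is "continuous_on _ ?f")
    and "compact (\<phi> ` K)" and "z \<notin> \<phi> ` K \<Longrightarrow> (if z \<in> \<phi> ` N then u (inv_into U \<phi> z) else 0) = 0"
proof -
  have "continuous_on N \<phi>" by (rule continuous_on_subset[OF chart_cont[OF c] coordinates_subset])
  then show cK: "compact (\<phi> ` K)" using K by (intro compact_continuous_image) (auto intro: continuous_on_subset)
  show z: "?f z = 0" if "z \<notin> \<phi> ` K" for z
    using that coordinates_inv by (auto intro!: K(3))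
  have "continuous_on (\<phi> ` N \<union> - \<phi> ` K) ?f"
  proof (rule continuous_on_open_Un[OF coordinates_open_image])
    show "open (- \<phi> ` K)" using compact_imp_closed[OF cK] by auto
    have "continuous_on (\<phi> ` N) (\<lambda>z. u (inv_into U \<phi> z))"
      by (rule continuous_on_compose2[OF u coordinates_inv_cont]) (use coordinates_inv in auto)
    then show "continuous_on (\<phi> ` N) ?f" by (rule continuous_on_eq) simp
    have "continuous_on (- \<phi> ` K) (\<lambda>z. 0::real)" by simp
    then show "continuous_on (- \<phi> ` K) ?f" by (rule continuous_on_eq) (use z in auto)
  qed
  moreover have "\<phi> ` N \<union> - \<phi> ` K = UNIV" using K(2) by auto
  ultimately show "continuous_on UNIV ?f" by simp
qed

text \<open>Put \<open>w = sqrt (det G)\<close> and \<open>h\<^sub>j = f X[\<xi>\<^sub>j]\<close>. On \<open>N\<close> the product rule and \<open>\<partial>\<^sub>j w = (div D\<^sub>j) w\<close> give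
\<open>w div (f X) = \<Sum>\<^sub>j w (D\<^sub>j[h\<^sub>j] + h\<^sub>j div D\<^sub>j) = \<Sum>\<^sub>j \<partial>\<^sub>j (h\<^sub>j w)\<close>, and each \<open>h\<^sub>j w\<close> extends by zero to a
compactly supported function on Euclidean space.\<close>

lemma divergence_theorem_chart:
  assumes X: "X \<in> vector_fields \<A>" and f: "f \<in> Cinf \<A>"
    and K: "compact K" "K \<subseteq> N" "\<And>y. y \<notin> K \<Longrightarrow> f y = 0"
  shows "(\<integral>y. vf_div \<A> g nabla (vf_scale f X) y \<partial>\<mu>) = 0"
proof (cases "N = {}")
  case True
  then have "vf_div \<A> g nabla (vf_scale f X) y = 0" for y
    using vf_div_scale_off(2)[OF X f K(1,3)] K(2) by auto
  then show ?thesis by simp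
next
  case False
  then obtain y0 where y0: "y0 \<in> N" by blast
  note co' = coordinates_onD[OF co]
  let ?I = "inv_into U \<phi>" and ?d = "vf_div \<A> g nabla (vf_scale f X)"
  define h where "h j y = f y * X y (\<xi> j)" for j y
  have h: "h j \<in> Cinf \<A>" for j unfolding h_def by (rule Cinf_mult[OF f vf_Cinf[OF X co'(3)]])
  have h0: "h j y = 0" if "y \<notin> K" for j y using K(3)[OF that] by (simp add: h_def)
  define w where "w y = sqrt (det (gram D y))" for y
  define u where "u j y = (D j y (h j) + h j y * vf_div \<A> g nabla (D j) y) * w y" for j y
  define F where "F j z = (if z \<in> \<phi> ` N then h j (?I z) * w (?I z) else 0)" for j z
  define F' where "F' j z = (if z \<in> \<phi> ` N then u j (?I z) else 0)" for j z
  have cw: "continuous_on N w"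
    unfolding w_def using continuous_on_subset[OF Cinf_continuous[OF gram_det_deriv(1)[OF c co y0]]]
    by (intro continuous_intros) auto
  have ch: "continuous_on N f'" if "f' \<in> Cinf \<A>" for f'
    using continuous_on_subset[OF Cinf_continuous[OF that]] by auto
  have cF: "continuous_on N (\<lambda>y. h j y * w y)" for j
    by (intro continuous_intros cw ch h)
  have cu: "continuous_on N (u j)" for j
    unfolding u_def[abs_def]
    by (rule continuous_on_mult[OF continuous_on_add[OF ch[OF vf_Cinf[OF co'(4) h]]
        continuous_on_mult[OF ch[OF h] ch[OF vf_div_Cinf[OF co'(4)]]]] cw])
  have F0: "h j y * w y = 0" "u j y = 0" if "y \<notin> K" for j y
    using h0[OF that] vf_div_scale_off(1)[OF co'(4) h K(1) h0 that] by (simp_all add: u_def)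
  have div: "?d y = (\<Sum>j\<in>UNIV. D j y (h j) + h j y * vf_div \<A> g nabla (D j) y)" if y: "y \<in> N" for y
  proof -
    have in1: "vf_scale (h j) (D j) \<in> vector_fields \<A>" for j by (rule vf_scale_in[OF h co'(4)])
    have "?d y = vf_div \<A> g nabla (vf_sum UNIV (\<lambda>j. vf_scale (h j) (D j))) y"
    proof (rule vf_div_local[OF vf_scale_in[OF f X] vf_sum_in[OF in1] coordinates_open y])
      fix y' assume y': "y' \<in> N"
      show "vf_scale f X y' = vf_sum UNIV (\<lambda>j. vf_scale (h j) (D j)) y'"
      proof
        fix q
        have "X y' q = (\<Sum>j\<in>UNIV. X y' (\<xi> j) * D j y' q)"
          by (rule coordinates_expand[OF c co y' vf_tan[OF X]])
        then show "vf_scale f X y' q = vf_sum UNIV (\<lambda>j. vf_scale (h j) (D j)) y' q"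
          by (simp add: vf_scale_def vf_sum_def h_def sum_distrib_left mult_ac)
      qed
    qed
    also have "\<dots> = (\<Sum>j\<in>UNIV. vf_div \<A> g nabla (vf_scale (h j) (D j)) y)"
      by (rule vf_div_sum[OF finite in1])
    also have "\<dots> = (\<Sum>j\<in>UNIV. D j y (h j) + h j y * vf_div \<A> g nabla (D j) y)"
      by (simp add: vf_div_scale[OF co'(4) h] add.commute)
    finally show ?thesis .
  qed
  have partial: "((f' \<circ> ?I) has_derivative frechet_derivative (f' \<circ> ?I) (at (\<phi> y))) (at (\<phi> y))"
    "frechet_derivative (f' \<circ> ?I) (at (\<phi> y)) (axis j 1) = D j y f'"
    if y: "y \<in> N" and f': "f' \<in> Cinf \<A>" for y f' j
    using Cinf_chart_has_derivative[OF c _ f', of y] y coordinates_subset coord_vector_cong[OF f', of U \<phi> j y] co'(6)[OF y]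
    by auto
  have line: "((\<lambda>t. f' (?I (z + t *\<^sub>R axis j 1))) has_real_derivative D j (?I z) f') (at 0)"
    if z: "z \<in> \<phi> ` N" and f': "f' \<in> Cinf \<A>" for z f' j
  proof -
    obtain y where y: "y \<in> N" "z = \<phi> y" using z by blast
    have l: "((\<lambda>t. z + t *\<^sub>R axis j 1) has_derivative (\<lambda>t. t *\<^sub>R axis j 1)) (at (0::real))"
      by (auto intro!: derivative_eq_intros)
    have p: "((f' \<circ> ?I) has_derivative frechet_derivative (f' \<circ> ?I) (at z)) (at (z + 0 *\<^sub>R axis j 1))"
      using partial(1)[OF y(1) f'] y(2) by simp
    have "((\<lambda>t. (f' \<circ> ?I) (z + t *\<^sub>R axis j 1)) has_derivative
      (\<lambda>t. frechet_derivative (f' \<circ> ?I) (at z) (t *\<^sub>R axis j 1))) (at 0)"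
      by (rule has_derivative_compose[OF l p])
    moreover have "frechet_derivative (f' \<circ> ?I) (at z) (t *\<^sub>R axis j 1) = D j y f' * t" for t
      using linear_cmul[OF has_derivative_linear[OF p], of t "axis j 1"] partial(2)[OF y(1) f', of j] y(2) by simp
    ultimately show ?thesis using coordinates_inv[OF y(1)] y(2) by (simp add: has_field_derivative_def)
  qed
  have dF: "((\<lambda>t. F j (z + t *\<^sub>R axis j 1)) has_real_derivative F' j z) (at 0)" for j z
  proof -
    have lc: "((\<lambda>t. z + t *\<^sub>R axis j 1) \<longlongrightarrow> z + 0 *\<^sub>R axis j 1) (nhds (0::real))"
      by (intro tendsto_intros filterlim_ident)
    have near: "\<forall>\<^sub>F t in nhds (0::real). z + t *\<^sub>R axis j 1 \<in> Q" if "open Q" "z \<in> Q" for Q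
      using topological_tendstoD[OF lc that(1)] that(2) by simp
    show ?thesis
    proof (cases "z \<in> \<phi> ` N")
      case True
      then obtain y where y: "y \<in> N" "z = \<phi> y" by blast
      have Iz: "?I z = y" using y coordinates_inv by simp
      let ?G = "\<lambda>y. det (gram D y)"
      have G: "((\<lambda>t. ?G (?I (z + t *\<^sub>R axis j 1))) has_real_derivative 2 * vf_div \<A> g nabla (D j) y * ?G y) (at 0)"
        using line[OF True gram_det_deriv(1)[OF c co y(1)], of j] gram_det_deriv(2)[OF c co y(1), of j] Iz by simp
      have Gpos: "?G y > 0" by (rule gram_det_pos(1)[OF c co y(1)])
      \<comment> \<open>The logarithmic derivative of \<open>sqrt (det G)\<close> is half that of \<open>det G\<close>.\<close>
      have W: "((\<lambda>t. w (?I (z + t *\<^sub>R axis j 1))) has_real_derivative vf_div \<A> g nabla (D j) y * w y) (at 0)"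
      proof -
        have s: "(sqrt has_real_derivative inverse (sqrt (?G y)) / 2) (at (?G (?I (z + 0 *\<^sub>R axis j 1))))"
          using DERIV_real_sqrt[OF Gpos] Iz by simp
        have "((\<lambda>t. sqrt (?G (?I (z + t *\<^sub>R axis j 1)))) has_real_derivative
          inverse (sqrt (?G y)) / 2 * (2 * vf_div \<A> g nabla (D j) y * ?G y)) (at 0)"
          by (rule DERIV_chain2[OF s G])
        moreover have "inverse (sqrt (?G y)) / 2 * (2 * vf_div \<A> g nabla (D j) y * ?G y) = vf_div \<A> g nabla (D j) y * w y"
        proof -
          have "inverse s / 2 * (2 * d * (s * s)) = d * s" if "s > 0" for s d :: real
            using that by (simp add: field_simps)
          from this[of "sqrt (?G y)" "vf_div \<A> g nabla (D j) y"] show ?thesis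
            using Gpos by (simp add: w_def)
        qed
        ultimately show ?thesis by (simp only: w_def)
      qed
      have "((\<lambda>t. h j (?I (z + t *\<^sub>R axis j 1)) * w (?I (z + t *\<^sub>R axis j 1))) has_real_derivative F' j z) (at 0)"
        using DERIV_mult[OF line[OF True h, of j j] W] True Iz by (simp add: F'_def u_def algebra_simps)
      moreover have "\<forall>\<^sub>F t in nhds 0. h j (?I (z + t *\<^sub>R axis j 1)) * w (?I (z + t *\<^sub>R axis j 1)) = F j (z + t *\<^sub>R axis j 1)"
        using near[OF coordinates_open_image True] by eventually_elim (simp add: F_def)
      ultimately show ?thesis by (subst (asm) DERIV_cong_ev[OF refl _ refl]) auto
    next
      case False
      then have zK: "z \<in> - \<phi> ` K" using K(2) by auto
      have "open (- \<phi> ` K)"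
        using compact_imp_closed[OF chart_extension_continuous(2)[OF cF K(1,2) F0(1)]] by auto
      from near[OF this zK] have "\<forall>\<^sub>F t in nhds 0. 0 = F j (z + t *\<^sub>R axis j 1)"
        by eventually_elim (use chart_extension_continuous(3)[OF cF[of j] K(1,2) F0(1)] in \<open>simp add: F_def\<close>)
      moreover have "((\<lambda>t. 0) has_real_derivative F' j z) (at 0)" using False by (simp add: F'_def)
      ultimately show ?thesis by (subst (asm) DERIV_cong_ev[OF refl _ refl]) auto
    qed
  qed
  have I: "integrable lborel (F' j)" "(\<integral>z. F' j z \<partial>lborel) = 0" for j
  proof -
    note e1 = chart_extension_continuous[OF cF[of j] K(1,2) F0(1), folded F_def]
    note e2 = chart_extension_continuous[OF cu[of j] K(1,2) F0(2), folded F'_def]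
    show "integrable lborel (F' j)" "(\<integral>z. F' j z \<partial>lborel) = 0"
      using integral_derivative_eq_0[of "F j" "axis j 1" "F' j" "\<phi> ` K", OF dF e1(1) e2(1) e1(2)] e1(3) e2(3)
      unfolding F_def F'_def by blast+
  qed
  have m: "?d \<in> borel_measurable borel"
    by (rule borel_measurable_continuous_onI[OF Cinf_continuous[OF vf_div_Cinf[OF vf_scale_in[OF f X]]]])
  have off: "?d y = 0" if "y \<notin> N" for y using vf_div_scale_off(2)[OF X f K(1,3)] K(2) that by blast
  have "(\<integral>y. ?d y \<partial>\<mu>) = (\<integral>z. chart_density U \<phi> N D z * ?d (chart_inverse U \<phi> N z) \<partial>lborel)"
    by (rule integral_chart[OF m off])
  also have "\<dots> = (\<integral>z. (\<Sum>j\<in>UNIV. F' j z) \<partial>lborel)"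
  proof (rule Bochner_Integration.integral_cong[OF refl])
    fix z
    show "chart_density U \<phi> N D z * ?d (chart_inverse U \<phi> N z) = (\<Sum>j\<in>UNIV. F' j z)"
    proof (cases "z \<in> \<phi> ` N")
      case True
      then have "?I z \<in> N" using coordinates_inv by auto
      then show ?thesis using True
        by (simp add: chart_density_def chart_inverse_def F'_def u_def w_def div sum_distrib_left mult.commute)
    qed (simp add: chart_density_def F'_def)
  qed
  also have "\<dots> = 0" using I by (subst Bochner_Integration.integral_sum) auto
  finally show ?thesis .
qed

end

text \<open>Cutoffs provide around each point an open set inside a compact subset of a coordinate neighbourhood,
where the density is bounded; finitely many of these open sets cover \<open>K\<close>.\<close>

lemma emeasure_compact_finite_mu: "compact K \<Longrightarrow> emeasure \<mu> K < \<infinity>"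
proof -
  assume K: "compact K"
  have "\<exists>M. open M \<and> x \<in> M \<and> emeasure \<mu> M < \<infinity>" for x
  proof -
    obtain U \<phi> N \<xi> D where c: "(U, \<phi>) \<in> \<A>" "x \<in> N" "coordinates_on U \<phi> N \<xi> D" by (rule coordinates_at)
    obtain \<eta> M K where \<eta>: "\<eta> \<in> Cinf \<A>" "open M" "x \<in> M" "M \<subseteq> K" "compact K" "K \<subseteq> N"
      by (rule manifold_bump[OF coordinates_onD(1)[OF c(3)] c(2)]) (rule that; assumption)
    have "emeasure \<mu> M \<le> emeasure \<mu> K"
      using compact_imp_closed[OF \<eta>(5)] \<eta>(4) by (intro emeasure_mono) (auto simp: sets_mu)
    also have "\<dots> < \<infinity>" by (rule emeasure_chart_compact_finite[OF c(1,3) \<eta>(5,6)])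
    finally show ?thesis using \<eta>(2,3) by blast
  qed
  then obtain M where M: "\<And>x. open (M x)" "\<And>x. x \<in> M x" "\<And>x. emeasure \<mu> (M x) < \<infinity>" by metis
  obtain C' where C': "C' \<subseteq> K" "finite C'" "K \<subseteq> (\<Union>x\<in>C'. M x)"
    by (rule compactE_image[OF K, of K M]) (use M in auto)
  have "emeasure \<mu> K \<le> emeasure \<mu> (\<Union>x\<in>C'. M x)"
    using C' M by (intro emeasure_mono) (auto simp: sets_mu)
  also have "\<dots> \<le> (\<Sum>x\<in>C'. emeasure \<mu> (M x))"
    using C' M by (intro emeasure_subadditive_finite) (auto simp: sets_mu)
  also have "(\<Sum>x\<in>S. emeasure \<mu> (M x)) < \<infinity>" if "finite S" for S
    using that by (induction S) (use M(3) in auto)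
  then have "(\<Sum>x\<in>C'. emeasure \<mu> (M x)) < \<infinity>" using C'(2) .
  finally show ?thesis .
qed

lemma integrable_compact_support:
  assumes f: "continuous_on UNIV f" and K: "compact K" "\<And>y. y \<notin> K \<Longrightarrow> f y = (0::real)"
  shows "integrable \<mu> f"
proof -
  obtain B where B: "\<And>z. z \<in> K \<Longrightarrow> norm (f z) \<le> B"
    using compact_imp_bounded[OF compact_continuous_image[OF continuous_on_subset[OF f] K(1)]]
    by (auto simp: bounded_iff)
  show ?thesis
  proof (rule integrableI_bounded_set[of K])
    show "K \<in> sets \<mu>" using compact_imp_closed[OF K(1)] by (simp add: sets_mu)
    show "f \<in> borel_measurable \<mu>"
      using borel_measurable_continuous_onI[OF f] measurable_cong_sets[OF sets_mu refl] by blast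
    show "emeasure \<mu> K < \<infinity>" by (rule emeasure_compact_finite_mu[OF K(1)])
  qed (use B K(2) in auto)
qed

text \<open>Otherwise the set where \<open>r\<close> does not vanish is a nonempty open null set, contradicting the positivity
of the density in coordinates.\<close>

lemma integral_square_eq_0:
  assumes r: "r \<in> Cinf_c \<A>" and 0: "(\<integral>x. r x * r x \<partial>\<mu>) = 0"
  shows "r x = 0"
proof (rule ccontr)
  assume x: "r x \<noteq> 0"
  obtain K where K: "r \<in> Cinf \<A>" "compact K" "\<And>y. y \<notin> K \<Longrightarrow> r y = 0" by (rule Cinf_cE[OF r]) (rule that; assumption)
  have cr: "continuous_on UNIV r" by (rule Cinf_continuous[OF K(1)])
  have "integrable \<mu> (\<lambda>x. r x * r x)"
    by (rule integrable_compact_support[OF _ K(2)]) (use K(3) in \<open>auto intro!: continuous_intros cr\<close>)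
  then have "AE y in \<mu>. r y * r y = 0"
    using 0 by (subst (asm) integral_nonneg_eq_0_iff_AE) auto
  then have ae: "AE y in \<mu>. y \<notin> {y. r y \<noteq> 0}" by eventually_elim simp
  obtain U \<phi> N \<xi> D where c: "(U, \<phi>) \<in> \<A>" "x \<in> N" "coordinates_on U \<phi> N \<xi> D" by (rule coordinates_at)
  let ?Q = "{y. r y \<noteq> 0} \<inter> N"
  have o: "open {y. r y \<noteq> 0}" by (rule open_Collect_neq[OF cr continuous_on_const])
  then have oQ: "open ?Q" using coordinates_onD(1)[OF c(3)] by blast
  have "{y. r y \<noteq> 0} \<in> null_sets \<mu>"
    using ae o by (subst AE_iff_null_sets) (auto simp: sets_mu)
  then have "emeasure \<mu> ?Q = 0"
    using emeasure_mono[of ?Q "{y. r y \<noteq> 0}" \<mu>] o by (auto simp: null_sets_def)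
  moreover have "emeasure \<mu> ?Q \<noteq> 0"
    by (rule emeasure_chart_open_pos[OF c(1,3) oQ]) (use x c in auto)
  ultimately show False by simp
qed

lemma vf_div_integrable:
  assumes X: "X \<in> vector_fields \<A>" and f: "f \<in> Cinf_c \<A>"
  shows "integrable \<mu> (vf_div \<A> g nabla (vf_scale f X))"
proof -
  obtain K where K: "f \<in> Cinf \<A>" "compact K" "\<And>y. y \<notin> K \<Longrightarrow> f y = 0" by (rule Cinf_cE[OF f]) (rule that; assumption)
  show ?thesis
    by (rule integrable_compact_support[OF Cinf_continuous[OF vf_div_Cinf[OF vf_scale_in[OF K(1) X]]] K(2)])
      (rule vf_div_scale_off(2)[OF X K])
qed

text \<open>Finitely many cutoffs \<open>\<eta>\<close>, each supported in a coordinate neighbourhood, satisfy \<open>f \<Prod> (1 - \<eta>) = 0\<close>.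
Splitting \<open>f = f \<eta> + f (1 - \<eta>)\<close> for one cutoff after the other reduces the claim to the coordinate
case. This does the work of a partition of unity without a division by the sum of the cutoffs.\<close>

theorem divergence_theorem:
  assumes X: "X \<in> vector_fields \<A>" and f: "f \<in> Cinf_c \<A>"
  shows "(\<integral>y. vf_div \<A> g nabla (vf_scale f X) y \<partial>\<mu>) = 0"
proof -
  \<comment> \<open>Multiplication by a good function turns a test function into one for which the claim is known.\<close>
  define good where "good \<eta> \<longleftrightarrow> \<eta> \<in> Cinf \<A> \<and> (\<forall>f\<in>Cinf_c \<A>.
    (\<lambda>y. f y * \<eta> y) \<in> Cinf_c \<A> \<and> (\<integral>y. vf_div \<A> g nabla (vf_scale (\<lambda>y. f y * \<eta> y) X) y \<partial>\<mu>) = 0)" for \<eta>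
  have ex: "\<exists>\<eta> M. good \<eta> \<and> open M \<and> x \<in> M \<and> (\<forall>y\<in>M. \<eta> y = 1)" for x
  proof -
    obtain U \<phi> N \<xi> D where c: "(U, \<phi>) \<in> \<A>" "x \<in> N" "coordinates_on U \<phi> N \<xi> D" by (rule coordinates_at)
    obtain \<eta> M K where \<eta>: "\<eta> \<in> Cinf \<A>" "open M" "x \<in> M" "M \<subseteq> K" "compact K" "K \<subseteq> N"
      "\<And>y. y \<in> M \<Longrightarrow> \<eta> y = 1" "\<And>y. y \<notin> K \<Longrightarrow> \<eta> y = 0"
      by (rule manifold_bump[OF coordinates_onD(1)[OF c(3)] c(2)]) (rule that; assumption)
    have "good \<eta>"
      unfolding good_def
    proof (intro conjI ballI)
      fix f assume "f \<in> Cinf_c \<A>"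
      then have f: "f \<in> Cinf \<A>" by (simp add: Cinf_c_def)
      have f\<eta>: "(\<lambda>y. f y * \<eta> y) \<in> Cinf \<A>" by (rule Cinf_mult[OF f \<eta>(1)])
      show "(\<lambda>y. f y * \<eta> y) \<in> Cinf_c \<A>" by (rule Cinf_cI[OF f\<eta> \<eta>(5)]) (use \<eta>(8) in simp)
      show "(\<integral>y. vf_div \<A> g nabla (vf_scale (\<lambda>y. f y * \<eta> y) X) y \<partial>\<mu>) = 0"
        by (rule divergence_theorem_chart[OF c(1,3) X f\<eta> \<eta>(5,6)]) (use \<eta>(8) in simp)
    qed (rule \<eta>(1))
    then show ?thesis using \<eta>(2,3,7) by blast
  qed
  then obtain \<eta> M where \<eta>: "\<And>x. good (\<eta> x)" "\<And>x. open (M x)" "\<And>x. x \<in> M x" "\<And>x y. y \<in> M x \<Longrightarrow> \<eta> x y = 1"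
    by metis
  obtain K where K: "f \<in> Cinf \<A>" "compact K" "\<And>y. y \<notin> K \<Longrightarrow> f y = 0" by (rule Cinf_cE[OF f]) (rule that; assumption)
  obtain T where T: "T \<subseteq> K" "finite T" "K \<subseteq> (\<Union>x\<in>T. M x)"
    by (rule compactE_image[OF K(2), of K M]) (use \<eta> in auto)
  have claim: "(\<integral>y. vf_div \<A> g nabla (vf_scale f X) y \<partial>\<mu>) = 0"
    if "finite T" "f \<in> Cinf_c \<A>" "\<And>y. f y * (\<Prod>x\<in>T. 1 - \<eta> x y) = 0" for T f
    using that
  proof (induction T arbitrary: f)
    case empty
    then have "f = (\<lambda>_. 0)" by auto
    then show ?case using vf_div_scale[OF X Cinf_const, of 0] tan_const[OF vf_tan[OF X]] by simp
  next
    case (insert a T)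
    have fC: "f \<in> Cinf \<A>" using insert.prems(1) by (simp add: Cinf_c_def)
    have \<eta>C: "\<eta> a \<in> Cinf \<A>" using \<eta>(1) unfolding good_def by blast
    have 1: "(\<lambda>y. f y * \<eta> a y) \<in> Cinf_c \<A>" "(\<integral>y. vf_div \<A> g nabla (vf_scale (\<lambda>y. f y * \<eta> a y) X) y \<partial>\<mu>) = 0"
      using \<eta>(1)[of a] insert.prems(1) unfolding good_def by blast+
    obtain L where L: "compact L" "\<And>y. y \<notin> L \<Longrightarrow> f y = 0" by (rule Cinf_cE[OF insert.prems(1)]) (rule that; assumption)
    have c2: "(\<lambda>y. f y * (1 - \<eta> a y)) \<in> Cinf \<A>" by (rule Cinf_mult[OF fC Cinf_diff[OF Cinf_const \<eta>C]])
    have 2: "(\<lambda>y. f y * (1 - \<eta> a y)) \<in> Cinf_c \<A>" by (rule Cinf_cI[OF c2 L(1)]) (simp add: L(2))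
    have 3: "(\<integral>y. vf_div \<A> g nabla (vf_scale (\<lambda>y. f y * (1 - \<eta> a y)) X) y \<partial>\<mu>) = 0"
      by (rule insert.IH[OF 2]) (use insert.prems(2) insert.hyps in \<open>simp add: mult.assoc\<close>)
    have c1: "(\<lambda>y. f y * \<eta> a y) \<in> Cinf \<A>" by (rule Cinf_mult[OF fC \<eta>C])
    have "vf_scale f X = vf_add (vf_scale (\<lambda>y. f y * \<eta> a y) X) (vf_scale (\<lambda>y. f y * (1 - \<eta> a y)) X)"
      by (simp add: vf_add_def vf_scale_def algebra_simps)
    then show ?case
      using vf_div_add[OF vf_scale_in[OF c1 X] vf_scale_in[OF c2 X]] 1 3
        vf_div_integrable[OF X 1(1)] vf_div_integrable[OF X 2] by simp
  qed
  show ?thesis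
  proof (rule claim[OF T(2) f])
    fix y
    show "f y * (\<Prod>x\<in>T. 1 - \<eta> x y) = 0"
    proof (cases "y \<in> K")
      case True
      then obtain x where "x \<in> T" "y \<in> M x" using T(3) by blast
      then show ?thesis using \<eta>(4) T(2) by auto
    qed (simp add: K(3))
  qed
qed

end

section \<open>Divergence of the diffusion tensor\<close>

context riemannian
begin

lemma cov_oneform_apply:
  "X \<in> vector_fields \<A> \<Longrightarrow> cov_oneform \<A> nabla Y \<alpha> X x = Y x (\<alpha> X) - \<alpha> (nabla Y X) x"
  by (simp add: cov_oneform_def)

text \<open>The derivative of the coefficient in \<open>Y[\<alpha> (h X)]\<close> cancels against the one in \<open>\<alpha> (\<nabla>\<^sub>Y (h X))\<close>. The outer
tensor divergence evaluates the inner one at the covariant derivative of a coframe element, so this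
derivative has to be a one-form again.\<close>

lemma cov_oneform_in:
  assumes Y: "Y \<in> vector_fields \<A>" and \<alpha>: "\<alpha> \<in> one_forms \<A>"
  shows "cov_oneform \<A> nabla Y \<alpha> \<in> one_forms \<A>"
  unfolding one_forms_def mem_Collect_eq
proof (intro conjI ballI allI impI)
  fix X Z assume X: "X \<in> vector_fields \<A>"
  have *: "cov_oneform \<A> nabla Y \<alpha> X = (\<lambda>x. Y x (\<alpha> X) - \<alpha> (nabla Y X) x)"
    by (rule ext, rule cov_oneform_apply[OF X])
  show "cov_oneform \<A> nabla Y \<alpha> X \<in> Cinf \<A>"
    unfolding * by (rule Cinf_diff[OF vf_Cinf[OF Y one_form_Cinf[OF \<alpha> X]] one_form_Cinf[OF \<alpha> nabla_in[OF Y X]]])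
  show "cov_oneform \<A> nabla Y \<alpha> (vf_scale h X) = (\<lambda>x. h x * cov_oneform \<A> nabla Y \<alpha> X x)" if h: "h \<in> Cinf \<A>" for h
  proof
    fix x
    have Yh: "(\<lambda>x. Y x h) \<in> Cinf \<A>" by (rule vf_Cinf[OF Y h])
    have "\<alpha> (nabla Y (vf_scale h X)) x = Y x h * \<alpha> X x + h x * \<alpha> (nabla Y X) x"
      unfolding nabla_scale2[OF h Y X] one_form_add[OF \<alpha> vf_scale_in[OF Yh X] vf_scale_in[OF h nabla_in[OF Y X]]]
        one_form_scale[OF \<alpha> Yh X] one_form_scale[OF \<alpha> h nabla_in[OF Y X]] ..
    moreover have "Y x (\<alpha> (vf_scale h X)) = h x * Y x (\<alpha> X) + \<alpha> X x * Y x h"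
      unfolding one_form_scale[OF \<alpha> h X] by (rule tan_mult[OF vf_tan[OF Y] h one_form_Cinf[OF \<alpha> X]])
    ultimately show "cov_oneform \<A> nabla Y \<alpha> (vf_scale h X) x = h x * cov_oneform \<A> nabla Y \<alpha> X x"
      by (simp add: cov_oneform_apply X vf_scale_in[OF h X] algebra_simps)
  qed
  assume Z: "Z \<in> vector_fields \<A>"
  show "cov_oneform \<A> nabla Y \<alpha> (vf_add X Z) = (\<lambda>x. cov_oneform \<A> nabla Y \<alpha> X x + cov_oneform \<A> nabla Y \<alpha> Z x)"
  proof
    fix x
    have "\<alpha> (nabla Y (vf_add X Z)) x = \<alpha> (nabla Y X) x + \<alpha> (nabla Y Z) x"
      unfolding nabla_add2[OF Y X Z] one_form_add[OF \<alpha> nabla_in[OF Y X] nabla_in[OF Y Z]] ..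
    moreover have "Y x (\<alpha> (vf_add X Z)) = Y x (\<alpha> X) + Y x (\<alpha> Z)"
      unfolding one_form_add[OF \<alpha> X Z] by (rule tan_add[OF vf_tan[OF Y] one_form_Cinf[OF \<alpha> X] one_form_Cinf[OF \<alpha> Z]])
    ultimately show "cov_oneform \<A> nabla Y \<alpha> (vf_add X Z) x = cov_oneform \<A> nabla Y \<alpha> X x + cov_oneform \<A> nabla Y \<alpha> Z x"
      by (simp add: cov_oneform_apply X Z vf_add_in[OF X Z])
  qed
next
  fix X assume "X \<notin> vector_fields \<A>"
  then show "cov_oneform \<A> nabla Y \<alpha> X = (\<lambda>x. 0)" by (simp add: cov_oneform_def)
qed

lemma one_form_sum:
  assumes \<alpha>: "\<alpha> \<in> one_forms \<A>" and I: "finite I" "\<And>i. i \<in> I \<Longrightarrow> X i \<in> vector_fields \<A>"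
  shows "\<alpha> (vf_sum I X) x = (\<Sum>i\<in>I. \<alpha> (X i) x)"
proof -
  have "\<alpha> (vf_sum I X) x = (\<Sum>i\<in>I. 1 * \<alpha> (X i) x)"
    by (rule one_form_tensorial[OF \<alpha> vf_sum_in I(1)]) (use I in \<open>simp_all add: vf_sum_def\<close>)
  then show ?thesis by simp
qed

text \<open>The derivatives of \<open>\<alpha> (\<sigma>\<^sub>i)\<close> and \<open>\<beta> (\<sigma>\<^sub>i)\<close> in the product rule cancel against those in the covariant
derivatives of \<open>\<alpha>\<close> and \<open>\<beta>\<close>; what is left differentiates \<open>p\<close> and the \<open>\<sigma>\<^sub>i\<close>.\<close>

lemma cov_tensor_diffusion:
  assumes Y: "Y \<in> vector_fields \<A>" and \<alpha>: "\<alpha> \<in> one_forms \<A>" and \<beta>: "\<beta> \<in> one_forms \<A>"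
    and p: "p \<in> Cinf \<A>" and \<sigma>: "\<And>i. i \<in> {1..m} \<Longrightarrow> \<sigma> i \<in> vector_fields \<A>"
  shows "cov_tensor \<A> nabla Y (tensor_scale p (diffusion_tensor m \<sigma>)) [\<alpha>, \<beta>] [] x
    = (\<Sum>i=1..m. Y x p * \<alpha> (\<sigma> i) x * \<beta> (\<sigma> i) x
        + p x * (\<alpha> (nabla Y (\<sigma> i)) x * \<beta> (\<sigma> i) x + \<alpha> (\<sigma> i) x * \<beta> (nabla Y (\<sigma> i)) x))"
proof -
  note a = one_form_Cinf[OF \<alpha> \<sigma>] and b = one_form_Cinf[OF \<beta> \<sigma>]
  have S: "(\<lambda>y. \<Sum>i=1..m. \<alpha> (\<sigma> i) y * \<beta> (\<sigma> i) y) \<in> Cinf \<A>"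
    by (rule Cinf_sum, rule Cinf_mult[OF a b])
  have "Y x (\<lambda>y. p y * (\<Sum>i=1..m. \<alpha> (\<sigma> i) y * \<beta> (\<sigma> i) y))
    = p x * Y x (\<lambda>y. \<Sum>i=1..m. \<alpha> (\<sigma> i) y * \<beta> (\<sigma> i) y) + (\<Sum>i=1..m. \<alpha> (\<sigma> i) x * \<beta> (\<sigma> i) x) * Y x p"
    by (rule tan_mult[OF vf_tan[OF Y] p S])
  also have "Y x (\<lambda>y. \<Sum>i=1..m. \<alpha> (\<sigma> i) y * \<beta> (\<sigma> i) y) = (\<Sum>i=1..m. Y x (\<lambda>y. \<alpha> (\<sigma> i) y * \<beta> (\<sigma> i) y))"
    by (rule tan_sum[OF vf_tan[OF Y] Cinf_mult[OF a b]])
  also have "\<dots> = (\<Sum>i=1..m. \<alpha> (\<sigma> i) x * Y x (\<beta> (\<sigma> i)) + \<beta> (\<sigma> i) x * Y x (\<alpha> (\<sigma> i)))"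
    by (rule sum.cong[OF refl], rule tan_mult[OF vf_tan[OF Y] a b])
  finally have 1: "Y x (\<lambda>y. p y * (\<Sum>i=1..m. \<alpha> (\<sigma> i) y * \<beta> (\<sigma> i) y))
    = p x * (\<Sum>i=1..m. \<alpha> (\<sigma> i) x * Y x (\<beta> (\<sigma> i)) + \<beta> (\<sigma> i) x * Y x (\<alpha> (\<sigma> i)))
      + (\<Sum>i=1..m. \<alpha> (\<sigma> i) x * \<beta> (\<sigma> i) x) * Y x p" .
  have 2: "(\<Sum>i=1..m. cov_oneform \<A> nabla Y \<alpha> (\<sigma> i) x * \<beta> (\<sigma> i) x)
    = (\<Sum>i=1..m. (Y x (\<alpha> (\<sigma> i)) - \<alpha> (nabla Y (\<sigma> i)) x) * \<beta> (\<sigma> i) x)"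
    by (rule sum.cong[OF refl]) (simp add: cov_oneform_apply[OF \<sigma>])
  have 3: "(\<Sum>i=1..m. \<alpha> (\<sigma> i) x * cov_oneform \<A> nabla Y \<beta> (\<sigma> i) x)
    = (\<Sum>i=1..m. \<alpha> (\<sigma> i) x * (Y x (\<beta> (\<sigma> i)) - \<beta> (nabla Y (\<sigma> i)) x))"
    by (rule sum.cong[OF refl]) (simp add: cov_oneform_apply[OF \<sigma>])
  have "cov_tensor \<A> nabla Y (tensor_scale p (diffusion_tensor m \<sigma>)) [\<alpha>, \<beta>] [] x
    = Y x (\<lambda>y. p y * (\<Sum>i=1..m. \<alpha> (\<sigma> i) y * \<beta> (\<sigma> i) y))
      - (p x * (\<Sum>i=1..m. cov_oneform \<A> nabla Y \<alpha> (\<sigma> i) x * \<beta> (\<sigma> i) x)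
        + p x * (\<Sum>i=1..m. \<alpha> (\<sigma> i) x * cov_oneform \<A> nabla Y \<beta> (\<sigma> i) x))"
    by (simp add: cov_tensor_def tensor_scale_def diffusion_tensor_def vf_tensor_def numeral_2_eq_2 lessThan_Suc)
  then show ?thesis unfolding 1 2 3
    by (simp add: sum_distrib_left sum_distrib_right sum.distrib[symmetric] sum_subtractf[symmetric] algebra_simps)
qed

text \<open>The vector field that represents the \<open>(1, 0)\<close> tensor field \<open>div (p D)\<close>.\<close>

definition diffusion_flux :: "('a \<Rightarrow> real) \<Rightarrow> nat \<Rightarrow> (nat \<Rightarrow> 'a vfield) \<Rightarrow> 'a vfield" where
  "diffusion_flux p m \<sigma> = vf_sum {1..m} (\<lambda>i.
     vf_add (vf_scale (vf_div \<A> g nabla (vf_scale p (\<sigma> i))) (\<sigma> i)) (vf_scale p (nabla (\<sigma> i) (\<sigma> i))))"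

context
  fixes p m \<sigma>
  assumes p: "p \<in> Cinf \<A>" and \<sigma>: "\<And>i. i \<in> {1..m::nat} \<Longrightarrow> \<sigma> i \<in> vector_fields \<A>"
begin

lemma flux_summand_in:
  assumes i: "i \<in> {1..m}"
  shows "vf_scale (vf_div \<A> g nabla (vf_scale p (\<sigma> i))) (\<sigma> i) \<in> vector_fields \<A>"
    "vf_scale p (nabla (\<sigma> i) (\<sigma> i)) \<in> vector_fields \<A>"
  by (rule vf_scale_in[OF vf_div_Cinf[OF vf_scale_in[OF p \<sigma>[OF i]]] \<sigma>[OF i]],
      rule vf_scale_in[OF p nabla_in[OF \<sigma>[OF i] \<sigma>[OF i]]])

lemma diffusion_flux_in: "diffusion_flux p m \<sigma> \<in> vector_fields \<A>"
  unfolding diffusion_flux_def by (rule vf_sum_in, rule vf_add_in[OF flux_summand_in])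

text \<open>Contraction of the Leibniz rule with the frame: the term with \<open>E\<^sub>k[p]\<close> becomes \<open>\<sigma>[p] \<sigma>\<close>, the term with the
derivative in the first slot becomes \<open>p \<nabla>\<^sub>\<sigma> \<sigma>\<close> by tensoriality, and the term with the derivative in the
second slot becomes \<open>p (div \<sigma>) \<sigma>\<close>. The first and the last combine to \<open>div (p \<sigma>) \<sigma>\<close>.\<close>

lemma tensor_div_diffusion:
  assumes \<alpha>: "\<alpha> \<in> one_forms \<A>"
  shows "tensor_div \<A> g nabla (tensor_scale p (diffusion_tensor m \<sigma>)) [\<alpha>] [] = \<alpha> (diffusion_flux p m \<sigma>)"
proof
  fix x
  obtain E \<epsilon> where F0: "orthonormal_frame \<A> g x = (E, \<epsilon>)" by fastforce
  note F = orthonormal_frameD[OF F0]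
  have A: "(\<Sum>k\<in>UNIV. E k x p * \<epsilon> k (\<sigma> i) x) = \<sigma> i x p" if "i \<in> {1..m}" for i
    using frame_expand(1)[OF F0 \<sigma>[OF that], of p] by (simp add: mult.commute)
  have B: "(\<Sum>k\<in>UNIV. \<epsilon> k (\<sigma> i) x * \<alpha> (nabla (E k) (\<sigma> i)) x) = \<alpha> (nabla (\<sigma> i) (\<sigma> i)) x" if i: "i \<in> {1..m}" for i
    by (rule tensorial_sum[of "\<lambda>X. \<alpha> (nabla X (\<sigma> i)) x" x, OF _ _ \<sigma>[OF i] finite F(1) frame_expand(1)[OF F0 \<sigma>[OF i]], symmetric])
      (simp_all add: nabla_add1 nabla_scale1 \<sigma>[OF i] one_form_add[OF \<alpha>] one_form_scale[OF \<alpha>] nabla_in)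
  have C: "(\<Sum>k\<in>UNIV. \<epsilon> k (nabla (E k) (\<sigma> i)) x) = vf_div \<A> g nabla (\<sigma> i) x" for i
    by (simp add: vf_div_def trace_at_def F0)
  have "tensor_div \<A> g nabla (tensor_scale p (diffusion_tensor m \<sigma>)) [\<alpha>] [] x
    = (\<Sum>k\<in>UNIV. cov_tensor \<A> nabla (E k) (tensor_scale p (diffusion_tensor m \<sigma>)) [\<alpha>, \<epsilon> k] [] x)"
    by (simp add: tensor_div_def F0)
  also have "\<dots> = (\<Sum>k\<in>UNIV. \<Sum>i=1..m. E k x p * \<alpha> (\<sigma> i) x * \<epsilon> k (\<sigma> i) x
        + p x * (\<alpha> (nabla (E k) (\<sigma> i)) x * \<epsilon> k (\<sigma> i) x + \<alpha> (\<sigma> i) x * \<epsilon> k (nabla (E k) (\<sigma> i)) x))"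
    by (rule sum.cong[OF refl], rule cov_tensor_diffusion[OF F(1) \<alpha> F(2) p \<sigma>])
  also have "\<dots> = (\<Sum>i=1..m. \<Sum>k\<in>UNIV. E k x p * \<alpha> (\<sigma> i) x * \<epsilon> k (\<sigma> i) x
        + p x * (\<alpha> (nabla (E k) (\<sigma> i)) x * \<epsilon> k (\<sigma> i) x + \<alpha> (\<sigma> i) x * \<epsilon> k (nabla (E k) (\<sigma> i)) x))"
    by (rule sum.swap)
  also have "\<dots> = (\<Sum>i=1..m. \<alpha> (vf_add (vf_scale (vf_div \<A> g nabla (vf_scale p (\<sigma> i))) (\<sigma> i)) (vf_scale p (nabla (\<sigma> i) (\<sigma> i)))) x)"
  proof (rule sum.cong[OF refl])
    fix i assume i: "i \<in> {1..m}"
    have "(\<Sum>k\<in>UNIV. E k x p * \<alpha> (\<sigma> i) x * \<epsilon> k (\<sigma> i) x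
        + p x * (\<alpha> (nabla (E k) (\<sigma> i)) x * \<epsilon> k (\<sigma> i) x + \<alpha> (\<sigma> i) x * \<epsilon> k (nabla (E k) (\<sigma> i)) x))
      = \<alpha> (\<sigma> i) x * (\<Sum>k\<in>UNIV. E k x p * \<epsilon> k (\<sigma> i) x)
        + p x * ((\<Sum>k\<in>UNIV. \<epsilon> k (\<sigma> i) x * \<alpha> (nabla (E k) (\<sigma> i)) x)
        + \<alpha> (\<sigma> i) x * (\<Sum>k\<in>UNIV. \<epsilon> k (nabla (E k) (\<sigma> i)) x))"
      by (simp add: sum.distrib sum_distrib_left algebra_simps)
    also have "\<dots> = \<alpha> (\<sigma> i) x * \<sigma> i x p + p x * (\<alpha> (nabla (\<sigma> i) (\<sigma> i)) x + \<alpha> (\<sigma> i) x * vf_div \<A> g nabla (\<sigma> i) x)"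
      unfolding A[OF i] B[OF i] C ..
    also have "\<dots> = vf_div \<A> g nabla (vf_scale p (\<sigma> i)) x * \<alpha> (\<sigma> i) x + p x * \<alpha> (nabla (\<sigma> i) (\<sigma> i)) x"
      by (simp add: vf_div_scale[OF \<sigma>[OF i] p] algebra_simps)
    also have "\<dots> = \<alpha> (vf_add (vf_scale (vf_div \<A> g nabla (vf_scale p (\<sigma> i))) (\<sigma> i)) (vf_scale p (nabla (\<sigma> i) (\<sigma> i)))) x"
      unfolding one_form_add[OF \<alpha> flux_summand_in[OF i]]
        one_form_scale[OF \<alpha> vf_div_Cinf[OF vf_scale_in[OF p \<sigma>[OF i]]] \<sigma>[OF i]]
        one_form_scale[OF \<alpha> p nabla_in[OF \<sigma>[OF i] \<sigma>[OF i]]] ..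
    finally show "(\<Sum>k\<in>UNIV. E k x p * \<alpha> (\<sigma> i) x * \<epsilon> k (\<sigma> i) x
        + p x * (\<alpha> (nabla (E k) (\<sigma> i)) x * \<epsilon> k (\<sigma> i) x + \<alpha> (\<sigma> i) x * \<epsilon> k (nabla (E k) (\<sigma> i)) x))
      = \<alpha> (vf_add (vf_scale (vf_div \<A> g nabla (vf_scale p (\<sigma> i))) (\<sigma> i)) (vf_scale p (nabla (\<sigma> i) (\<sigma> i)))) x" .
  qed
  also have "\<dots> = \<alpha> (diffusion_flux p m \<sigma>) x"
    unfolding diffusion_flux_def by (rule one_form_sum[OF \<alpha> finite_atLeastAtMost vf_add_in[OF flux_summand_in], symmetric])
  finally show "tensor_div \<A> g nabla (tensor_scale p (diffusion_tensor m \<sigma>)) [\<alpha>] [] x = \<alpha> (diffusion_flux p m \<sigma>) x" .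
qed

text \<open>On a \<open>(1, 0)\<close> tensor field of the form \<open>\<alpha> \<mapsto> \<alpha> V\<close>, the covariant derivative is \<open>\<alpha> \<mapsto> \<alpha> (\<nabla>\<^sub>Y V)\<close>, so
the tensor divergence is the divergence of \<open>V\<close>.\<close>

lemma tensor_div_div_diffusion:
  "tensor_div \<A> g nabla (tensor_div \<A> g nabla (tensor_scale p (diffusion_tensor m \<sigma>))) [] [] x
    = vf_div \<A> g nabla (diffusion_flux p m \<sigma>) x"
proof -
  obtain E \<epsilon> where F0: "orthonormal_frame \<A> g x = (E, \<epsilon>)" by fastforce
  note F = orthonormal_frameD[OF F0]
  let ?S = "tensor_div \<A> g nabla (tensor_scale p (diffusion_tensor m \<sigma>))" and ?V = "diffusion_flux p m \<sigma>"
  have "cov_tensor \<A> nabla (E k) ?S [\<epsilon> k] [] x = \<epsilon> k (nabla (E k) ?V) x" for k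
  proof -
    have "cov_tensor \<A> nabla (E k) ?S [\<epsilon> k] [] x = E k x (?S [\<epsilon> k] []) - ?S [cov_oneform \<A> nabla (E k) (\<epsilon> k)] [] x"
      by (simp add: cov_tensor_def)
    also have "\<dots> = E k x (\<epsilon> k ?V) - cov_oneform \<A> nabla (E k) (\<epsilon> k) ?V x"
      unfolding tensor_div_diffusion[OF F(2)] tensor_div_diffusion[OF cov_oneform_in[OF F(1) F(2)]] ..
    also have "\<dots> = \<epsilon> k (nabla (E k) ?V) x" by (simp add: cov_oneform_apply[OF diffusion_flux_in])
    finally show ?thesis .
  qed
  moreover have "tensor_div \<A> g nabla ?S [] [] x = (\<Sum>k\<in>UNIV. cov_tensor \<A> nabla (E k) ?S [\<epsilon> k] [] x)"
    unfolding tensor_div_def[of \<A> g nabla ?S] by (simp add: F0)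
  ultimately show ?thesis by (simp add: vf_div_def trace_at_def F0)
qed

end

end

section \<open>The adjoint of the generator\<close>

context riemannian_volume_space
begin

lemma Cinf_c_mult:
  assumes "f \<in> Cinf_c \<A>" "h \<in> Cinf \<A>" shows "(\<lambda>x. h x * f x) \<in> Cinf_c \<A>"
proof -
  obtain K where K: "f \<in> Cinf \<A>" "compact K" "\<And>y. y \<notin> K \<Longrightarrow> f y = 0"
    by (rule Cinf_cE[OF assms(1)]) (rule that; assumption)
  show ?thesis by (rule Cinf_cI[OF Cinf_mult[OF assms(2) K(1)] K(2)]) (simp add: K(3))
qed

lemma Cinf_cD: "f \<in> Cinf_c \<A> \<Longrightarrow> f \<in> Cinf \<A>"
  by (simp add: Cinf_c_def)

lemma Cinf_c_integrable: "f \<in> Cinf_c \<A> \<Longrightarrow> integrable \<mu> f"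
  by (erule Cinf_cE) (rule integrable_compact_support[OF Cinf_continuous])

definition fokker_planck :: "('a \<Rightarrow> real) \<Rightarrow> nat \<Rightarrow> (nat \<Rightarrow> 'a vfield) \<Rightarrow> 'a vfield \<Rightarrow> 'a \<Rightarrow> real" where
  "fokker_planck p m \<sigma> Xt x =
     - vf_div \<A> g nabla (vf_scale p Xt) x + 1/2 * vf_div \<A> g nabla (diffusion_flux p m \<sigma>) x"

context
  fixes p m \<sigma> Xt
  assumes p: "p \<in> Cinf_c \<A>" and \<sigma>: "\<And>i. i \<in> {1..m::nat} \<Longrightarrow> \<sigma> i \<in> vector_fields \<A>"
    and Xt: "Xt \<in> vector_fields \<A>"
begin

text \<open>Outside the support of \<open>p\<close> both vector fields under the divergence vanish identically, so the
divergences vanish there as well.\<close>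

lemma fokker_planck_Cinf_c: "fokker_planck p m \<sigma> Xt \<in> Cinf_c \<A>"
proof -
  obtain K where K: "p \<in> Cinf \<A>" "compact K" "\<And>y. y \<notin> K \<Longrightarrow> p y = 0"
    by (rule Cinf_cE[OF p]) (rule that; assumption)
  let ?V = "diffusion_flux p m \<sigma>"
  have V: "?V \<in> vector_fields \<A>" by (rule diffusion_flux_in[OF K(1) \<sigma>])
  have V0: "?V y = vf_scale (\<lambda>_. 0) ?V y" if "y \<in> - K" for y
    using that K(3) vf_div_scale_off(2)[OF \<sigma> K, of _ y]
    by (intro ext) (simp add: diffusion_flux_def vf_sum_def vf_add_def vf_scale_def[of _ "nabla a b" for a b] vf_scale_def[of "vf_div a b c d" for a b c d] vf_scale_def[of "\<lambda>_. 0"])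
  show ?thesis
  proof (rule Cinf_cI[OF _ K(2)])
    show "fokker_planck p m \<sigma> Xt \<in> Cinf \<A>"
      unfolding fokker_planck_def[abs_def]
      by (rule Cinf_add[OF Cinf_minus[OF vf_div_Cinf[OF vf_scale_in[OF K(1) Xt]]] Cinf_mult[OF Cinf_const vf_div_Cinf[OF V]]])
    fix y assume y: "y \<notin> K"
    have "vf_div \<A> g nabla ?V y = vf_div \<A> g nabla (vf_scale (\<lambda>_. 0) ?V) y"
      by (rule vf_div_local[where N = "- K", OF V vf_scale_in[OF Cinf_const V] _ _ V0]) (use y compact_imp_closed[OF K(2)] in auto)
    also have "\<dots> = 0" using vf_div_scale[OF V Cinf_const, of 0] tan_const[OF vf_tan[OF V]] by simp
    finally show "fokker_planck p m \<sigma> Xt y = 0"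
      using vf_div_scale_off(2)[OF Xt K y] by (simp add: fokker_planck_def)
  qed
qed

text \<open>For each noise field, \<open>G\<close> collects the divergences that remain after two integrations by parts. All of
them are divergences of compactly supported multiples of vector fields, so their integrals vanish.\<close>

lemma generator_adjoint:
  assumes q: "q \<in> Cinf_c \<A>"
  shows "L2_inner \<mu> p (ito_generator nabla m Xt \<sigma> q) = L2_inner \<mu> (fokker_planck p m \<sigma> Xt) q"
proof -
  have pC: "p \<in> Cinf \<A>" and qC: "q \<in> Cinf \<A>" using p q by (simp_all add: Cinf_cD)
  let ?u = "\<lambda>i. vf_div \<A> g nabla (vf_scale p (\<sigma> i))" and ?h = "\<lambda>i y. \<sigma> i y q"
  let ?div = "\<lambda>f X. vf_div \<A> g nabla (vf_scale f X)"
  define G where "G i x = ?div (\<lambda>y. ?h i y * p y) (\<sigma> i) x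
     - ?div (\<lambda>y. ?u i y * q y) (\<sigma> i) x - ?div (\<lambda>y. p y * q y) (nabla (\<sigma> i) (\<sigma> i)) x" for i x
  have u: "?u i \<in> Cinf \<A>" if "i \<in> {1..m}" for i by (rule vf_div_Cinf[OF vf_scale_in[OF pC \<sigma>[OF that]]])
  have h: "?h i \<in> Cinf \<A>" if "i \<in> {1..m}" for i by (rule vf_Cinf[OF \<sigma>[OF that] qC])
  note n = nabla_in[OF \<sigma> \<sigma>]
  have assoc: "vf_scale (\<lambda>y. a y * b y) X = vf_scale a (vf_scale b X)" for a b :: "'a \<Rightarrow> real" and X
    by (simp add: vf_scale_def mult.assoc)
  have assoc': "vf_scale (\<lambda>y. a y * b y) X = vf_scale b (vf_scale a X)" for a b :: "'a \<Rightarrow> real" and X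
    by (simp add: vf_scale_def mult_ac)
  have prod: "?div (\<lambda>y. a y * b y) X x = b x * ?div a X x + a x * X x b"
    if "a \<in> Cinf \<A>" "b \<in> Cinf \<A>" "X \<in> vector_fields \<A>" for a b X x
    unfolding assoc' vf_div_scale[OF vf_scale_in[OF that(1,3)] that(2)] by (simp add: vf_scale_def)
  have G_eq: "p x * \<sigma> i x (?h i) - p x * nabla (\<sigma> i) (\<sigma> i) x q
      = q x * (?div (?u i) (\<sigma> i) x + ?div p (nabla (\<sigma> i) (\<sigma> i)) x) + G i x" if i: "i \<in> {1..m}" for i x
    unfolding G_def prod[OF h[OF i] pC \<sigma>[OF i]] prod[OF u[OF i] qC \<sigma>[OF i]] prod[OF pC qC n[OF i i]]
    using vf_div_scale[OF \<sigma>[OF i] pC, of x] vf_div_scale[OF \<sigma>[OF i] h[OF i], of x]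
    by (simp add: algebra_simps)
  have Gint: "integrable \<mu> (G i)" "(\<integral>x. G i x \<partial>\<mu>) = 0" if i: "i \<in> {1..m}" for i
  proof -
    have c: "(\<lambda>y. ?h i y * p y) \<in> Cinf_c \<A>" "(\<lambda>y. ?u i y * q y) \<in> Cinf_c \<A>" "(\<lambda>y. p y * q y) \<in> Cinf_c \<A>"
      by (rule Cinf_c_mult[OF p h[OF i]], rule Cinf_c_mult[OF q u[OF i]], rule Cinf_c_mult[OF q pC])
    show "integrable \<mu> (G i)" "(\<integral>x. G i x \<partial>\<mu>) = 0"
      unfolding G_def
      using vf_div_integrable[OF \<sigma>[OF i] c(1)] vf_div_integrable[OF \<sigma>[OF i] c(2)] vf_div_integrable[OF n[OF i i] c(3)]
        divergence_theorem[OF \<sigma>[OF i] c(1)] divergence_theorem[OF \<sigma>[OF i] c(2)] divergence_theorem[OF n[OF i i] c(3)]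
      by simp_all
  qed
  have flux: "vf_div \<A> g nabla (diffusion_flux p m \<sigma>) x = (\<Sum>i=1..m. ?div (?u i) (\<sigma> i) x + ?div p (nabla (\<sigma> i) (\<sigma> i)) x)" for x
  proof -
    have in1: "vf_scale (?u i) (\<sigma> i) \<in> vector_fields \<A>" if "i \<in> {1..m}" for i
      by (rule vf_scale_in[OF u[OF that] \<sigma>[OF that]])
    have in2: "vf_scale p (nabla (\<sigma> i) (\<sigma> i)) \<in> vector_fields \<A>" if "i \<in> {1..m}" for i
      by (rule vf_scale_in[OF pC n[OF that that]])
    have "vf_div \<A> g nabla (diffusion_flux p m \<sigma>) x
      = (\<Sum>i=1..m. vf_div \<A> g nabla (vf_add (vf_scale (?u i) (\<sigma> i)) (vf_scale p (nabla (\<sigma> i) (\<sigma> i)))) x)"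
      unfolding diffusion_flux_def by (rule vf_div_sum[OF finite_atLeastAtMost vf_add_in[OF in1 in2]])
    also have "\<dots> = (\<Sum>i=1..m. ?div (?u i) (\<sigma> i) x + ?div p (nabla (\<sigma> i) (\<sigma> i)) x)"
      by (rule sum.cong[OF refl vf_div_add[OF in1 in2]])
    finally show ?thesis .
  qed
  let ?pq = "\<lambda>y. p y * q y"
  have pq: "?pq \<in> Cinf_c \<A>" by (rule Cinf_c_mult[OF q pC])
  have eq: "p x * ito_generator nabla m Xt \<sigma> q x
    = fokker_planck p m \<sigma> Xt x * q x + ?div ?pq Xt x + 1/2 * (\<Sum>i=1..m. G i x)" for x
  proof -
    have "p x * ito_generator nabla m Xt \<sigma> q x
      = p x * Xt x q + 1/2 * (\<Sum>i=1..m. p x * \<sigma> i x (?h i) - p x * nabla (\<sigma> i) (\<sigma> i) x q)"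
      by (simp add: ito_generator_def stratonovich_generator_def stratonovich_drift_def sum_subtractf
          sum_distrib_left[symmetric] algebra_simps)
    also have "(\<Sum>i=1..m. p x * \<sigma> i x (?h i) - p x * nabla (\<sigma> i) (\<sigma> i) x q)
      = (\<Sum>i=1..m. q x * (?div (?u i) (\<sigma> i) x + ?div p (nabla (\<sigma> i) (\<sigma> i)) x) + G i x)"
      by (rule sum.cong[OF refl G_eq])
    also have "\<dots> = q x * vf_div \<A> g nabla (diffusion_flux p m \<sigma>) x + (\<Sum>i=1..m. G i x)"
      unfolding flux sum_distrib_left by (rule sum.distrib)
    also have "p x * Xt x q = ?div ?pq Xt x - q x * ?div p Xt x"
      unfolding prod[OF pC qC Xt] by simp
    finally show ?thesis by (simp add: fokker_planck_def algebra_simps)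
  qed
  have i1: "integrable \<mu> (\<lambda>x. fokker_planck p m \<sigma> Xt x * q x)"
    by (rule Cinf_c_integrable[OF Cinf_c_mult[OF q Cinf_cD[OF fokker_planck_Cinf_c]]])
  have S: "integrable \<mu> (\<lambda>x. \<Sum>i=1..m. G i x)" "(\<integral>x. (\<Sum>i=1..m. G i x) \<partial>\<mu>) = 0"
    by (rule Bochner_Integration.integrable_sum, erule Gint(1))
      (subst Bochner_Integration.integral_sum, auto simp: Gint)
  show ?thesis
    unfolding L2_inner_def eq
    using i1 vf_div_integrable[OF Xt pq] divergence_theorem[OF Xt pq] S by simp
qed

lemma fokker_planck_adjoint: "is_L2_adjoint_at \<A> \<mu> (ito_generator nabla m Xt \<sigma>) p (fokker_planck p m \<sigma> Xt)"
  unfolding is_L2_adjoint_at_def using fokker_planck_Cinf_c generator_adjoint by blast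

end

text \<open>The difference of the two candidates is used as a test function.\<close>

lemma L2_adjoint_unique:
  assumes "is_L2_adjoint_at \<A> \<mu> L p r" "is_L2_adjoint_at \<A> \<mu> L p s"
  shows "r = s"
proof
  fix x
  have r: "r \<in> Cinf_c \<A>" and s: "s \<in> Cinf_c \<A>" using assms by (simp_all add: is_L2_adjoint_at_def)
  obtain K where K: "r \<in> Cinf \<A>" "compact K" "\<And>y. y \<notin> K \<Longrightarrow> r y = 0"
    by (rule Cinf_cE[OF r]) (rule that; assumption)
  obtain J where J: "s \<in> Cinf \<A>" "compact J" "\<And>y. y \<notin> J \<Longrightarrow> s y = 0"
    by (rule Cinf_cE[OF s]) (rule that; assumption)
  let ?d = "\<lambda>y. r y - s y"
  have d: "?d \<in> Cinf_c \<A>"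
    by (rule Cinf_cI[OF Cinf_diff[OF K(1) J(1)] compact_Un[OF K(2) J(2)]]) (simp add: K(3) J(3))
  have "L2_inner \<mu> r ?d = L2_inner \<mu> s ?d" using assms d unfolding is_L2_adjoint_at_def by metis
  moreover have "integrable \<mu> (\<lambda>x. r x * ?d x)" "integrable \<mu> (\<lambda>x. s x * ?d x)"
    by (rule Cinf_c_integrable[OF Cinf_c_mult[OF d K(1)]], rule Cinf_c_integrable[OF Cinf_c_mult[OF d J(1)]])
  ultimately have "(\<integral>x. r x * ?d x - s x * ?d x \<partial>\<mu>) = 0"
    unfolding L2_inner_def by (subst Bochner_Integration.integral_diff) simp_all
  then have "(\<integral>x. ?d x * ?d x \<partial>\<mu>) = 0" by (simp add: left_diff_distrib)
  from integral_square_eq_0[OF d this] show "r x = s x" by simp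
qed

end

theorem theorem5:
  fixes \<A> :: "('a::{t2_space, second_countable_topology}, 'n::finite) chart set"
    and g :: "'a metric" and nabla :: "'a connection" and \<mu> :: "'a measure"
    and m :: nat and Xt :: "'a vfield" and \<sigma> :: "nat \<Rightarrow> 'a vfield"
  assumes "riemannian_manifold \<A> g"
    and "levi_civita \<A> g nabla"
    and "riemannian_volume \<A> g \<mu>"
    and "Xt \<in> vector_fields \<A>"
    and "\<forall>i\<in>{1..m}. \<sigma> i \<in> vector_fields \<A>"
  shows "\<forall>p\<in>Cinf_c \<A>.
    (\<exists>!r. is_L2_adjoint_at \<A> \<mu> (ito_generator nabla m Xt \<sigma>) p r) \<and>
    L2_adjoint \<A> \<mu> (ito_generator nabla m Xt \<sigma>) p =
      (\<lambda>x. - vf_div \<A> g nabla (vf_scale p Xt) x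
           + 1/2 * tensor_div \<A> g nabla
               (tensor_div \<A> g nabla (tensor_scale p (diffusion_tensor m \<sigma>))) [] [] x)"
proof
  interpret riemannian_volume_space \<A> g nabla \<mu>
    using assms(1-3) by unfold_locales (simp_all add: riemannian_manifold_def)
  fix p assume p: "p \<in> Cinf_c \<A>"
  note Xt = assms(4)
  have \<sigma>: "\<sigma> i \<in> vector_fields \<A>" if "i \<in> {1..m}" for i using assms(5) that by blast
  let ?L = "ito_generator nabla m Xt \<sigma>"
  let ?r = "\<lambda>x. - vf_div \<A> g nabla (vf_scale p Xt) x
           + 1/2 * tensor_div \<A> g nabla
               (tensor_div \<A> g nabla (tensor_scale p (diffusion_tensor m \<sigma>))) [] [] x"
  have adj: "is_L2_adjoint_at \<A> \<mu> ?L p (fokker_planck p m \<sigma> Xt)"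
    by (rule fokker_planck_adjoint[OF p _ Xt]) (rule \<sigma>)
  have "tensor_div \<A> g nabla (tensor_div \<A> g nabla (tensor_scale p (diffusion_tensor m \<sigma>))) [] [] x
      = vf_div \<A> g nabla (diffusion_flux p m \<sigma>) x" for x
    by (rule tensor_div_div_diffusion[OF Cinf_cD[OF p]]) (rule \<sigma>)
  then have "fokker_planck p m \<sigma> Xt = ?r"
    by (intro ext) (simp add: fokker_planck_def)
  with adj have "is_L2_adjoint_at \<A> \<mu> ?L p ?r" by (simp only:)
  moreover have "s = ?r" if "is_L2_adjoint_at \<A> \<mu> ?L p s" for s
    by (rule L2_adjoint_unique[OF that calculation])
  ultimately show "(\<exists>!r. is_L2_adjoint_at \<A> \<mu> ?L p r) \<and> L2_adjoint \<A> \<mu> ?L p = ?r"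
    unfolding L2_adjoint_def by (intro conjI ex1I[of _ ?r] the_equality)
qed

end
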